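(* Let $T>0$ and let $L$ have coefficients $a=\sigma\sigma^T$, $b$ satisfying conditions (L1)–(L3) of the context. Let $\tau,\lambda\in(0,1]$ and $\beta>0$ satisfy $\tau+\frac12\lambda>1$ and $\beta+\lambda<2$, and let $W:[0,T]\times\mathbb{R}^d\to\mathbb{R}$ satisfy $$\sup_{\substack{0\le s<t\le T\\ x\ne y}}\frac{|W(s,x)-W(t,x)-W(s,y)+W(t,y)|}{(1+|x|+|y|)^\beta|t-s|^\tau|x-y|^\lambda}+\sup_{\substack{0\le s<t\le T\\ x\in\mathbb{R}^d}}\frac{|W(s,x)-W(t,x)|}{(1+|x|)^{\beta+\lambda}|t-s|^\tau}+\sup_{\substack{0\le t\le T\\ x\ne y}}\frac{|W(t,y)-W(t,x)|}{(1+|x|+|y|)^\beta|x-y|^\lambda}<\infty.$$ Suppose there is $\alpha_0\in(0,2)$ (and constants $C_1,C_2$) such that $|u_T(x)|\le C_2e^{C_1|x|^{\alpha_0}}$ for all $x\in\mathbb{R}^d$. Then $$u(r,x)=\mathbb{E}^B\left[u_T(X_T^{r,x})\exp\left(\int_r^TW(ds,X_s^{r,x})\right)\right]$$ is well defined and finite for all $r\in[0,T]$, $x\in\mathbb{R}^d$.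
   Context: $X^{r,x}$ solves $dX^{i,r,x}_t=\sigma^{ij}(t,X^{r,x}_t)\,\delta B^j_t+b^i(t,X^{r,x}_t)\,dt$, $X_r^{r,x}=x$ (summation over repeated indices), where $B$ is a standard $d$-dimensional Brownian motion, $\delta B$ the Itô differential, $\sigma$ the square root matrix of $a$, and $\mathbb{E}^B$ is expectation with respect to $B$ ($W$ is a fixed function; $u_T$ is a measurable function). Conditions: (L1) there are positive ellipticity constants $\lambda_L,\Lambda$ with $\lambda_L|\xi|^2\le\sum a^{ij}(t,x)\xi^i\xi^j\le\Lambda|\xi|^2$ for all $\xi$; (L2) $\sup_t\|a(t,\cdot)\|_{C_b^{2+\alpha}(\mathbb{R}^d)}\le\Lambda$ (for some $\alpha\in(0,1)$); (L3) there is $\kappa(b)>0$ with $\sup_t|b^i(t,x)|\le\kappa(b)(1+|x|)$ and $\sup_t|b^i(t,y)-b^i(t,x)|\le\kappa(b)|y-x|$ for all $x,y$. The integral $\int_r^TW(ds,X_s^{r,x})$ is the pathwise nonlinear Young integral: the limit, as the mesh tends to $0$, of $\sum_i[W(t_{i+1},X_{t_i})-W(t_i,X_{t_i})]$ over partitions of $[r,T]$; it exists because almost every path of $X^{r,x}$ is $\gamma$-Hölder for some $\gamma<1/2$ with $\tau+\lambda\gamma>1$. *)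

theory Defs
  imports "HOL-Probability.Probability"
begin

definition partition_of :: "real \<Rightarrow> real \<Rightarrow> nat \<Rightarrow> (nat \<Rightarrow> real) \<Rightarrow> bool" where
  "partition_of r t n p \<longleftrightarrow> p 0 = r \<and> p n = t \<and> (\<forall>k<n. p k < p (Suc k))"


subsection \<open>Brownian motion\<close>

text \<open>The filtration is arbitrary; the (augmented) filtration generated by \<open>B\<close> is a special case.
  The index type of the library's filtrations is all of \<open>real\<close>, but negative times play no role.\<close>

locale brownian_motion = prob_space M + filtration "space M" F
  for M :: "'w measure" and F :: "real \<Rightarrow> 'w measure" +
  fixes B :: "real \<Rightarrow> 'w \<Rightarrow> real ^ 'n"
  assumes subalgebra_F: "\<And>t. subalgebra M (F t)"
    and adapted: "\<And>t. 0 \<le> t \<Longrightarrow> B t \<in> borel_measurable (F t)"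
    and start: "AE \<omega> in M. B 0 \<omega> = 0"
    and continuous_paths: "AE \<omega> in M. continuous_on {0..} (\<lambda>t. B t \<omega>)"
    and increments_indep: "\<And>s t. 0 \<le> s \<Longrightarrow> s < t \<Longrightarrow>
          indep_set (sets (F s)) {(\<lambda>\<omega>. B t \<omega> - B s \<omega>) -` A \<inter> space M | A. A \<in> sets borel}"
    and increments_normal: "\<And>s t i. 0 \<le> s \<Longrightarrow> s < t \<Longrightarrow>
          distributed M lborel (\<lambda>\<omega>. (B t \<omega> - B s \<omega>) $ i) (normal_density 0 (sqrt (t - s)))"
    and increments_components_indep: "\<And>s t. 0 \<le> s \<Longrightarrow> s < t \<Longrightarrow>
          indep_vars (\<lambda>_. borel) (\<lambda>i \<omega>. (B t \<omega> - B s \<omega>) $ i) UNIV"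


subsection \<open>The Ito integral\<close>

definition tends_to_zero_in_prob :: "'w measure \<Rightarrow> (nat \<Rightarrow> 'w \<Rightarrow> ennreal) \<Rightarrow> bool" where
  "tends_to_zero_in_prob M Z \<longleftrightarrow>
     (\<forall>n. Z n \<in> borel_measurable M) \<and>
     (\<forall>\<epsilon>>0. (\<lambda>n. measure M {\<omega> \<in> space M. Z n \<omega> > ennreal \<epsilon>}) \<longlonglongrightarrow> 0)"

definition progressive_on ::
    "(real \<Rightarrow> 'w measure) \<Rightarrow> real \<Rightarrow> real \<Rightarrow> (real \<Rightarrow> 'w \<Rightarrow> real) \<Rightarrow> bool" where
  "progressive_on F r t H \<longleftrightarrow> (\<forall>u\<in>{r..t}.
     (\<lambda>(s, \<omega>). H s \<omega>) \<in> borel_measurable (restrict_space borel {r..u} \<Otimes>\<^sub>M F u))"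

text \<open>An elementary process is given by a partition \<open>p\<close> and random weights \<open>\<xi>\<close>; weight \<open>\<xi> k\<close>
  is in force on \<open>(p k, p (k+1)]\<close>.\<close>

definition elementary_data ::
    "(real \<Rightarrow> 'w measure) \<Rightarrow> real \<Rightarrow> real \<Rightarrow> nat \<Rightarrow> (nat \<Rightarrow> real) \<Rightarrow> (nat \<Rightarrow> 'w \<Rightarrow> real) \<Rightarrow> bool" where
  "elementary_data F r t n p \<xi> \<longleftrightarrow> partition_of r t n p \<and>
     (\<forall>k<n. \<xi> k \<in> borel_measurable (F (p k)) \<and> (\<exists>c. \<forall>\<omega>\<in>space (F (p k)). \<bar>\<xi> k \<omega>\<bar> \<le> c))"

definition elementary_process ::
    "nat \<Rightarrow> (nat \<Rightarrow> real) \<Rightarrow> (nat \<Rightarrow> 'w \<Rightarrow> real) \<Rightarrow> real \<Rightarrow> 'w \<Rightarrow> real" where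
  "elementary_process n p \<xi> s \<omega> = (\<Sum>k<n. \<xi> k \<omega> * indicator {p k<..p (Suc k)} s)"

definition elementary_integral ::
    "(real \<Rightarrow> 'w \<Rightarrow> real) \<Rightarrow> nat \<Rightarrow> (nat \<Rightarrow> real) \<Rightarrow> (nat \<Rightarrow> 'w \<Rightarrow> real) \<Rightarrow> 'w \<Rightarrow> real" where
  "elementary_integral \<beta> n p \<xi> \<omega> = (\<Sum>k<n. \<xi> k \<omega> * (\<beta> (p (Suc k)) \<omega> - \<beta> (p k) \<omega>))"

text \<open>\<open>I\<close> is (a version of) the Ito integral of \<open>H\<close> against the scalar Brownian motion \<open>\<beta>\<close>
  over \<open>[r, t]\<close>. This is the usual extension in probability from elementary processes to all
  progressive \<open>H\<close> with \<open>\<integral> H\<^sup>2 ds < \<infinity>\<close> almost surely (the latter is forced by the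
  existence of the approximating sequence).\<close>

definition is_ito_integral ::
    "'w measure \<Rightarrow> (real \<Rightarrow> 'w measure) \<Rightarrow> (real \<Rightarrow> 'w \<Rightarrow> real) \<Rightarrow> real \<Rightarrow> real \<Rightarrow>
     (real \<Rightarrow> 'w \<Rightarrow> real) \<Rightarrow> ('w \<Rightarrow> real) \<Rightarrow> bool" where
  "is_ito_integral M F \<beta> r t H I \<longleftrightarrow>
     I \<in> borel_measurable M \<and> progressive_on F r t H \<and>
     (\<exists>n p \<xi>.
        (\<forall>m. elementary_data F r t (n m) (p m) (\<xi> m)) \<and>
        tends_to_zero_in_prob M (\<lambda>m \<omega>. \<integral>\<^sup>+ s\<in>{r..t}.
          ennreal ((elementary_process (n m) (p m) (\<xi> m) s \<omega> - H s \<omega>)\<^sup>2) \<partial>lborel) \<and>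
        tends_to_zero_in_prob M (\<lambda>m \<omega>.
          ennreal \<bar>elementary_integral \<beta> (n m) (p m) (\<xi> m) \<omega> - I \<omega>\<bar>))"


subsection \<open>The stochastic differential equation\<close>

definition is_sqrt_matrix :: "real ^ 'n ^ 'n \<Rightarrow> real ^ 'n ^ 'n \<Rightarrow> bool" where
  "is_sqrt_matrix S A \<longleftrightarrow>
     transpose S = S \<and> (\<forall>\<xi>. 0 \<le> \<xi> \<bullet> (S *v \<xi>)) \<and> S ** transpose S = A"

text \<open>\<open>X\<close> solves \<open>dX = \<sigma>(t,X) \<delta>B + b(t,X) dt\<close> on \<open>[r, T]\<close> with \<open>X\<^sub>r = x\<close>. Since the paths are
  continuous, requiring the integral equation at each \<open>t\<close> almost surely is the same as requiring it
  almost surely at all \<open>t\<close> with the continuous version of the Ito integral.\<close>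

definition sde_solution ::
    "'w measure \<Rightarrow> (real \<Rightarrow> 'w measure) \<Rightarrow> (real \<Rightarrow> 'w \<Rightarrow> real ^ 'n) \<Rightarrow>
     (real \<Rightarrow> real ^ 'n \<Rightarrow> real ^ 'n ^ 'n) \<Rightarrow> (real \<Rightarrow> real ^ 'n \<Rightarrow> real ^ 'n) \<Rightarrow>
     real \<Rightarrow> real \<Rightarrow> real ^ 'n \<Rightarrow> (real \<Rightarrow> 'w \<Rightarrow> real ^ 'n) \<Rightarrow> bool" where
  "sde_solution M F B \<sigma> b T r x X \<longleftrightarrow>
     (\<forall>t\<in>{r..T}. X t \<in> borel_measurable (F t)) \<and>
     (AE \<omega> in M. continuous_on {r..T} (\<lambda>t. X t \<omega>)) \<and>
     (AE \<omega> in M. X r \<omega> = x) \<and>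
     (\<forall>t\<in>{r..T}. \<exists>I.
        (\<forall>i j. is_ito_integral M F (\<lambda>s \<omega>. B s \<omega> $ j) r t (\<lambda>s \<omega>. \<sigma> s (X s \<omega>) $ i $ j) (I i j)) \<and>
        (AE \<omega> in M. \<forall>i.
           set_integrable lborel {r..t} (\<lambda>s. b s (X s \<omega>) $ i) \<and>
           X t \<omega> $ i = x $ i + (\<Sum>j\<in>UNIV. I i j \<omega>) + (LINT s:{r..t}|lborel. b s (X s \<omega>) $ i)))"


subsection \<open>The Hoelder norm of order 2 + alpha\<close>

text \<open>The infimum ranges over the (at most one) pair of first and second derivatives of \<open>f\<close>, so the
  norm is infinite when \<open>f\<close> is not twice differentiable.\<close>

definition Cb2_norm :: "real \<Rightarrow> ('a::real_normed_vector \<Rightarrow> 'b::real_normed_vector) \<Rightarrow> ennreal" where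
  "Cb2_norm \<alpha> f =
     (INF (D, D2) \<in> {(D :: 'a \<Rightarrow> 'a \<Rightarrow>\<^sub>L 'b, D2 :: 'a \<Rightarrow> 'a \<Rightarrow>\<^sub>L 'a \<Rightarrow>\<^sub>L 'b).
                      (\<forall>x. (f has_derivative blinfun_apply (D x)) (at x)) \<and>
                      (\<forall>x. (D has_derivative blinfun_apply (D2 x)) (at x))}.
        (SUP x. ennreal (norm (f x))) + (SUP x. ennreal (norm (D x))) +
        (SUP x. ennreal (norm (D2 x))) +
        (SUP (x, y) \<in> {(x, y). x \<noteq> y}. ennreal (norm (D2 x - D2 y) / norm (x - y) powr \<alpha>)))"


subsection \<open>The weighted Hoelder norm of W and the nonlinear Young integral\<close>

definition W_norm ::
    "real \<Rightarrow> real \<Rightarrow> real \<Rightarrow> real \<Rightarrow> (real \<Rightarrow> 'a::real_normed_vector \<Rightarrow> real) \<Rightarrow> ennreal" where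
  "W_norm T \<tau> lam \<beta> W =
     (SUP (s, t, x, y) \<in> {(s, t, x, y). 0 \<le> s \<and> s < t \<and> t \<le> T \<and> x \<noteq> y}.
        ennreal (\<bar>W s x - W t x - W s y + W t y\<bar> /
          ((1 + norm x + norm y) powr \<beta> * \<bar>t - s\<bar> powr \<tau> * norm (x - y) powr lam))) +
     (SUP (s, t, x) \<in> {(s, t, x). 0 \<le> s \<and> s < t \<and> t \<le> T}.
        ennreal (\<bar>W s x - W t x\<bar> / ((1 + norm x) powr (\<beta> + lam) * \<bar>t - s\<bar> powr \<tau>))) +
     (SUP (t, x, y) \<in> {(t, x, y). 0 \<le> t \<and> t \<le> T \<and> x \<noteq> y}.
        ennreal (\<bar>W t y - W t x\<bar> / ((1 + norm x + norm y) powr \<beta> * norm (x - y) powr lam)))"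

definition has_young_integral ::
    "(real \<Rightarrow> 'a \<Rightarrow> real) \<Rightarrow> (real \<Rightarrow> 'a) \<Rightarrow> real \<Rightarrow> real \<Rightarrow> real \<Rightarrow> bool" where
  "has_young_integral W \<phi> r T J \<longleftrightarrow>
     (\<forall>\<epsilon>>0. \<exists>\<delta>>0. \<forall>n p. partition_of r T n p \<and> (\<forall>k<n. p (Suc k) - p k < \<delta>) \<longrightarrow>
        \<bar>(\<Sum>k<n. W (p (Suc k)) (\<phi> (p k)) - W (p k) (\<phi> (p k))) - J\<bar> < \<epsilon>)"

definition young_integral ::
    "(real \<Rightarrow> 'a \<Rightarrow> real) \<Rightarrow> (real \<Rightarrow> 'a) \<Rightarrow> real \<Rightarrow> real \<Rightarrow> real" where
  "young_integral W \<phi> r T = (THE J. has_young_integral W \<phi> r T J)"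


subsection \<open>The Feynman-Kac functional\<close>

definition fk_variable ::
    "real \<Rightarrow> (real \<Rightarrow> 'a \<Rightarrow> real) \<Rightarrow> ('a \<Rightarrow> real) \<Rightarrow> real \<Rightarrow> (real \<Rightarrow> 'w \<Rightarrow> 'a) \<Rightarrow> 'w \<Rightarrow> real" where
  "fk_variable T W uT r X \<omega> = uT (X T \<omega>) * exp (young_integral W (\<lambda>s. X s \<omega>) r T)"

text \<open>\<open>X r x\<close> is the solution started from \<open>x\<close> at time \<open>r\<close>. The pathwise integral exists only off
  a null set, and the filtered space is not assumed complete; hence the expectation is taken with
  respect to the completion of \<open>M\<close>, so that values on null sets are irrelevant also for
  measurability.\<close>

definition fk_u ::
    "'w measure \<Rightarrow> real \<Rightarrow> (real \<Rightarrow> 'a \<Rightarrow> real) \<Rightarrow> ('a \<Rightarrow> real) \<Rightarrow>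
     (real \<Rightarrow> 'a \<Rightarrow> real \<Rightarrow> 'w \<Rightarrow> 'a) \<Rightarrow> real \<Rightarrow> 'a \<Rightarrow> real" where
  "fk_u M T W uT X r x = (LINT \<omega>|completion M. fk_variable T W uT r (X r x) \<omega>)"

end

theory Submission
  imports Defs
begin

text \<open>Paths of the solution split into a drift and a stochastic integral of a bounded integrand. The
  exponential martingales of elementary integrands pass to the limit and give
  \<open>E exp (\<theta> (I\<^sub>t - I\<^sub>s)) \<le> exp (c \<theta>\<^sup>2 (t - s))\<close>, hence Gaussian moments of the normalised increments.
  Summing these over all dyadic intervals yields an integrable random variable \<open>G\<close> such that, by chaining
  and Gronwall, both the supremum and the Hoelder constant of a path are at most a constant times
  \<open>R = 1 + sqrt (ln G)\<close>. The sewing lemma bounds the Young integral by a multiple of \<open>R\<close> to the power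
  \<open>\<beta> + \<lambda>\<close>, so the functional is at most \<open>exp (c R\<^sup>p)\<close> with \<open>p = max \<alpha>\<^sub>0 (\<beta> + \<lambda>) < 2\<close>, and this is at
  most a multiple of \<open>G\<close>.\<close>

subsection \<open>Partitions\<close>

text \<open>Only the noise needs probability: the drift of linear growth is controlled path by path,
  so the factors in front of \<open>R\<close> are deterministic. Since supremum and Hoelder constant
  are linear in the same \<open>R\<close>, both terms of the Young bound have the same degree
  \<beta> + \<lambda> in \<open>R\<close>. The exponent 2 is the natural limit: \<open>R\<close>
  squared is comparable with \<open>ln G\<close>, and all that is known about \<open>G\<close> is
  that \<open>G = exp (ln G)\<close> is integrable; a power of \<open>R\<close> below 2 is absorbed
  whatever constant stands before it. In the same way \<gamma> < 1/2 pays for the logarithmic loss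
  of a maximum over all dyadic intervals, and \<tau> + \<lambda>/2 > 1 leaves room for such a
  \<gamma> with \<tau> + \<lambda>\<gamma> > 1. One obstacle is that the Ito integrals and the
  integral equation are given for each time separately, up to null sets. The equation is therefore
  used at the countably many dyadic times only, and continuity of the solution supplies the rest.
  Another is that the Young integral is a definite description; its measurability comes from
  explicit Riemann sums and the completion of the measure.\<close>

lemma partition_of_less:
  assumes "partition_of r t n p" "i < j" "j \<le> n"
  shows "p i < p j"
  using assms(2,3)
proof (induction j)
  case (Suc j)
  have "p j < p (Suc j)" using assms(1) Suc.prems by (simp add: partition_of_def)
  with Suc show ?case by (cases "i = j") auto
qed simp

lemma partition_of_le:
  assumes "partition_of r t n p" "i \<le> j" "j \<le> n"
  shows "p i \<le> p j"
  using partition_of_less[OF assms(1), of i j] assms(2,3) by (cases "i = j") auto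

lemma partition_of_bounds:
  assumes "partition_of r t n p" "k \<le> n"
  shows "r \<le> p k" "p k \<le> t"
  using partition_of_le[OF assms(1), of 0 k] partition_of_le[OF assms(1), of k n] assms
  by (auto simp: partition_of_def)

text \<open>Enumerate \<open>D\<close> in increasing order. Applied to the union of the points of
  two partitions, this provides their common refinement.\<close>

lemma partition_of_finite_set:
  assumes "finite D" "r \<in> D" "t \<in> D" "\<forall>x\<in>D. r \<le> x \<and> x \<le> t"
  shows "\<exists>n q. partition_of r t n q \<and> q ` {..n} = D"
proof -
  define xs where "xs = sorted_list_of_set D"
  have xs: "set xs = D" "sorted xs" "distinct xs" "length xs = card D"
    using assms(1) by (auto simp: xs_def)
  have pos: "card D > 0" using assms by (auto simp: card_gt_0_iff)
  have ne: "xs \<noteq> []" using pos xs by auto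
  have less: "xs ! i < xs ! j" if "i < j" "j < card D" for i j
    using that xs by (metis order.strict_trans le_less nless_le nth_eq_iff_index_eq sorted_nth_mono)
  have img: "(!) xs ` {..card D - 1} = D"
  proof -
    have "{..card D - 1} = {..<length xs}" using pos xs by auto
    then show ?thesis using xs(1) by (auto simp: set_conv_nth image_iff)
  qed
  have hd: "xs ! 0 = r"
  proof -
    obtain i where i: "i < card D" "xs ! i = r" using assms(2) xs by (metis in_set_conv_nth)
    have "r \<le> xs ! 0" using assms(4) pos xs by (metis nth_mem)
    with i less[of 0 i] show ?thesis by (cases "i = 0") auto
  qed
  have lt: "xs ! (card D - 1) = t"
  proof -
    obtain i where i: "i < card D" "xs ! i = t" using assms(3) xs by (metis in_set_conv_nth)
    have "xs ! (card D - 1) \<le> t" using assms(4) pos xs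
      by (metis diff_less nth_mem zero_less_one)
    with i less[of i "card D - 1"] show ?thesis by (cases "i < card D - 1"; cases "i = card D - 1") auto
  qed
  have "partition_of r t (card D - 1) ((!) xs)"
    unfolding partition_of_def using hd lt less by auto
  then show ?thesis using img by blast
qed

text \<open>These partitions give both arbitrarily fine meshes and one explicit sequence of Riemann
  sums, from which measurability of the Young integral is read off.\<close>

lemma uniform_partition:
  assumes "r < (T::real)"
  shows "partition_of r T (Suc n) (\<lambda>k. r + (T - r) * real k / real (Suc n))"
  unfolding partition_of_def using assms
  by (auto intro!: divide_strict_right_mono mult_strict_left_mono simp del: of_nat_Suc) 

subsection \<open>The sewing lemma\<close>

text \<open>The partition is split at its last point before the midpoint of the interval; both halves are
  then at most half as long, which gives a geometric recursion because \<open>\<mu> > 1\<close>.\<close>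

lemma sewing_partition_bound:
  fixes A :: "real \<Rightarrow> real \<Rightarrow> real" and p :: "nat \<Rightarrow> real"
  assumes A0: "\<And>s. A s s = 0" and mu: "\<mu> > 1" and Q: "Q \<ge> 0"
    and delta: "\<And>s u v. r \<le> s \<Longrightarrow> s \<le> u \<Longrightarrow> u \<le> v \<Longrightarrow> v \<le> T \<Longrightarrow>
        \<bar>A s v - A s u - A u v\<bar> \<le> Q * (v - s) powr \<mu>"
    and "i \<le> j" "r \<le> p i" "p j \<le> T" "\<forall>k\<in>{i..<j}. p k \<le> p (Suc k)"
  shows "\<bar>(\<Sum>k=i..<j. A (p k) (p (Suc k))) - A (p i) (p j)\<bar>
      \<le> 2 / (1 - 2 powr (1 - \<mu>)) * Q * (p j - p i) powr \<mu>"
  using assms(5-)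
proof (induction "j - i" arbitrary: i j rule: less_induct)
  case less
  \<comment> \<open>\<open>C\<close> is the fixed point of the recursion
    \<open>C = C * (2 / 2 powr \<mu>) + 2\<close>: two halves, each with a factor
    \<open>(1/2) powr \<mu>\<close>, and two additivity defects.\<close>
  define C where "C = 2 / (1 - 2 powr (1 - \<mu>))"
  have "(2::real) powr (1 - \<mu>) < 2 powr 0" using mu by (intro powr_less_mono) auto
  then have lt: "2 powr (1 - \<mu>) < 1" by simp
  then have "1 - 2 powr (1 - \<mu>) \<noteq> 0" by linarith
  then have "C * (1 - 2 powr (1 - \<mu>)) = 2" 
    using nonzero_eq_divide_eq[of "1 - 2 powr (1 - \<mu>)" C 2] C_def by blast
  moreover have C: "C > 0" using lt by (simp add: C_def)
  ultimately have C2: "C * (2 / 2 powr \<mu>) + 2 = C" using powr_diff[of 2 1 \<mu>]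
    by (simp add: right_diff_distrib)
  have mono: "p k \<le> p l" if "i \<le> k" "k \<le> l" "l \<le> j" for k l
    using that(2,1,3) less.prems(4)
  proof (induction l rule: dec_induct)
    case (step l) then show ?case by (force intro: order_trans[of _ "p l"])
  qed simp
  show ?case
  proof (cases "j \<le> Suc i")
    case True
    then have "j = i \<or> j = Suc i" using less.prems by auto
    then show ?thesis using A0 Q C unfolding C_def[symmetric] by auto
  next
    case False
    \<comment> \<open>The cell from \<open>p l\<close> to \<open>p (Suc l)\<close> straddles the
      midpoint and is kept apart. What remains on either side has length at most
      \<open>d / 2\<close> and strictly fewer cells.\<close>
    define m where "m = (p i + p j) / 2"
    define l where "l = Max {k\<in>{i..<j}. p k \<le> m}"
    have ij: "p i \<le> p j" using mono less.prems by auto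
    have ne: "finite {k\<in>{i..<j}. p k \<le> m}" "i \<in> {k\<in>{i..<j}. p k \<le> m}"
      using False ij by (auto simp: m_def)
    have l: "i \<le> l" "l < j" "p l \<le> m"
      using Max_in[OF ne(1)] Max_ge[OF ne] ne(2) unfolding l_def[symmetric] by auto
    have l2: "m \<le> p (Suc l)"
    proof (cases "Suc l = j")
      case True then show ?thesis using ij by (simp add: m_def)
    next
      case False
      then show ?thesis using Max_ge[OF ne(1), of "Suc l"] l unfolding l_def[symmetric] by force
    qed
    define d where "d = p j - p i"
    have d: "d \<ge> 0" using ij d_def by simp
    have half: "(d / 2) powr \<mu> = d powr \<mu> / 2 powr \<mu>" using d by (simp add: powr_divide)
    have bds: "p l \<le> p (Suc l)" "p (Suc l) \<le> p j" "p i \<le> p l"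
      using mono l less.prems by auto
    then have bds': "r \<le> p l" "p l \<le> T" "p (Suc l) \<le> T" "r \<le> p (Suc l)"
      using less.prems by linarith+
    have "\<bar>(\<Sum>k=i..<l. A (p k) (p (Suc k))) - A (p i) (p l)\<bar> \<le> C * Q * (p l - p i) powr \<mu>"
      unfolding C_def using less.prems l bds bds' by (intro less.hyps) auto
    also have "\<dots> \<le> C * Q * (d / 2) powr \<mu>"
      using C Q bds l mu by (intro mult_left_mono powr_mono2) (auto simp: d_def m_def field_simps)
    finally have 1: "\<bar>(\<Sum>k=i..<l. A (p k) (p (Suc k))) - A (p i) (p l)\<bar> \<le> C * Q * (d / 2) powr \<mu>" .
    have "\<bar>(\<Sum>k=Suc l..<j. A (p k) (p (Suc k))) - A (p (Suc l)) (p j)\<bar>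
        \<le> C * Q * (p j - p (Suc l)) powr \<mu>"
      unfolding C_def using less.prems l bds bds' by (intro less.hyps) auto
    also have "\<dots> \<le> C * Q * (d / 2) powr \<mu>"
      using C Q bds l2 mu by (intro mult_left_mono powr_mono2) (auto simp: d_def m_def field_simps)
    finally have 2: "\<bar>(\<Sum>k=Suc l..<j. A (p k) (p (Suc k))) - A (p (Suc l)) (p j)\<bar>
        \<le> C * Q * (d / 2) powr \<mu>" .
    have 3: "\<bar>A (p i) (p j) - A (p i) (p l) - A (p l) (p j)\<bar> \<le> Q * d powr \<mu>"
      unfolding d_def using less.prems bds bds' by (intro delta) auto
    have "\<bar>A (p l) (p j) - A (p l) (p (Suc l)) - A (p (Suc l)) (p j)\<bar> \<le> Q * (p j - p l) powr \<mu>"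
      using less.prems bds bds' by (intro delta) auto
    also have "\<dots> \<le> Q * d powr \<mu>"
      using Q bds mu by (intro mult_left_mono powr_mono2) (auto simp: d_def)
    finally have 4: "\<bar>A (p l) (p j) - A (p l) (p (Suc l)) - A (p (Suc l)) (p j)\<bar> \<le> Q * d powr \<mu>" .
    \<comment> \<open>The two defects \<open>Q * d powr \<mu>\<close> come from cutting the whole
      interval at \<open>p l\<close> and then its right part at \<open>p (Suc l)\<close>.\<close>
    have "(\<Sum>k=i..<j. A (p k) (p (Suc k))) = (\<Sum>k=i..<l. A (p k) (p (Suc k))) +
        (\<Sum>k=l..<j. A (p k) (p (Suc k)))"
      using l by (simp add: sum.atLeastLessThan_concat)
    also have "(\<Sum>k=l..<j. A (p k) (p (Suc k))) = A (p l) (p (Suc l)) +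
        (\<Sum>k=Suc l..<j. A (p k) (p (Suc k)))"
      using l by (simp add: sum.atLeast_Suc_lessThan)
    finally have "\<bar>(\<Sum>k=i..<j. A (p k) (p (Suc k))) - A (p i) (p j)\<bar> \<le>
        2 * (C * Q * (d / 2) powr \<mu>) + 2 * (Q * d powr \<mu>)"
      using 1 2 3 4 by linarith
    also have "\<dots> = (C * (2 / 2 powr \<mu>) + 2) * Q * d powr \<mu>"
      unfolding half by (simp add: field_simps)
    finally show ?thesis unfolding C2 by (simp add: C_def d_def)
  qed
qed

text \<open>Inside each cell of the coarse partition the fine one is again a partition, so the
  previous bound applies cell by cell. One factor of the cell length is kept and telescopes to
  \<open>T - r\<close>; the remaining power \<mu> - 1 is bounded by the mesh.\<close>

lemma sewing_refinement_bound:
  fixes A :: "real \<Rightarrow> real \<Rightarrow> real"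
  assumes A0: "\<And>s. A s s = 0" and mu: "\<mu> > 1" and Q: "Q \<ge> 0"
    and delta: "\<And>s u v. r \<le> s \<Longrightarrow> s \<le> u \<Longrightarrow> u \<le> v \<Longrightarrow> v \<le> T \<Longrightarrow>
        \<bar>A s v - A s u - A u v\<bar> \<le> Q * (v - s) powr \<mu>"
    and p: "partition_of r T n p" and q: "partition_of r T N q"
    and sub: "p ` {..n} \<subseteq> q ` {..N}"
    and mesh: "\<forall>k<n. p (Suc k) - p k < h"
  shows "\<bar>(\<Sum>k<N. A (q k) (q (Suc k))) - (\<Sum>k<n. A (p k) (p (Suc k)))\<bar>
      \<le> 2 / (1 - 2 powr (1 - \<mu>)) * Q * (T - r) * h powr (\<mu> - 1)"
proof -
  define C where "C = 2 / (1 - 2 powr (1 - \<mu>))"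
  have "(2::real) powr (1 - \<mu>) < 2 powr 0" using mu by (intro powr_less_mono) auto
  then have C: "C > 0" by (auto simp: C_def)
  have "\<forall>k\<in>{..n}. \<exists>l. l \<le> N \<and> q l = p k" 
  proof
    fix k assume "k \<in> {..n}"
    then have "p k \<in> q ` {..N}" using sub by blast
    then show "\<exists>l. l \<le> N \<and> q l = p k" by (auto simp: image_iff)
  qed
  \<comment> \<open>\<open>\<iota> k\<close> is the position of the coarse point \<open>p k\<close>
    in the fine partition; it is strictly increasing from 0 to \<open>N\<close>, so the fine sum
    splits into blocks.\<close>
  then obtain \<iota> where \<iota>: "\<And>k. k \<le> n \<Longrightarrow> \<iota> k \<le> N" "\<And>k. k \<le> n \<Longrightarrow> q (\<iota> k) = p k"
    by (metis atMost_iff)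
  have less: "\<iota> k < \<iota> (Suc k)" if "k < n" for k
  proof (rule ccontr)
    assume "\<not> ?thesis"
    then have "q (\<iota> (Suc k)) \<le> q (\<iota> k)" using that by (intro partition_of_le[OF q]) (auto intro: \<iota>)
    then show False using partition_of_less[OF p, of k "Suc k"] that \<iota> by auto
  qed
  have inj: "l = l'" if "q l = q l'" "l \<le> N" "l' \<le> N" for l l'
    using that partition_of_less[OF q] by (metis less_irrefl nat_neq_iff)
  have \<iota>0: "\<iota> 0 = 0" using \<iota>[of 0] p q by (intro inj) (auto simp: partition_of_def)
  have \<iota>n: "\<iota> n = N" using \<iota>[of n] p q by (intro inj) (auto simp: partition_of_def)
  have split: "(\<Sum>l<\<iota> k. A (q l) (q (Suc l))) = (\<Sum>j<k. \<Sum>l=\<iota> j..<\<iota> (Suc j). A (q l) (q (Suc l)))"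
    if "k \<le> n" for k using that
  proof (induction k)
    case 0 then show ?case using \<iota>0 by simp
  next
    case (Suc k)
    have "(\<Sum>l<\<iota> (Suc k). A (q l) (q (Suc l))) = (\<Sum>l<\<iota> k. A (q l) (q (Suc l))) +
        (\<Sum>l=\<iota> k..<\<iota> (Suc k). A (q l) (q (Suc l)))"
      unfolding lessThan_atLeast0 using less[of k] Suc.prems
      by (subst sum.atLeastLessThan_concat) auto
    with Suc show ?case by simp
  qed
  have loc: "\<bar>(\<Sum>l=\<iota> k..<\<iota> (Suc k). A (q l) (q (Suc l))) - A (p k) (p (Suc k))\<bar>
      \<le> C * Q * h powr (\<mu> - 1) * (p (Suc k) - p k)" if k: "k < n" for k
  proof -
    have pos: "p (Suc k) - p k > 0" using partition_of_less[OF p, of k "Suc k"] k by auto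
    have "\<bar>(\<Sum>l=\<iota> k..<\<iota> (Suc k). A (q l) (q (Suc l))) - A (q (\<iota> k)) (q (\<iota> (Suc k)))\<bar>
        \<le> C * Q * (q (\<iota> (Suc k)) - q (\<iota> k)) powr \<mu>"
      unfolding C_def
    proof (rule sewing_partition_bound[OF A0 mu Q delta])
      show "r \<le> q (\<iota> k)" "q (\<iota> (Suc k)) \<le> T"
        using k partition_of_bounds[OF p] \<iota> by auto
      show "\<forall>k\<in>{\<iota> k..<\<iota> (Suc k)}. q k \<le> q (Suc k)"
        using k \<iota>(1)[of "Suc k"] by (auto intro!: partition_of_le[OF q])
    qed (use less[OF k] in auto)
    also have "q (\<iota> (Suc k)) - q (\<iota> k) = p (Suc k) - p k" using k \<iota> by auto
    also have "(p (Suc k) - p k) powr \<mu> = (p (Suc k) - p k) powr (\<mu> - 1) * (p (Suc k) - p k)"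
      using powr_add[of "p (Suc k) - p k" "\<mu> - 1" 1] pos by simp
    also have "C * Q * \<dots> \<le> C * Q * (h powr (\<mu> - 1) * (p (Suc k) - p k))"
      using C Q pos mesh k mu by (intro mult_left_mono mult_right_mono powr_mono2) (auto simp: less_imp_le)
    finally show ?thesis using k \<iota> by (auto simp: mult_ac)
  qed
  have "\<bar>(\<Sum>k<N. A (q k) (q (Suc k))) - (\<Sum>k<n. A (p k) (p (Suc k)))\<bar> =
      \<bar>\<Sum>k<n. (\<Sum>l=\<iota> k..<\<iota> (Suc k). A (q l) (q (Suc l))) - A (p k) (p (Suc k))\<bar>"
    using split[of n] \<iota>n by (simp add: sum_subtractf)
  also have "\<dots> \<le> (\<Sum>k<n. C * Q * h powr (\<mu> - 1) * (p (Suc k) - p k))"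
    by (rule order_trans[OF sum_abs sum_mono]) (auto intro: loc)
  also have "\<dots> = C * Q * h powr (\<mu> - 1) * (T - r)"
    using p by (simp add: sum_distrib_left[symmetric] sum_lessThan_telescope partition_of_def)
  finally show ?thesis unfolding C_def[symmetric] by (simp only: mult_ac)
qed

text \<open>Sums over two partitions of small mesh are compared through a common refinement, which
  makes them Cauchy as the mesh tends to 0. The limit is constructed along the uniform partitions,
  and this sequence is part of the conclusion because it shows later that the limit depends
  measurably on the path.\<close>

lemma sewing:
  fixes A :: "real \<Rightarrow> real \<Rightarrow> real"
  assumes A0: "\<And>s. A s s = 0" and mu: "\<mu> > 1" and Q: "Q \<ge> 0" and rT: "r < T"
    and delta: "\<And>s u v. r \<le> s \<Longrightarrow> s \<le> u \<Longrightarrow> u \<le> v \<Longrightarrow> v \<le> T \<Longrightarrow>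
        \<bar>A s v - A s u - A u v\<bar> \<le> Q * (v - s) powr \<mu>"
  obtains J where
    "\<And>\<epsilon>. \<epsilon> > 0 \<Longrightarrow> \<exists>h>0. \<forall>n p. partition_of r T n p \<and> (\<forall>k<n. p (Suc k) - p k < h) \<longrightarrow>
        \<bar>(\<Sum>k<n. A (p k) (p (Suc k))) - J\<bar> < \<epsilon>"
    "\<bar>J - A r T\<bar> \<le> 2 / (1 - 2 powr (1 - \<mu>)) * Q * (T - r) powr \<mu>"
    "(\<lambda>n. \<Sum>k<Suc n. A (r + (T - r) * real k / real (Suc n))
                       (r + (T - r) * real (Suc k) / real (Suc n))) \<longlonglongrightarrow> J"
proof -
  define C where "C = 2 / (1 - 2 powr (1 - \<mu>)) * Q * (T - r)"
  define S where "S n p = (\<Sum>k<n. A (p k) (p (Suc k)))" for n :: nat and p :: "nat \<Rightarrow> real"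
  define U where "U n k = r + (T - r) * real k / real (Suc n)" for n k :: nat
  have U: "partition_of r T (Suc n) (U n)" for n
    using uniform_partition[OF rT, of n] unfolding U_def .
  have meshU: "U n (Suc k) - U n k = (T - r) / real (Suc n)" for n k
    by (simp add: U_def add_divide_distrib[symmetric] diff_divide_distrib[symmetric] distrib_left
        del: of_nat_Suc) (simp add: algebra_simps)
  have cmp: "\<bar>S n p - S m q\<bar> \<le> 2 * C * h powr (\<mu> - 1)"
    if p: "partition_of r T n p" "\<forall>k<n. p (Suc k) - p k < h"
      and q: "partition_of r T m q" "\<forall>k<m. q (Suc k) - q k < h" for n m p q h
  proof -
    have "r \<in> p ` {..n}" "T \<in> p ` {..n}" using p(1) by (auto simp: partition_of_def image_iff)
    moreover have "r \<le> x \<and> x \<le> T" if "x \<in> p ` {..n} \<union> q ` {..m}" for x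
      using that partition_of_bounds[OF p(1)] partition_of_bounds[OF q(1)] by auto
    ultimately obtain N w where w: "partition_of r T N w" "w ` {..N} = p ` {..n} \<union> q ` {..m}"
      using partition_of_finite_set[of "p ` {..n} \<union> q ` {..m}" r T] by auto
    have "\<bar>S N w - S n p\<bar> \<le> C * h powr (\<mu> - 1)" unfolding S_def C_def
      by (rule sewing_refinement_bound[OF A0 mu Q delta p(1) w(1)]) (use w p in auto)
    moreover have "\<bar>S N w - S m q\<bar> \<le> C * h powr (\<mu> - 1)" unfolding S_def C_def
      by (rule sewing_refinement_bound[OF A0 mu Q delta q(1) w(1)]) (use w q in auto)
    ultimately show ?thesis by linarith
  qed
  have small: "\<exists>h>0. 2 * C * h powr (\<mu> - 1) < \<epsilon>" if "\<epsilon> > 0" for \<epsilon> :: real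
  proof -
    have "((\<lambda>h. h powr (\<mu> - 1)) \<longlongrightarrow> 0 powr (\<mu> - 1)) (at_right 0)"
      using mu by (intro tendsto_powr') (auto simp: eventually_at_filter)
    then have "((\<lambda>h. 2 * C * h powr (\<mu> - 1)) \<longlongrightarrow> 2 * C * 0) (at_right 0)"
      using mu by (intro tendsto_intros) simp
    then have "eventually (\<lambda>h. 2 * C * h powr (\<mu> - 1) < \<epsilon>) (at_right 0)"
      using that by (intro order_tendstoD) auto
    then have "eventually (\<lambda>h. h > 0 \<and> 2 * C * h powr (\<mu> - 1) < \<epsilon>) (at_right 0)"
      using eventually_at_right_less[of 0] by eventually_elim auto
    then show ?thesis using eventually_happens'[OF trivial_limit_at_right_real] by blast
  qed
  have fine: "eventually (\<lambda>n. \<forall>k<Suc n. U n (Suc k) - U n k < h) sequentially" if "h > 0" for h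
  proof -
    have "(\<lambda>n. (T - r) * inverse (real (Suc n))) \<longlonglongrightarrow> (T - r) * 0"
      by (intro tendsto_intros LIMSEQ_inverse_real_of_nat)
    then have "eventually (\<lambda>n. (T - r) * inverse (real (Suc n)) < h) sequentially"
      using that by (intro order_tendstoD) auto
    then show ?thesis unfolding meshU by eventually_elim (simp add: divide_inverse)
  qed
  have "Cauchy (\<lambda>n. S (Suc n) (U n))"
  proof (rule CauchyI')
    fix \<epsilon> :: real assume "\<epsilon> > 0"
    then obtain h where h: "h > 0" "2 * C * h powr (\<mu> - 1) < \<epsilon>" using small by blast
    obtain N where N: "\<And>n. n \<ge> N \<Longrightarrow> \<forall>k<Suc n. U n (Suc k) - U n k < h"
      using fine[OF h(1)] unfolding eventually_sequentially by blast
    show "\<exists>M. \<forall>m\<ge>M. \<forall>n>m. dist (S (Suc m) (U m)) (S (Suc n) (U n)) < \<epsilon>"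
    proof (intro exI[of _ N] allI impI)
      fix m n assume "m \<ge> N" "n > m"
      then have "\<bar>S (Suc m) (U m) - S (Suc n) (U n)\<bar> \<le> 2 * C * h powr (\<mu> - 1)"
        by (intro cmp U N) auto
      then show "dist (S (Suc m) (U m)) (S (Suc n) (U n)) < \<epsilon>" using h by (simp add: dist_real_def)
    qed
  qed
  then obtain J where J: "(\<lambda>n. S (Suc n) (U n)) \<longlonglongrightarrow> J"
    using Cauchy_convergent convergent_def by blast
  show thesis
  proof (rule that[of J])
    fix \<epsilon> :: real assume e: "\<epsilon> > 0"
    then obtain h where h: "h > 0" "2 * C * h powr (\<mu> - 1) < \<epsilon> / 2" using small[of "\<epsilon> / 2"] by auto
    have "eventually (\<lambda>n. \<bar>S (Suc n) (U n) - J\<bar> < \<epsilon> / 2) sequentially"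
      using tendstoD[OF J, of "\<epsilon> / 2"] e by (simp add: dist_real_def)
    with fine[OF h(1)] have "eventually (\<lambda>n. \<bar>S (Suc n) (U n) - J\<bar> < \<epsilon> / 2 \<and>
        (\<forall>k<Suc n. U n (Suc k) - U n k < h)) sequentially" by eventually_elim auto
    then obtain n where n: "\<bar>S (Suc n) (U n) - J\<bar> < \<epsilon> / 2" "\<forall>k<Suc n. U n (Suc k) - U n k < h"
      using eventually_happens'[OF sequentially_bot] by blast
    show "\<exists>h>0. \<forall>n p. partition_of r T n p \<and> (\<forall>k<n. p (Suc k) - p k < h) \<longrightarrow>
        \<bar>(\<Sum>k<n. A (p k) (p (Suc k))) - J\<bar> < \<epsilon>"
    proof (intro exI[of _ h] conjI allI impI h)
      fix m p assume "partition_of r T m p \<and> (\<forall>k<m. p (Suc k) - p k < h)"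
      then have "\<bar>S m p - S (Suc n) (U n)\<bar> \<le> 2 * C * h powr (\<mu> - 1)"
        using cmp[of m p h "Suc n" "U n"] U n(2) by auto
      then show "\<bar>(\<Sum>k<m. A (p k) (p (Suc k))) - J\<bar> < \<epsilon>"
        using n(1) h(2) unfolding S_def[symmetric] by linarith
    qed
  next
    have "\<bar>S (Suc n) (U n) - A r T\<bar> \<le> 2 / (1 - 2 powr (1 - \<mu>)) * Q * (T - r) powr \<mu>" for n
      using sewing_partition_bound[OF A0 mu Q delta, where p = "U n" and i = 0 and j = "Suc n"] U[of n]
        partition_of_le[OF U]
      unfolding S_def partition_of_def lessThan_atLeast0 by auto
    then have "eventually (\<lambda>n. \<bar>S (Suc n) (U n) - A r T\<bar> \<le>
        2 / (1 - 2 powr (1 - \<mu>)) * Q * (T - r) powr \<mu>) sequentially" by simp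
    moreover have "(\<lambda>n. \<bar>S (Suc n) (U n) - A r T\<bar>) \<longlonglongrightarrow> \<bar>J - A r T\<bar>" by (intro tendsto_intros J)
    ultimately show "\<bar>J - A r T\<bar> \<le> 2 / (1 - 2 powr (1 - \<mu>)) * Q * (T - r) powr \<mu>"
      by (intro tendsto_upperbound[OF _ _ sequentially_bot])
  next
    show "(\<lambda>n. \<Sum>k<Suc n. A (r + (T - r) * real k / real (Suc n))
                       (r + (T - r) * real (Suc k) / real (Suc n))) \<longlonglongrightarrow> J"
      using J unfolding S_def U_def .
  qed
qed

subsection \<open>The nonlinear Young integral\<close>

text \<open>Some partition must be finer than both thresholds, otherwise the defining condition
  could hold vacuously for every value. Here \<open>r \<le> T\<close> enters; for
  \<open>r = T\<close> the partition without cells serves.\<close>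

lemma has_young_integral_unique:
  assumes "r \<le> T" "has_young_integral W \<phi> r T J" "has_young_integral W \<phi> r T J'"
  shows "J = J'"
proof (rule ccontr)
  assume "J \<noteq> J'"
  define \<epsilon> where "\<epsilon> = \<bar>J - J'\<bar> / 2"
  have e: "\<epsilon> > 0" using \<open>J \<noteq> J'\<close> by (simp add: \<epsilon>_def)
  obtain h where h: "h > 0" "\<And>n p. partition_of r T n p \<and> (\<forall>k<n. p (Suc k) - p k < h) \<Longrightarrow>
        \<bar>(\<Sum>k<n. W (p (Suc k)) (\<phi> (p k)) - W (p k) (\<phi> (p k))) - J\<bar> < \<epsilon>"
    using assms(2) e unfolding has_young_integral_def by meson
  obtain h' where h': "h' > 0" "\<And>n p. partition_of r T n p \<and> (\<forall>k<n. p (Suc k) - p k < h') \<Longrightarrow>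
        \<bar>(\<Sum>k<n. W (p (Suc k)) (\<phi> (p k)) - W (p k) (\<phi> (p k))) - J'\<bar> < \<epsilon>"
    using assms(3) e unfolding has_young_integral_def by meson
  have "\<exists>n p. partition_of r T n p \<and> (\<forall>k<n. p (Suc k) - p k < min h h')"
  proof (cases "r = T")
    case True
    then have "partition_of r T 0 (\<lambda>_. r)" by (simp add: partition_of_def)
    then show ?thesis by blast
  next
    case False
    then have rT: "r < T" using assms(1) by simp
    obtain n where n: "(T - r) / min h h' < real n" using reals_Archimedean2 by blast
    have "(T - r) / real (Suc n) < min h h'"
    proof -
      have "T - r < real n * min h h'" using n h h' by (simp add: pos_divide_less_eq)
      also have "\<dots> \<le> real (Suc n) * min h h'" using h h' by (intro mult_right_mono) auto
      finally show ?thesis by (subst pos_divide_less_eq) (auto simp: mult.commute)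
    qed
    moreover have "r + (T - r) * real (Suc k) / real (Suc n) - (r + (T - r) * real k / real (Suc n)) =
        (T - r) / real (Suc n)" for k
      by (simp add: add_divide_distrib[symmetric] diff_divide_distrib[symmetric] distrib_left
        del: of_nat_Suc) (simp add: algebra_simps)
    ultimately show ?thesis using uniform_partition[OF rT, of n] by metis
  qed
  then obtain n p where "partition_of r T n p" "\<forall>k<n. p (Suc k) - p k < min h h'" by blast
  with h(2)[of n p] h'(2)[of n p] have "\<bar>J - J'\<bar> < 2 * \<epsilon>" by fastforce
  then show False by (simp add: \<epsilon>_def)
qed

lemma young_integral_eq:
  assumes "r \<le> T" "has_young_integral W \<phi> r T J"
  shows "young_integral W \<phi> r T = J"
  unfolding young_integral_def using assms has_young_integral_unique by blast

lemma has_young_integral_refl: "has_young_integral W \<phi> r r 0"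
  unfolding has_young_integral_def
proof (intro allI impI exI[of _ 1] conjI)
  fix \<epsilon> :: real and n p assume e: "\<epsilon> > 0" and "partition_of r r n p \<and> (\<forall>k<n. p (Suc k) - p k < 1)"
  then have p: "partition_of r r n p" by simp
  have "n = 0" using partition_of_less[OF p, of 0 n] p by (cases n) (auto simp: partition_of_def)
  then show "\<bar>(\<Sum>k<n. W (p (Suc k)) (\<phi> (p k)) - W (p k) (\<phi> (p k))) - 0\<bar> < \<epsilon>" using e by simp
qed simp

text \<open>Sewing for the germ \<open>W t (\<phi> s) - W s (\<phi> s)\<close>: its additivity
  defect is a rectangular increment of \<open>W\<close> over a time interval and the pair
  \<open>\<phi> s\<close>, \<open>\<phi> u\<close>, hence of order \<tau> + \<lambda>\<gamma> > 1.
  The bound displays \<open>S\<close> and \<open>H\<close> because both will be random.\<close>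

lemma young_integral_exists:
  fixes W :: "real \<Rightarrow> 'a::real_normed_vector \<Rightarrow> real"
  assumes r: "0 \<le> r" "r \<le> T" and w: "w \<ge> 0" and beta: "\<beta> > 0" and lam: "lam > 0" and gam: "\<gamma> > 0"
    and tau: "\<tau> > 0" and mu: "\<tau> + lam * \<gamma> > 1"
    and W1: "\<And>s t x y. 0 \<le> s \<Longrightarrow> s \<le> t \<Longrightarrow> t \<le> T \<Longrightarrow> \<bar>W s x - W t x - W s y + W t y\<bar>
        \<le> w * (1 + norm x + norm y) powr \<beta> * (t - s) powr \<tau> * norm (x - y) powr lam"
    and W2: "\<And>s t x. 0 \<le> s \<Longrightarrow> s \<le> t \<Longrightarrow> t \<le> T \<Longrightarrow> \<bar>W s x - W t x\<bar>
        \<le> w * (1 + norm x) powr (\<beta> + lam) * (t - s) powr \<tau>"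
    and H: "H \<ge> 0" and hoelder: "\<And>s t. r \<le> s \<Longrightarrow> s \<le> t \<Longrightarrow> t \<le> T \<Longrightarrow>
        norm (\<phi> t - \<phi> s) \<le> H * (t - s) powr \<gamma>"
    and S: "\<And>s. r \<le> s \<Longrightarrow> s \<le> T \<Longrightarrow> norm (\<phi> s) \<le> S"
  obtains J where "has_young_integral W \<phi> r T J"
    "\<bar>J\<bar> \<le> w * (1 + S) powr (\<beta> + lam) * T powr \<tau> + 2 / (1 - 2 powr (1 - (\<tau> + lam * \<gamma>))) *
        (w * (1 + 2 * S) powr \<beta> * H powr lam) * T powr (\<tau> + lam * \<gamma>)"
    "(\<lambda>n. \<Sum>k<Suc n.
        W (r + (T - r) * real (Suc k) / real (Suc n)) (\<phi> (r + (T - r) * real k / real (Suc n))) -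
        W (r + (T - r) * real k / real (Suc n)) (\<phi> (r + (T - r) * real k / real (Suc n)))) \<longlonglongrightarrow> J"
proof -
  define \<mu> where "\<mu> = \<tau> + lam * \<gamma>"
  define Q where "Q = w * (1 + 2 * S) powr \<beta> * H powr lam"
  define C where "C = 2 / (1 - 2 powr (1 - \<mu>))"
  have "(2::real) powr (1 - \<mu>) < 2 powr 0" using mu by (intro powr_less_mono) (auto simp: \<mu>_def)
  then have C: "C > 0" by (auto simp: C_def)
  have Q: "Q \<ge> 0" using w by (simp add: Q_def)
  have S0: "S \<ge> 0" using S[of r] r norm_ge_zero order_trans by blast
  show thesis
  proof (cases "r = T")
    case True
    then have "has_young_integral W \<phi> r T 0" using has_young_integral_refl by simp
    then show ?thesis using Q C w True by (intro that[of 0]) (auto simp: Q_def C_def \<mu>_def)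
  next
    case False
    then have rT: "r < T" using r by simp
    define A where "A s t = W t (\<phi> s) - W s (\<phi> s)" for s t
    have delta: "\<bar>A s v - A s u - A u v\<bar> \<le> Q * (v - s) powr \<mu>"
      if "r \<le> s" "s \<le> u" "u \<le> v" "v \<le> T" for s u v
    proof -
      have "\<bar>A s v - A s u - A u v\<bar> = \<bar>W u (\<phi> s) - W v (\<phi> s) - W u (\<phi> u) + W v (\<phi> u)\<bar>"
        by (simp add: A_def abs_if)
      also have "\<dots> \<le> w * (1 + norm (\<phi> s) + norm (\<phi> u)) powr \<beta> * (v - u) powr \<tau> *
          norm (\<phi> s - \<phi> u) powr lam" using that r by (intro W1) auto
      also have "\<dots> \<le> w * (1 + 2 * S) powr \<beta> * (v - s) powr \<tau> * (H * (v - s) powr \<gamma>) powr lam"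
      proof (intro mult_mono powr_mono2)
        have "norm (\<phi> s - \<phi> u) \<le> H * (u - s) powr \<gamma>" using hoelder[of s u] that
          by (simp add: norm_minus_commute)
        also have "\<dots> \<le> H * (v - s) powr \<gamma>" using that H gam by (intro mult_left_mono powr_mono2) auto
        finally show "norm (\<phi> s - \<phi> u) \<le> H * (v - s) powr \<gamma>" .
        show "1 + norm (\<phi> s) + norm (\<phi> u) \<le> 1 + 2 * S" using S[of s] S[of u] that by auto
      qed (use that w beta lam tau in auto)
      also have "\<dots> = Q * (v - s) powr \<mu>"
        using H that by (simp add: Q_def \<mu>_def powr_mult powr_powr powr_add mult_ac)
      finally show ?thesis .
    qed
    have "\<mu> > 1" using mu by (simp add: \<mu>_def)
    show ?thesis
    proof (rule sewing[of A \<mu> Q r T])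
      fix J assume J:
        "\<And>\<epsilon>. \<epsilon> > 0 \<Longrightarrow> \<exists>h>0. \<forall>n p. partition_of r T n p \<and> (\<forall>k<n. p (Suc k) - p k < h) \<longrightarrow>
            \<bar>(\<Sum>k<n. A (p k) (p (Suc k))) - J\<bar> < \<epsilon>"
        "\<bar>J - A r T\<bar> \<le> 2 / (1 - 2 powr (1 - \<mu>)) * Q * (T - r) powr \<mu>"
        "(\<lambda>n. \<Sum>k<Suc n. A (r + (T - r) * real k / real (Suc n))
                           (r + (T - r) * real (Suc k) / real (Suc n))) \<longlonglongrightarrow> J"
      have "\<bar>A r T\<bar> \<le> w * (1 + norm (\<phi> r)) powr (\<beta> + lam) * (T - r) powr \<tau>"
        using W2[of r T "\<phi> r"] r by (simp add: A_def abs_minus_commute)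
      also have "\<dots> \<le> w * (1 + S) powr (\<beta> + lam) * T powr \<tau>"
        using S[of r] r w beta lam tau by (intro mult_mono powr_mono2) auto
      finally have "\<bar>A r T\<bar> \<le> w * (1 + S) powr (\<beta> + lam) * T powr \<tau>" .
      moreover have "C * Q * (T - r) powr \<mu> \<le> C * Q * T powr \<mu>"
        using C Q r \<open>\<mu> > 1\<close> by (intro mult_left_mono powr_mono2) auto
      ultimately have "\<bar>J\<bar> \<le> w * (1 + S) powr (\<beta> + lam) * T powr \<tau> + C * Q * T powr \<mu>"
        using J(2) unfolding C_def[symmetric] by linarith
      then show ?thesis using J(1,3)
        by (intro that[of J]) (simp_all add: A_def has_young_integral_def C_def Q_def \<mu>_def)
    qed (use \<open>\<mu> > 1\<close> Q rT delta in \<open>auto simp: A_def\<close>)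
  qed
qed

text \<open>Each supremum is at most the finite total norm, so one constant serves all three
  estimates. The degenerate cases \<open>s = t\<close> and \<open>x = y\<close>, excluded from the
  suprema, are added since both sides vanish there.\<close>

lemma W_norm_bounds:
  fixes W :: "real \<Rightarrow> 'a::real_normed_vector \<Rightarrow> real"
  assumes "W_norm T \<tau> lam \<beta> W < \<infinity>"
  obtains w where "w \<ge> 0"
    "\<And>s t x y. 0 \<le> s \<Longrightarrow> s \<le> t \<Longrightarrow> t \<le> T \<Longrightarrow> \<bar>W s x - W t x - W s y + W t y\<bar>
        \<le> w * (1 + norm x + norm y) powr \<beta> * (t - s) powr \<tau> * norm (x - y) powr lam"
    "\<And>s t x. 0 \<le> s \<Longrightarrow> s \<le> t \<Longrightarrow> t \<le> T \<Longrightarrow> \<bar>W s x - W t x\<bar>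
        \<le> w * (1 + norm x) powr (\<beta> + lam) * (t - s) powr \<tau>"
    "\<And>t x y. 0 \<le> t \<Longrightarrow> t \<le> T \<Longrightarrow> \<bar>W t y - W t x\<bar>
        \<le> w * (1 + norm x + norm y) powr \<beta> * norm (x - y) powr lam"
proof -
  define w where "w = enn2real (W_norm T \<tau> lam \<beta> W)"
  have w: "W_norm T \<tau> lam \<beta> W = ennreal w" "w \<ge> 0" using assms by (auto simp: w_def top.not_eq_extremum)
  have conv: "x \<le> w * d" if "ennreal (x / d) \<le> ennreal w" "d > 0" for x d
    using that w(2) by (simp add: pos_divide_le_eq)
  have n: "1 + norm x + norm y > 0" "1 + norm x > 0" for x y :: 'a
    by (auto simp: add_pos_nonneg)
  show thesis
  proof (rule that[OF w(2)])
    fix s t and x y :: 'a assume st: "0 \<le> s" "s \<le> t" "t \<le> T"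
    show "\<bar>W s x - W t x - W s y + W t y\<bar>
        \<le> w * (1 + norm x + norm y) powr \<beta> * (t - s) powr \<tau> * norm (x - y) powr lam"
    proof (cases "s = t \<or> x = y")
      case False
      have "ennreal (\<bar>W s x - W t x - W s y + W t y\<bar> /
          ((1 + norm x + norm y) powr \<beta> * \<bar>t - s\<bar> powr \<tau> * norm (x - y) powr lam)) \<le> ennreal w"
        unfolding w(1)[symmetric] W_norm_def using st False
        by (intro add_increasing2 SUP_upper2[of "(s, t, x, y)"]) auto
      then have "\<bar>W s x - W t x - W s y + W t y\<bar> \<le>
          w * ((1 + norm x + norm y) powr \<beta> * \<bar>t - s\<bar> powr \<tau> * norm (x - y) powr lam)"
        using False n(1)[of x y] by (intro conv) auto
      then show ?thesis using st by (simp add: mult.assoc)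
    qed (auto simp: w)
    show "\<bar>W s x - W t x\<bar> \<le> w * (1 + norm x) powr (\<beta> + lam) * (t - s) powr \<tau>"
    proof (cases "s = t")
      case False
      have "ennreal (\<bar>W s x - W t x\<bar> / ((1 + norm x) powr (\<beta> + lam) * \<bar>t - s\<bar> powr \<tau>)) \<le> ennreal w"
        unfolding w(1)[symmetric] W_norm_def using st False
        by (intro add_increasing2[OF _ add_increasing] SUP_upper2[of "(s, t, x)"]) auto
      then have "\<bar>W s x - W t x\<bar> \<le> w * ((1 + norm x) powr (\<beta> + lam) * \<bar>t - s\<bar> powr \<tau>)"
        using False n(2)[of x] by (intro conv) auto
      then show ?thesis using st by (simp add: mult.assoc)
    qed (auto simp: w)
  next
    fix t and x y :: 'a assume t: "0 \<le> t" "t \<le> T"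
    show "\<bar>W t y - W t x\<bar> \<le> w * (1 + norm x + norm y) powr \<beta> * norm (x - y) powr lam"
    proof (cases "x = y")
      case False
      have "ennreal (\<bar>W t y - W t x\<bar> / ((1 + norm x + norm y) powr \<beta> * norm (x - y) powr lam)) \<le> ennreal w"
        unfolding w(1)[symmetric] W_norm_def using t False
        by (intro add_increasing SUP_upper2[of "(t, x, y)"]) auto
      then have "\<bar>W t y - W t x\<bar> \<le> w * ((1 + norm x + norm y) powr \<beta> * norm (x - y) powr lam)"
        using False n(1)[of x y] by (intro conv) auto
      then show ?thesis by (simp add: mult.assoc)
    qed (auto simp: w)
  qed
qed

text \<open>Supplies the continuity of \<open>W t\<close>, and thereby the measurability of
  \<open>W t\<close> evaluated at a random point.\<close>

lemma hoelder_weight_continuous: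
  fixes f :: "'a::real_normed_vector \<Rightarrow> real"
  assumes "lam > 0" "w \<ge> 0" "\<And>x y. \<bar>f y - f x\<bar> \<le> w * (1 + norm x + norm y) powr \<beta> * norm (x - y) powr lam"
  shows "continuous_on UNIV f"
  unfolding continuous_on_def
proof
  fix x :: 'a assume "x \<in> UNIV"
  have "((\<lambda>y. w * (1 + norm x + norm y) powr \<beta> * norm (x - y) powr lam) \<longlongrightarrow>
      w * (1 + norm x + norm x) powr \<beta> * norm (x - x) powr lam) (at x)"
    using assms(1) by (intro tendsto_intros tendsto_powr') (auto simp: add_nonneg_eq_0_iff)
  then have "((\<lambda>y. w * (1 + norm x + norm y) powr \<beta> * norm (x - y) powr lam) \<longlongrightarrow> 0) (at x)"
    using assms(1) by simp
  then have "((\<lambda>y. f y - f x) \<longlongrightarrow> 0) (at x)"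
    by (rule Lim_null_comparison[rotated]) (use assms(3) in auto)
  then show "(f \<longlongrightarrow> f x) (at x)" using LIM_zero_iff by blast
qed

subsection \<open>Regularity of paths\<close>

text \<open>Rounding \<open>t\<close> down to level \<open>n\<close> gives \<open>D n t\<close>.
  Passing to the next level adds at most one dyadic increment, so the distance from
  \<open>f (D n t)\<close> to \<open>f t\<close> is bounded by a geometric series. At the level
  matching \<open>t - s\<close> the two rounded points are equal or neighbours. The constant
  consists of two tails \<open>1 / (1 - q)\<close>, one middle increment, and
  \<open>2 powr \<gamma>\<close> from replacing the dyadic scale by \<open>t - s\<close>.\<close>

lemma dyadic_chaining:
  fixes f :: "real \<Rightarrow> 'a::real_normed_vector"
  assumes cont: "continuous_on {0..1} f" and gam: "\<gamma> > 0" and R: "R \<ge> 0"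
    and inc: "\<And>n k. k < (2::nat) ^ n \<Longrightarrow>
        norm (f (real (Suc k) / 2 ^ n) - f (real k / 2 ^ n)) \<le> R * (2 powr - \<gamma>) ^ n"
    and st: "0 \<le> s" "s \<le> t" "t \<le> 1"
  shows "norm (f t - f s) \<le> (2 / (1 - 2 powr - \<gamma>) + 1) * 2 powr \<gamma> * R * (t - s) powr \<gamma>"
proof (cases "s = t")
  case False
  define q where "q = (2::real) powr - \<gamma>"
  define d where "d n t = nat \<lfloor>t * 2 ^ n\<rfloor>" for n and t :: real
  define D where "D n t = real (d n t) / 2 ^ n" for n t
  have q: "0 < q" "q < 1" using gam powr_less_mono[of "-\<gamma>" 0 2] by (auto simp: q_def)
  have d: "real (d n t) \<le> t * 2 ^ n" "t * 2 ^ n < real (d n t) + 1" if "0 \<le> t" for n t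
  proof -
    have "t * 2 ^ n \<ge> 0" using that by simp
    then show "real (d n t) \<le> t * 2 ^ n" "t * 2 ^ n < real (d n t) + 1" unfolding d_def by linarith+
  qed
  have D: "D n t \<le> t" "t < D n t + 1 / 2 ^ n" "0 \<le> D n t" if "0 \<le> t" for n t
    using d[OF that, of n] by (auto simp: D_def field_simps)
  have step: "norm (f (D (Suc n) t) - f (D n t)) \<le> R * q ^ Suc n" if t: "0 \<le> t" "t \<le> 1" for n t
  proof -
    \<comment> \<open>The next binary digit of \<open>t\<close> is 0 or 1: the rounded point stays,
      or moves by one cell of level \<open>Suc n\<close>.\<close>
    have "real (d (Suc n) t) < real (2 * d n t + 2)" "real (2 * d n t) < real (d (Suc n) t + 1)"
      using d[OF t(1), of n] d[OF t(1), of "Suc n"] by auto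
    then consider "d (Suc n) t = 2 * d n t" | "d (Suc n) t = Suc (2 * d n t)" by linarith
    then show ?thesis
    proof cases
      case 1
      then show ?thesis using R q by (simp add: D_def)
    next
      case 2
      have "real (Suc (2 * d n t)) \<le> t * 2 ^ Suc n" using d(1)[OF t(1), of "Suc n"] 2 by simp
      also have "\<dots> \<le> 2 ^ Suc n" using t by simp
      finally have "real (Suc (2 * d n t)) \<le> real (2 ^ Suc n)" by simp
      then have "2 * d n t < 2 ^ Suc n" by (simp only: of_nat_le_iff)
      from inc[OF this] show ?thesis using 2 by (simp add: D_def q_def)
    qed
  qed
  have chain: "norm (f (D (n + m) t) - f (D n t)) \<le> R * q ^ n * (1 - q ^ m) / (1 - q)"
    if t: "0 \<le> t" "t \<le> 1" for n m t
  proof (induction m)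
    case (Suc m)
    have "norm (f (D (n + Suc m) t) - f (D n t)) \<le>
        norm (f (D (Suc (n + m)) t) - f (D (n + m) t)) + norm (f (D (n + m) t) - f (D n t))"
      using norm_triangle_ineq[of "f (D (Suc (n + m)) t) - f (D (n + m) t)" "f (D (n + m) t) - f (D n t)"]
      by simp
    also have "\<dots> \<le> R * q ^ Suc (n + m) + R * q ^ n * (1 - q ^ m) / (1 - q)"
      by (intro add_mono step t Suc)
    also have "R * q ^ Suc (n + m) \<le> R * q ^ (n + m)" using q R by (intro mult_left_mono power_decreasing) auto
    also have "R * q ^ (n + m) + R * q ^ n * (1 - q ^ m) / (1 - q) = R * q ^ n * (1 - q ^ Suc m) / (1 - q)"
      using q by (simp add: field_simps power_add)
    finally show ?case by simp
  qed simp
  have lim: "norm (f t - f (D n t)) \<le> R * q ^ n / (1 - q)" if t: "0 \<le> t" "t \<le> 1" for n t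
  proof -
    have "(\<lambda>m. D (n + m) t) \<longlonglongrightarrow> t"
    proof (rule tendsto_sandwich)
      show "eventually (\<lambda>m. t - (1/2) ^ (n + m) \<le> D (n + m) t) sequentially"
        using D(2)[OF t(1)] by (auto simp: power_divide less_imp_le diff_le_eq)
      show "eventually (\<lambda>m. D (n + m) t \<le> t) sequentially" using D[OF t(1)] by auto
      have "(\<lambda>m. t - (1/2) ^ n * (1/2::real) ^ m) \<longlonglongrightarrow> t - (1/2) ^ n * 0"
        by (intro tendsto_intros LIMSEQ_power_zero) auto
      then show "(\<lambda>m. t - (1/2::real) ^ (n + m)) \<longlonglongrightarrow> t" by (simp add: power_add)
    qed simp
    moreover have "D m t \<in> {0..1}" for m using D[OF t(1), of m] t by auto
    ultimately have "(\<lambda>m. f (D (n + m) t)) \<longlonglongrightarrow> f t"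
      using cont t unfolding continuous_on_sequentially by (auto simp: o_def)
    then have "(\<lambda>m. norm (f (D (n + m) t) - f (D n t))) \<longlonglongrightarrow> norm (f t - f (D n t))"
      by (intro tendsto_intros)
    moreover have "norm (f (D (n + m) t) - f (D n t)) \<le> R * q ^ n / (1 - q)" for m
    proof -
      have "R * q ^ n * (1 - q ^ m) / (1 - q) \<le> R * q ^ n * 1 / (1 - q)"
        using R q by (intro divide_right_mono mult_left_mono) auto
      then show ?thesis using chain[OF t, of n m] by simp
    qed
    ultimately show ?thesis by (intro tendsto_upperbound[OF _ _ sequentially_bot]) auto
  qed
  have ts: "t - s > 0" using st False by simp
  \<comment> \<open>The scale satisfies \<open>(1/2) ^ Suc n < t - s \<le> (1/2) ^ n\<close>. The
    upper bound makes the rounded points at most neighbours; the lower one converts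
    \<open>q ^ n\<close> into a power of \<open>t - s\<close>.\<close>
  define n where "n = (LEAST n. (1/2::real) ^ Suc n < t - s)"
  have "\<exists>n. (1/2::real) ^ n < t - s" using real_arch_pow_inv[OF ts, of "1/2"] by simp
  then obtain n0 where n0: "(1/2::real) ^ n0 < t - s" by blast
  have "(1/2::real) ^ Suc n0 \<le> (1/2) ^ n0" by (intro power_decreasing) auto
  with n0 have "(1/2::real) ^ Suc n0 < t - s" by linarith
  then have n1: "(1/2::real) ^ Suc n < t - s" unfolding n_def by (rule LeastI)
  have n2: "t - s \<le> (1/2::real) ^ n"
  proof (cases n)
    case 0 then show ?thesis using st by simp
  next
    case (Suc m)
    then have "\<not> (1/2::real) ^ Suc m < t - s" 
      using not_less_Least[of m "\<lambda>n. (1/2::real) ^ Suc n < t - s"] unfolding n_def[symmetric] by blast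
    then show ?thesis using Suc by simp
  qed
  have "real (d n s) \<le> t * 2 ^ n" using d(1)[of s n] st by (meson mult_right_mono order_trans zero_le_numeral zero_le_power)
  then have "d n s \<le> d n t" unfolding d_def using st by (intro nat_mono floor_mono mult_right_mono) auto
  moreover have "(t - s) * 2 ^ n \<le> 1" using n2 by (simp add: power_divide field_simps)
  then have "real (d n t) < real (d n s + 2)" using d(1)[of t n] d(2)[of s n] st
    by (simp add: left_diff_distrib)
  then have "d n t < d n s + 2" by linarith
  ultimately consider "d n t = d n s" | "d n t = Suc (d n s)" by linarith
  then have mid: "norm (f (D n t) - f (D n s)) \<le> R * q ^ n"
  proof cases
    case 1 then show ?thesis using R q by (simp add: D_def)
  next
    case 2
    have "real (Suc (d n s)) \<le> t * 2 ^ n" using d(1)[of t n] st 2 by simp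
    also have "\<dots> \<le> 2 ^ n" using st by simp
    finally have "real (Suc (d n s)) \<le> real (2 ^ n)" by simp
    then have "d n s < 2 ^ n" by (simp only: of_nat_le_iff)
    from inc[OF this] show ?thesis using 2 by (simp add: D_def q_def)
  qed
  have "norm (f t - f s) \<le> norm (f t - f (D n t)) + norm (f (D n t) - f (D n s)) + norm (f s - f (D n s))"
    using norm_triangle_ineq[of "f t - f (D n t)" "f (D n t) - f (D n s)"]
      norm_triangle_ineq4[of "f t - f (D n s)" "f s - f (D n s)"] by simp
  also have "\<dots> \<le> R * q ^ n / (1 - q) + R * q ^ n + R * q ^ n / (1 - q)"
    using st by (intro add_mono lim mid) auto
  also have "\<dots> = (2 / (1 - q) + 1) * R * q ^ n" by (simp add: algebra_simps)
  also have "q ^ n \<le> 2 powr \<gamma> * (t - s) powr \<gamma>"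
  proof -
    have "q ^ n = 2 powr (- \<gamma> * real n)"
      unfolding q_def by (subst powr_realpow[symmetric]) (simp_all add: powr_powr)
    also have "\<dots> = (2 powr (- real n)) powr \<gamma>" by (simp add: powr_powr mult.commute[of \<gamma>])
    also have "2 powr (- real n) = (1/2::real) ^ n"
      by (simp add: powr_minus_divide powr_realpow power_one_over)
    also have "((1/2) ^ n) powr \<gamma> \<le> (2 * (t - s)) powr \<gamma>" using n1 gam by (intro powr_mono2) auto
    also have "\<dots> = 2 powr \<gamma> * (t - s) powr \<gamma>" by (rule powr_mult)
    finally show ?thesis .
  qed
  then have "(2 / (1 - q) + 1) * R * q ^ n \<le> (2 / (1 - q) + 1) * R * (2 powr \<gamma> * (t - s) powr \<gamma>)"
    using q R by (intro mult_left_mono) (auto intro!: mult_nonneg_nonneg add_nonneg_nonneg)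
  finally show ?thesis by (simp add: q_def mult_ac)
qed simp

text \<open>The weight \<open>exp (- 2 c (t - r))\<close> makes the integral operator a contraction, so that the
  maximum of the weighted function can be absorbed.\<close>

lemma gronwall:
  fixes y :: "real \<Rightarrow> real"
  assumes cont: "continuous_on {r..T} y" and c: "c > 0" and a: "a \<ge> 0"
    and y: "\<And>t. t \<in> {r..T} \<Longrightarrow> 0 \<le> y t"
    and le: "\<And>t. t \<in> {r..T} \<Longrightarrow> y t \<le> a + c * integral {r..t} y"
    and t: "t \<in> {r..T}"
  shows "y t \<le> 2 * a * exp (2 * c * (T - r))"
proof -
  define z where "z t = exp (- (2 * c * (t - r))) * y t" for t
  have "continuous_on {r..T} z" unfolding z_def by (intro continuous_intros cont)
  then obtain t0 where t0: "t0 \<in> {r..T}" "\<And>t. t \<in> {r..T} \<Longrightarrow> z t \<le> z t0"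
    using continuous_attains_sup[of "{r..T}" z] t by auto
  define m where "m = z t0"
  have ym: "y t \<le> m * exp (2 * c * (t - r))" if "t \<in> {r..T}" for t
    using t0(2)[OF that] unfolding m_def by (simp add: z_def exp_minus divide_simps mult_ac split: if_splits)
  have m: "m \<ge> 0" using y[OF t0(1)] by (simp add: m_def z_def)
  have "((\<lambda>s. m * exp (2 * c * (s - r))) has_integral
      (m * exp (2 * c * (t0 - r)) / (2 * c) - m * exp (2 * c * (r - r)) / (2 * c))) {r..t0}"
    using t0(1) c by (intro fundamental_theorem_of_calculus)
      (auto intro!: derivative_eq_intros simp: has_real_derivative_iff_has_vector_derivative[symmetric])
  moreover have "y integrable_on {r..t0}"
    using t0(1) by (intro integrable_continuous_interval continuous_on_subset[OF cont]) auto
  ultimately have "integral {r..t0} y \<le>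
      m * exp (2 * c * (t0 - r)) / (2 * c) - m * exp (2 * c * (r - r)) / (2 * c)"
    using t0(1) by (intro has_integral_le[OF integrable_integral _ ym]) auto
  also have "\<dots> \<le> m * exp (2 * c * (t0 - r)) / (2 * c)" using m c by simp
  finally have "c * integral {r..t0} y \<le> c * (m * exp (2 * c * (t0 - r)) / (2 * c))"
    using c by (intro mult_left_mono) auto
  \<comment> \<open>The rate \<open>2 * c\<close> in the weight is chosen so that integration leaves
    exactly \<open>m / 2\<close>, which is absorbed into \<open>m\<close> on the left.\<close>
  then have "y t0 \<le> a + m / 2 * exp (2 * c * (t0 - r))" using le[OF t0(1)] c by simp
  then have "m \<le> exp (- (2 * c * (t0 - r))) * (a + m / 2 * exp (2 * c * (t0 - r)))"
    unfolding m_def z_def by (intro mult_left_mono) auto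
  also have "\<dots> = exp (- (2 * c * (t0 - r))) * a + m / 2 * (exp (- (2 * c * (t0 - r))) * exp (2 * c * (t0 - r)))"
    by (simp only: distrib_left mult_ac)
  also have "exp (- (2 * c * (t0 - r))) * exp (2 * c * (t0 - r)) = 1"
    by (simp only: exp_add[symmetric]) simp
  finally have "m \<le> exp (- (2 * c * (t0 - r))) * a + m / 2" by simp
  also have "exp (- (2 * c * (t0 - r))) * a \<le> 1 * a" using a c t0(1) by (intro mult_right_mono) auto
  finally have "m \<le> 2 * a" by simp
  have "y t \<le> m * exp (2 * c * (t - r))" by (rule ym[OF t])
  also have "\<dots> \<le> 2 * a * exp (2 * c * (T - r))"
    using t c m \<open>m \<le> 2 * a\<close> by (intro mult_mono) auto
  finally show ?thesis .
qed

lemma norm_le_card_component_bound: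
  fixes v :: "real ^ 'n"
  assumes "\<And>i. \<bar>v $ i\<bar> \<le> c"
  shows "norm v \<le> real CARD('n) * c"
proof -
  have "norm v \<le> (\<Sum>i\<in>UNIV. \<bar>v $ i\<bar>)" by (rule norm_le_l1_cart)
  also have "\<dots> \<le> (\<Sum>i\<in>(UNIV :: 'n set). c)" by (intro sum_mono assms)
  finally show ?thesis by simp
qed

text \<open>Nothing is known about continuity of \<open>N\<close>, and the equation is available at
  dyadic times only. The remainder \<open>M\<close> of \<open>X\<close> after removal of the start
  and the drift is continuous and equals \<open>N\<close> at dyadic times, so chaining applies to
  \<open>M\<close>. Its bound enters Gronwall for \<open>1 + norm X\<close>. The factor
  \<open>CARD('n)\<close> in \<open>e\<close> comes from componentwise estimates; in
  \<open>H\<close> the first term is the chaining constant after rescaling to the unit interval, the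
  second is the Lipschitz bound of the drift.\<close>

lemma path_regularity:
  fixes X bb N :: "real \<Rightarrow> real ^ 'n" and x :: "real ^ 'n" and c \<gamma> \<kappa> r T R :: real
  defines "c\<gamma> \<equiv> (2 / (1 - 2 powr - \<gamma>) + 1) * 2 powr \<gamma> * c"
  defines "e \<equiv> real CARD('n) * \<kappa>"
  defines "S \<equiv> 2 * (1 + norm x + c\<gamma>) * exp (2 * e * (T - r))"
  defines "H \<equiv> c\<gamma> * (T - r) powr (- \<gamma>) + e * S * (T - r) powr (1 - \<gamma>)"
  assumes rT: "r < T" and X: "continuous_on {r..T} X" "X r = x" and \<kappa>: "\<kappa> > 0" and c: "c > 0"
    and gam: "0 < \<gamma>" "\<gamma> < 1" and R: "R \<ge> 1"
    and int: "\<And>i. (\<lambda>s. bb s $ i) integrable_on {r..T}"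
    and bb: "\<And>s i. s \<in> {r..T} \<Longrightarrow> \<bar>bb s $ i\<bar> \<le> \<kappa> * (1 + norm (X s))"
    and N: "\<And>n k i. k \<le> (2::nat) ^ n \<Longrightarrow> X (r + (T - r) * (real k / 2 ^ n)) $ i = x $ i +
        N (r + (T - r) * (real k / 2 ^ n)) $ i + integral {r..r + (T - r) * (real k / 2 ^ n)} (\<lambda>s. bb s $ i)"
    and inc: "\<And>n k. k < (2::nat) ^ n \<Longrightarrow>
        norm (N (r + (T - r) * (real (Suc k) / 2 ^ n)) - N (r + (T - r) * (real k / 2 ^ n)))
        \<le> c * R * (2 powr - \<gamma>) ^ n"
  shows "\<And>t. t \<in> {r..T} \<Longrightarrow> norm (X t) \<le> S * R"
    and "\<And>s t. r \<le> s \<Longrightarrow> s \<le> t \<Longrightarrow> t \<le> T \<Longrightarrow> norm (X t - X s) \<le> H * R * (t - s) powr \<gamma>"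
    and "S > 0" "H > 0"
proof -
  define D where "D t = (\<chi> i. integral {r..t} (\<lambda>s. bb s $ i))" for t
  define y where "y t = 1 + norm (X t)" for t
  define M where "M t = X t - x - D t" for t
  have q: "(2::real) powr - \<gamma> < 1" using gam powr_less_mono[of "-\<gamma>" 0 2] by simp
  have c\<gamma>: "c\<gamma> > 0" unfolding c\<gamma>_def using q c by (intro mult_pos_pos add_pos_pos divide_pos_pos) auto
  have e: "e > 0" using \<kappa> by (simp add: e_def)
  show S: "S > 0" 
    unfolding S_def using c\<gamma> by (intro mult_pos_pos add_nonneg_pos) auto
  show H: "H > 0" unfolding H_def using c\<gamma> rT S e by (intro add_pos_pos mult_pos_pos) auto
  have ycont: "continuous_on {r..T} y" unfolding y_def by (intro continuous_intros X)
  have yint: "y integrable_on {s..t}" if "r \<le> s" "t \<le> T" for s t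
    by (intro integrable_continuous_interval continuous_on_subset[OF ycont]) (use that in auto)
  have Dinc: "norm (D t - D s) \<le> e * integral {s..t} y" if st: "r \<le> s" "s \<le> t" "t \<le> T" for s t
  proof -
    have "\<bar>(D t - D s) $ i\<bar> \<le> \<kappa> * integral {s..t} y" for i
    proof -
      have bi: "(\<lambda>s. bb s $ i) integrable_on {a..b}" if "r \<le> a" "b \<le> T" for a b
        by (rule integrable_subinterval_real[OF int[of i]]) (use that in auto)
      have "(D t - D s) $ i = integral {s..t} (\<lambda>s. bb s $ i)"
        using Henstock_Kurzweil_Integration.integral_combine[of r s t "\<lambda>s. bb s $ i"] st bi[of r t]
        by (simp add: D_def)
      also have "\<bar>\<dots>\<bar> \<le> integral {s..t} (\<lambda>s. \<kappa> * y s)"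
        using integral_norm_bound_integral[of "\<lambda>s. bb s $ i" "{s..t}" "\<lambda>s. \<kappa> * y s"] st bi[of s t]
          integrable_cmul[OF yint[of s t], of \<kappa>] bb by (auto simp: y_def)
      finally show ?thesis by simp
    qed
    from norm_le_card_component_bound[of "D t - D s", OF this]
    show ?thesis by (simp add: e_def mult.assoc)
  qed
  obtain Y where Y: "\<And>t. t \<in> {r..T} \<Longrightarrow> y t \<le> Y" "Y \<ge> 0"
  proof -
    have "bounded (y ` {r..T})" by (intro compact_imp_bounded compact_continuous_image ycont) auto
    then obtain Y where "\<forall>z\<in>y ` {r..T}. norm z \<le> Y" by (auto simp: bounded_iff)
    then have "\<bar>y t\<bar> \<le> Y" if "t \<in> {r..T}" for t using that by auto
    then have "y t \<le> max Y 0" if "t \<in> {r..T}" for t using that abs_ge_self[of "y t"] by (meson max.coboundedI1 order_trans)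
    then show ?thesis using that[of "max Y 0"] by simp
  qed
  have intle: "integral {s..t} y \<le> Z * (t - s)"
    if "\<And>t. t \<in> {r..T} \<Longrightarrow> y t \<le> Z" "r \<le> s" "s \<le> t" "t \<le> T" for s t Z
  proof -
    have "integral {s..t} y \<le> integral {s..t} (\<lambda>_. Z)"
      using that by (intro integral_le yint integrable_const_ivl) auto
    then show ?thesis using that by (simp add: mult.commute)
  qed
  \<comment> \<open>The integrand is dominated by a multiple of \<open>y\<close>, which is bounded
    on the compact interval, so \<open>D\<close> is Lipschitz.\<close>
  have "continuous_on {r..T} D"
  proof (rule continuous_on_iff[THEN iffD2], intro ballI allI impI)
    fix t and \<epsilon> :: real assume t: "t \<in> {r..T}" and \<epsilon>: "\<epsilon> > 0"
    have lip: "norm (D u - D t) \<le> e * Y * \<bar>u - t\<bar>" if u: "u \<in> {r..T}" for u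
    proof (cases "t \<le> u")
      case True
      have "norm (D u - D t) \<le> e * (Y * (u - t))"
        using t u True e by (intro order_trans[OF Dinc] mult_left_mono intle Y) auto
      then show ?thesis using True by (simp add: mult.assoc)
    next
      case False
      have "norm (D t - D u) \<le> e * (Y * (t - u))"
        using t u False e by (intro order_trans[OF Dinc] mult_left_mono intle Y) auto
      then show ?thesis using False by (simp add: mult.assoc norm_minus_commute)
    qed
    have small: "e * Y * \<bar>u - t\<bar> < \<epsilon>" if "\<bar>u - t\<bar> < \<epsilon> / (e * Y + 1)" for u
    proof -
      have "e * Y \<ge> 0" using e Y by simp
      then have "\<bar>u - t\<bar> * (e * Y + 1) < \<epsilon>" using that by (simp add: pos_less_divide_eq add_nonneg_pos)
      then show ?thesis using abs_ge_zero[of "u - t"] by (simp add: distrib_left mult.commute)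
    qed
    show "\<exists>d>0. \<forall>u\<in>{r..T}. dist u t < d \<longrightarrow> dist (D u) (D t) < \<epsilon>"
    proof (intro exI[of _ "\<epsilon> / (e * Y + 1)"] conjI ballI impI)
      show "\<epsilon> / (e * Y + 1) > 0" using \<epsilon> e Y by (simp add: add_nonneg_pos)
      fix u assume "u \<in> {r..T}" "dist u t < \<epsilon> / (e * Y + 1)"
      then show "dist (D u) (D t) < \<epsilon>"
        using le_less_trans[OF lip small] by (simp add: dist_norm)
    qed
  qed
  then have Mcont: "continuous_on {r..T} M" unfolding M_def by (intro continuous_intros X)
  have MN: "M (r + (T - r) * (real k / 2 ^ n)) = N (r + (T - r) * (real k / 2 ^ n))"
    if "k \<le> (2::nat) ^ n" for n k
    using N[OF that] by (simp add: vec_eq_iff M_def D_def)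
  have Minc: "norm (M t - M s) \<le> c\<gamma> * R * ((t - s) / (T - r)) powr \<gamma>" if st: "r \<le> s" "s \<le> t" "t \<le> T" for s t
  proof -
    define f where "f u = M (r + (T - r) * u)" for u
    have rng: "r + (T - r) * u \<in> {r..T}" if "u \<in> {0..1}" for u
    proof -
      have "(T - r) * u \<le> (T - r) * 1" "(T - r) * u \<ge> 0"
        using that rT by (intro mult_left_mono mult_nonneg_nonneg; simp)+
      then show ?thesis by simp
    qed
    have "continuous_on {0..1} f"
      unfolding f_def by (rule continuous_on_compose2[OF Mcont]) (use rng in \<open>auto intro!: continuous_intros\<close>)
    moreover have "norm (f (real (Suc k) / 2 ^ n) - f (real k / 2 ^ n)) \<le> c * R * (2 powr - \<gamma>) ^ n"
      if "k < (2::nat) ^ n" for n k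
      unfolding f_def using that by (simp only: MN Suc_leI less_imp_le inc)
    moreover have "c * R \<ge> 0" using c R by simp
    ultimately have "norm (f ((t - r) / (T - r)) - f ((s - r) / (T - r))) \<le>
        (2 / (1 - 2 powr - \<gamma>) + 1) * 2 powr \<gamma> * (c * R) * ((t - r) / (T - r) - (s - r) / (T - r)) powr \<gamma>"
      using st rT gam by (intro dyadic_chaining) (auto simp: divide_right_mono)
    moreover have "(t - r) / (T - r) - (s - r) / (T - r) = (t - s) / (T - r)"
      by (simp add: diff_divide_distrib[symmetric])
    ultimately show ?thesis using rT by (simp add: f_def c\<gamma>_def mult_ac)
  qed
  have "M r = 0" using X by (simp add: M_def D_def vec_eq_iff)
  have M: "norm (M t) \<le> c\<gamma> * R" if "t \<in> {r..T}" for t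
  proof -
    have "norm (M t) \<le> c\<gamma> * R * ((t - r) / (T - r)) powr \<gamma>" using Minc[of r t] \<open>M r = 0\<close> that by simp
    also have "\<dots> \<le> c\<gamma> * R * 1 powr \<gamma>"
      using that rT c\<gamma> R gam by (intro mult_left_mono powr_mono2) auto
    finally show ?thesis by simp
  qed
  have yS: "y t \<le> S * R" if t: "t \<in> {r..T}" for t
  proof -
    have "y t \<le> 2 * (1 + norm x + c\<gamma> * R) * exp (2 * e * (T - r))"
    proof (rule gronwall[OF ycont e _ _ _ t])
      fix t assume t: "t \<in> {r..T}"
      have "D r = 0" by (simp add: D_def vec_eq_iff)
      have "X t = x + M t + (D t - D r)" using \<open>D r = 0\<close> by (simp add: M_def)
      then have "norm (X t) \<le> norm x + norm (M t) + norm (D t - D r)"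
        using norm_triangle_ineq[of "x + M t" "D t - D r"] norm_triangle_ineq[of x "M t"] by simp
      then show "y t \<le> 1 + norm x + c\<gamma> * R + e * integral {r..t} y"
        using M[OF t] Dinc[of r t] t unfolding y_def[of t] by auto
    qed (use c\<gamma> R in \<open>auto simp: y_def intro!: add_nonneg_nonneg\<close>)
    \<comment> \<open>Since \<open>R \<ge> 1\<close>, the deterministic part
      \<open>1 + norm x\<close> may be multiplied by \<open>R\<close> too, which makes the whole
      bound linear in \<open>R\<close>.\<close>
    also have "\<dots> \<le> 2 * ((1 + norm x + c\<gamma>) * R) * exp (2 * e * (T - r))"
    proof (intro mult_right_mono mult_left_mono)
      have "1 + norm x \<le> (1 + norm x) * R" using mult_left_mono[OF R, of "1 + norm x"] by simp
      then show "1 + norm x + c\<gamma> * R \<le> (1 + norm x + c\<gamma>) * R" by (simp add: algebra_simps)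
    qed auto
    finally show ?thesis by (simp add: S_def mult_ac)
  qed
  then show "norm (X t) \<le> S * R" if "t \<in> {r..T}" for t
    using that by (force simp: y_def)
  show "norm (X t - X s) \<le> H * R * (t - s) powr \<gamma>" if st: "r \<le> s" "s \<le> t" "t \<le> T" for s t
  proof -
    have "X t - X s = (M t - M s) + (D t - D s)" by (simp add: M_def)
    then have "norm (X t - X s) \<le> norm (M t - M s) + norm (D t - D s)" by (metis norm_triangle_ineq)
    also have "norm (M t - M s) \<le> c\<gamma> * R * ((T - r) powr (- \<gamma>) * (t - s) powr \<gamma>)"
      using Minc[OF st] st rT by (simp add: powr_divide powr_minus_divide)
    also have "norm (D t - D s) \<le> e * (S * R * (t - s))"
      using e by (intro order_trans[OF Dinc[OF st]] mult_left_mono intle yS st) auto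
    \<comment> \<open>A Lipschitz bound on an interval of length at most \<open>T - r\<close> is
      weakened to a \<gamma>-Hoelder bound.\<close>
    also have "e * (S * R * (t - s)) \<le> e * (S * R * ((T - r) powr (1 - \<gamma>) * (t - s) powr \<gamma>))"
    proof (intro mult_left_mono)
      have "t - s = (t - s) powr (1 - \<gamma>) * (t - s) powr \<gamma>" using st by (cases "s = t") (auto simp: powr_add[symmetric])
      also have "\<dots> \<le> (T - r) powr (1 - \<gamma>) * (t - s) powr \<gamma>"
        using st gam by (intro mult_right_mono powr_mono2) auto
      finally show "t - s \<le> (T - r) powr (1 - \<gamma>) * (t - s) powr \<gamma>" .
    qed (use e S R in auto)
    finally show ?thesis by (simp add: H_def algebra_simps)
  qed
qed

subsection \<open>Exponential moments of Ito integrals\<close>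

text \<open>Exponential tilting: completing the square turns the integrand into the normal density
  with mean \<open>z * h\<close> and the same variance.\<close>

lemma gaussian_exp_moment:
  assumes "h > 0"
  shows "(\<integral>\<^sup>+d. ennreal (normal_density 0 (sqrt h) d) * ennreal (exp (z * d - z\<^sup>2 * h / 2)) \<partial>lborel) = 1"
proof -
  have "normal_density 0 (sqrt h) d * exp (z * d - z\<^sup>2 * h / 2) = normal_density (z * h) (sqrt h) d" for d
  proof -
    have "- (d\<^sup>2 / (2 * h)) + (z * d - z\<^sup>2 * h / 2) = - ((d - z * h)\<^sup>2 / (2 * h))"
      using assms by (simp add: field_simps power2_eq_square)
    then have "exp (- (d\<^sup>2 / (2 * h))) * exp (z * d - z\<^sup>2 * h / 2) = exp (- ((d - z * h)\<^sup>2 / (2 * h)))"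
      by (simp only: exp_add[symmetric])
    then show ?thesis using assms by (simp add: normal_density_def)
  qed
  then have "(\<integral>\<^sup>+d. ennreal (normal_density 0 (sqrt h) d) * ennreal (exp (z * d - z\<^sup>2 * h / 2)) \<partial>lborel) =
      (\<integral>\<^sup>+d. ennreal (normal_density (z * h) (sqrt h) d) \<partial>lborel)"
    by (simp add: ennreal_mult'[symmetric])
  also have "\<dots> = 1"
    using prob_space.emeasure_space_1[OF prob_space_normal_density[of "sqrt h" "z * h"]] assms
    by (simp add: emeasure_density)
  finally show ?thesis .
qed

section \<open>Exponential martingales of Brownian increments\<close>

context brownian_motion
begin

lemma F_measurable_M:
  assumes "f \<in> measurable (F t) N" shows "f \<in> measurable M N"
  using measurable_from_subalg[OF subalgebra_F assms] .

lemma F_measurable_mono: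
  assumes "s \<le> t" "f \<in> measurable (F s) N" shows "f \<in> measurable (F t) N"
proof -
  have "subalgebra (F t) (F s)" using assms(1) sets_F_mono space_F by (auto simp: subalgebra_def)
  from measurable_from_subalg[OF this assms(2)] show ?thesis .
qed

text \<open>The increment is independent of \<open>F s\<close>, so one may integrate over it with
  \<open>Y\<close> and \<zeta> frozen, and this inner integral is 1 by the Gaussian formula. The
  conditioning is carried out as Fubini on a product space.\<close>

lemma increment_exp_martingale:
  fixes Y :: "'w \<Rightarrow> ennreal" and \<zeta> :: "'w \<Rightarrow> real"
  assumes st: "0 \<le> s" "s < t" and Y[measurable]: "Y \<in> borel_measurable (F s)"
    and Z[measurable]: "\<zeta> \<in> borel_measurable (F s)"
  shows "(\<integral>\<^sup>+\<omega>. Y \<omega> * ennreal (exp (\<zeta> \<omega> * (B t \<omega> $ j - B s \<omega> $ j) - (\<zeta> \<omega>)\<^sup>2 * (t - s) / 2)) \<partial>M) =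
    (\<integral>\<^sup>+\<omega>. Y \<omega> \<partial>M)"
proof -
  define D where "D \<omega> = B t \<omega> - B s \<omega>" for \<omega>
  have Bm: "B t \<in> borel_measurable M" "B s \<in> borel_measurable M"
    using st by (auto intro!: F_measurable_M[OF adapted])
  then have D[measurable]: "D \<in> borel_measurable M" unfolding D_def by measurable
  have sF: "sets (F s) \<subseteq> sets M" "space (F s) = space M"
    using subalgebra_F[of s] by (auto simp: subalgebra_def)
  have id: "(\<lambda>\<omega>. \<omega>) \<in> measurable M (F s)" using sF by (intro measurableI) auto
  interpret D: prob_space "distr M borel D" by (rule prob_space_distr) measurable
  interpret Id: prob_space "distr M (F s) (\<lambda>\<omega>. \<omega>)" by (rule prob_space_distr[OF id])
  \<comment> \<open>The image of \<open>M\<close> under the identity into \<open>F s\<close> is the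
    restriction of \<open>M\<close> to that \<sigma>-algebra. Independence says precisely that its
    joint law with the increment is the product.\<close>
  have joint: "distr M (F s) (\<lambda>\<omega>. \<omega>) \<Otimes>\<^sub>M distr M borel D = distr M (F s \<Otimes>\<^sub>M borel) (\<lambda>\<omega>. (\<omega>, D \<omega>))"
  proof (rule pair_measure_eqI)
    fix A C assume "A \<in> sets (distr M (F s) (\<lambda>\<omega>. \<omega>))" "C \<in> sets (distr M borel D)"
    then have A: "A \<in> sets (F s)" and C: "C \<in> sets borel" by auto
    then have AM: "A \<in> sets M" "A \<subseteq> space M" using sF sets.sets_into_space by blast+
    have CM: "D -` C \<inter> space M \<in> sets M" by (rule measurable_sets[OF D C])
    have "prob (A \<inter> (D -` C \<inter> space M)) = prob A * prob (D -` C \<inter> space M)"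
      using increments_indep[OF st] A C unfolding indep_sets2_eq D_def[symmetric] by blast
    then have "emeasure M (A \<inter> (D -` C \<inter> space M)) = emeasure M A * emeasure M (D -` C \<inter> space M)"
      using AM CM by (simp add: emeasure_eq_measure ennreal_mult')
    moreover have "emeasure (distr M (F s \<Otimes>\<^sub>M borel) (\<lambda>\<omega>. (\<omega>, D \<omega>))) (A \<times> C) =
        emeasure M (A \<inter> (D -` C \<inter> space M))"
      using A C AM by (subst emeasure_distr[OF measurable_Pair[OF id D]])
        (auto intro!: arg_cong[of _ _ "emeasure M"])
    moreover have "emeasure (distr M (F s) (\<lambda>\<omega>. \<omega>)) A = emeasure M A"
      using AM by (subst emeasure_distr[OF id A]) (auto intro!: arg_cong[of _ _ "emeasure M"])
    ultimately show "emeasure (distr M (F s) (\<lambda>\<omega>. \<omega>)) A * emeasure (distr M borel D) C =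
        emeasure (distr M (F s \<Otimes>\<^sub>M borel) (\<lambda>\<omega>. (\<omega>, D \<omega>))) (A \<times> C)"
      using emeasure_distr[OF D C] by simp
  qed (auto simp: Id.sigma_finite_measure_axioms D.sigma_finite_measure_axioms intro!: sets_pair_measure_cong)
  define f where "f = (\<lambda>(\<omega>, d :: real ^ 'n). Y \<omega> * ennreal (exp (\<zeta> \<omega> * d $ j - (\<zeta> \<omega>)\<^sup>2 * (t - s) / 2)))"
  have [measurable]: "(\<lambda>d :: real ^ 'n. d $ j) \<in> borel_measurable borel"
    by (intro borel_measurable_continuous_onI continuous_intros)
  have f[measurable]: "f \<in> borel_measurable (F s \<Otimes>\<^sub>M borel)" unfolding f_def by measurable
  have f': "f \<in> borel_measurable (distr M (F s) (\<lambda>\<omega>. \<omega>) \<Otimes>\<^sub>M distr M borel D)"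
    using f by (subst measurable_cong_sets[OF sets_pair_measure_cong[OF sets_distr sets_distr] refl])
  have pair: "(\<lambda>\<omega>. (\<omega>, D \<omega>)) \<in> measurable M (F s \<Otimes>\<^sub>M borel)" by (intro measurable_Pair id D)
  have inner: "(\<integral>\<^sup>+d. f (\<omega>, d) \<partial>distr M borel D) = Y \<omega>" for \<omega>
  proof -
    have "(\<integral>\<^sup>+d. f (\<omega>, d) \<partial>distr M borel D) =
        (\<integral>\<^sup>+\<omega>'. Y \<omega> * ennreal (exp (\<zeta> \<omega> * D \<omega>' $ j - (\<zeta> \<omega>)\<^sup>2 * (t - s) / 2)) \<partial>M)"
      unfolding f_def by (subst nn_integral_distr) (auto intro!: measurable_compose[OF D])
    also have "\<dots> = Y \<omega> * (\<integral>\<^sup>+\<omega>'. ennreal (exp (\<zeta> \<omega> * D \<omega>' $ j - (\<zeta> \<omega>)\<^sup>2 * (t - s) / 2)) \<partial>M)"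
      by (intro nn_integral_cmult) measurable
    also have "(\<integral>\<^sup>+\<omega>'. ennreal (exp (\<zeta> \<omega> * D \<omega>' $ j - (\<zeta> \<omega>)\<^sup>2 * (t - s) / 2)) \<partial>M) =
        (\<integral>\<^sup>+d. ennreal (normal_density 0 (sqrt (t - s)) d) *
               ennreal (exp (\<zeta> \<omega> * d - (\<zeta> \<omega>)\<^sup>2 * (t - s) / 2)) \<partial>lborel)"
      using increments_normal[OF st] unfolding D_def
      by (intro distributed_nn_integral[symmetric]) auto
    also have "\<dots> = 1" using st by (intro gaussian_exp_moment) auto
    finally show ?thesis by simp
  qed
  have "(\<integral>\<^sup>+\<omega>. Y \<omega> * ennreal (exp (\<zeta> \<omega> * (B t \<omega> $ j - B s \<omega> $ j) - (\<zeta> \<omega>)\<^sup>2 * (t - s) / 2)) \<partial>M) =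
      (\<integral>\<^sup>+\<omega>. f (\<omega>, D \<omega>) \<partial>M)"
    by (simp add: f_def D_def)
  also have "\<dots> = (\<integral>\<^sup>+x. f x \<partial>distr M (F s \<Otimes>\<^sub>M borel) (\<lambda>\<omega>. (\<omega>, D \<omega>)))"
    by (subst nn_integral_distr[OF pair]) auto
  also have "\<dots> = (\<integral>\<^sup>+x. f x \<partial>(distr M (F s) (\<lambda>\<omega>. \<omega>) \<Otimes>\<^sub>M distr M borel D))" by (simp add: joint)
  also have "\<dots> = (\<integral>\<^sup>+\<omega>. \<integral>\<^sup>+d. f (\<omega>, d) \<partial>distr M borel D \<partial>distr M (F s) (\<lambda>\<omega>. \<omega>))"
    by (rule D.nn_integral_fst[symmetric]) (rule f')
  also have "\<dots> = (\<integral>\<^sup>+\<omega>. Y \<omega> \<partial>M)" unfolding inner by (subst nn_integral_distr[OF id]) auto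
  finally show ?thesis .
qed

text \<open>The last factor of this discrete stochastic exponential integrates out, because all
  earlier factors are known at the time where its increment starts.\<close>

lemma step_exp_moment:
  fixes \<zeta> :: "nat \<Rightarrow> 'w \<Rightarrow> real"
  assumes r: "0 \<le> r" and q: "partition_of r t N q"
    and meas: "\<And>k. k < N \<Longrightarrow> \<zeta> k \<in> borel_measurable (F (q k))"
  shows "(\<integral>\<^sup>+\<omega>. ennreal (exp (\<Sum>k<N. \<zeta> k \<omega> * (B (q (Suc k)) \<omega> $ j - B (q k) \<omega> $ j) -
      (\<zeta> k \<omega>)\<^sup>2 * (q (Suc k) - q k) / 2)) \<partial>M) = 1"
proof -
  define Y where "Y n \<omega> = ennreal (exp (\<Sum>k<n. \<zeta> k \<omega> * (B (q (Suc k)) \<omega> $ j - B (q k) \<omega> $ j) -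
      (\<zeta> k \<omega>)\<^sup>2 * (q (Suc k) - q k) / 2))" for n \<omega>
  have pos: "0 \<le> q k" if "k \<le> N" for k using partition_of_bounds(1)[OF q that] r by simp
  have Bm: "(\<lambda>\<omega>. B (q k) \<omega> $ j) \<in> borel_measurable (F (q n))" if "k \<le> n" "n \<le> N" for k n
  proof -
    have "B (q k) \<in> borel_measurable (F (q n))"
      using that pos[of k] by (intro F_measurable_mono[OF _ adapted] partition_of_le[OF q]) auto
    then show ?thesis
      by (rule measurable_compose) (intro borel_measurable_continuous_onI continuous_intros)
  qed
  have zm: "\<zeta> k \<in> borel_measurable (F (q n))" if "k < n" "n \<le> N" for k n
    using that by (intro F_measurable_mono[OF _ meas] partition_of_le[OF q]) auto
  have Ym: "Y n \<in> borel_measurable (F (q n))" if "n \<le> N" for n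
    unfolding Y_def using that
    by (intro measurable_compose[OF _ measurable_ennreal] borel_measurable_exp[THEN measurable_compose[rotated]]
        borel_measurable_sum borel_measurable_diff borel_measurable_times borel_measurable_divide
        borel_measurable_power Bm zm borel_measurable_const) auto
  have "(\<integral>\<^sup>+\<omega>. Y n \<omega> \<partial>M) = 1" if "n \<le> N" for n
    using that
  proof (induction n)
    case 0
    then show ?case by (simp add: Y_def emeasure_space_1)
  next
    case (Suc n)
    have "(\<integral>\<^sup>+\<omega>. Y (Suc n) \<omega> \<partial>M) = (\<integral>\<^sup>+\<omega>. Y n \<omega> * ennreal (exp (\<zeta> n \<omega> *
        (B (q (Suc n)) \<omega> $ j - B (q n) \<omega> $ j) - (\<zeta> n \<omega>)\<^sup>2 * (q (Suc n) - q n) / 2)) \<partial>M)"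
      by (simp add: Y_def exp_add ennreal_mult'[symmetric])
    also have "\<dots> = (\<integral>\<^sup>+\<omega>. Y n \<omega> \<partial>M)"
      using Suc.prems pos[of n] partition_of_less[OF q, of n "Suc n"]
      by (intro increment_exp_martingale Ym meas) auto
    finally show ?case using Suc by simp
  qed
  from this[of N] show ?thesis by (simp add: Y_def)
qed

end

text \<open>No point of \<open>p\<close> lies strictly between neighbours of \<open>q\<close>. Hence
  the process is constant on each left-open cell of \<open>q\<close> and is represented by its value
  at the right end; by the second claim, a weight in force there is already known at the left
  end.\<close>

lemma elementary_process_refine:
  assumes p: "partition_of r t n p" and q: "partition_of r' t' N q"
    and sub: "p ` {..n} \<subseteq> q ` {..N}" and k: "k < N"
  shows "v \<in> {q k<..q (Suc k)} \<Longrightarrow>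
      elementary_process n p \<xi> v \<omega> = elementary_process n p \<xi> (q (Suc k)) \<omega>"
    and "i \<le> n \<Longrightarrow> p i < q (Suc k) \<Longrightarrow> p i \<le> q k"
proof -
  have low: "p i \<le> q k" if i: "i \<le> n" "p i < q (Suc k)" for i
  proof -
    obtain l where l: "l \<le> N" "p i = q l" using sub i by blast
    then have "l < Suc k" using i partition_of_le[OF q, of "Suc k" l] k by force
    then show ?thesis using l k by (auto intro: partition_of_le[OF q])
  qed
  then show "i \<le> n \<Longrightarrow> p i < q (Suc k) \<Longrightarrow> p i \<le> q k" .
  assume v: "v \<in> {q k<..q (Suc k)}"
  have "indicator {p i<..p (Suc i)} v = (indicator {p i<..p (Suc i)} (q (Suc k)) :: real)" if "i < n" for i
    using low[of i] low[of "Suc i"] v that by (force simp: indicator_def)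
  then show "elementary_process n p \<xi> v \<omega> = elementary_process n p \<xi> (q (Suc k)) \<omega>"
    unfolding elementary_process_def by (intro sum.cong) auto
qed

text \<open>Increments over the fine cells inside one coarse cell telescope. This puts two
  elementary integrals on the same partition, where they can be subtracted.\<close>

lemma elementary_integral_refine:
  assumes p: "partition_of r t n p" and q: "partition_of r' t' N q"
    and sub: "p ` {..n} \<subseteq> q ` {..N}"
  shows "elementary_integral \<beta> n p \<xi> \<omega> =
      (\<Sum>k<N. elementary_process n p \<xi> (q (Suc k)) \<omega> * (\<beta> (q (Suc k)) \<omega> - \<beta> (q k) \<omega>))"
proof -
  have tel: "(\<Sum>k<N. indicator {p i<..p (Suc i)} (q (Suc k)) * (\<beta> (q (Suc k)) \<omega> - \<beta> (q k) \<omega>)) =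
      \<beta> (p (Suc i)) \<omega> - \<beta> (p i) \<omega>" if i: "i < n" for i
  proof -
    obtain a where a: "a \<le> N" "p i = q a" using sub i by (metis atMost_iff image_iff image_subset_iff less_imp_le)
    obtain b where b: "b \<le> N" "p (Suc i) = q b"
      using sub i by (metis atMost_iff image_iff image_subset_iff Suc_leI)
    have ab: "a < b"
      using partition_of_less[OF p, of i "Suc i"] i partition_of_le[OF q, of b a] a b by force
    have iff: "q (Suc k) \<in> {p i<..p (Suc i)} \<longleftrightarrow> k \<in> {a..<b}" if "k < N" for k
      using partition_of_less[OF q, of a "Suc k"] partition_of_le[OF q, of "Suc k" a]
        partition_of_less[OF q, of b "Suc k"] partition_of_le[OF q, of "Suc k" b] a b that
      by (auto simp: not_less) (metis Suc_leI leD leI less_Suc_eq_le)+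
    have "(\<Sum>k<N. indicator {p i<..p (Suc i)} (q (Suc k)) * (\<beta> (q (Suc k)) \<omega> - \<beta> (q k) \<omega>)) =
        (\<Sum>k<N. if k \<in> {a..<b} then \<beta> (q (Suc k)) \<omega> - \<beta> (q k) \<omega> else 0)"
    proof (intro sum.cong refl)
      fix k assume "k \<in> {..<N}"
      then show "indicator {p i<..p (Suc i)} (q (Suc k)) * (\<beta> (q (Suc k)) \<omega> - \<beta> (q k) \<omega>) =
          (if k \<in> {a..<b} then \<beta> (q (Suc k)) \<omega> - \<beta> (q k) \<omega> else 0)"
        using iff[of k] by (auto simp: indicator_def)
    qed
    also have "\<dots> = (\<Sum>k\<in>{..<N} \<inter> {a..<b}. \<beta> (q (Suc k)) \<omega> - \<beta> (q k) \<omega>)"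
      by (simp add: sum.inter_restrict)
    also have "{..<N} \<inter> {a..<b} = {a..<b}" using b by auto
    also have "(\<Sum>k\<in>{a..<b}. \<beta> (q (Suc k)) \<omega> - \<beta> (q k) \<omega>) = \<beta> (q b) \<omega> - \<beta> (q a) \<omega>"
      using ab by (intro sum_Suc_diff') auto
    finally show ?thesis using a b by simp
  qed
  have "(\<Sum>k<N. elementary_process n p \<xi> (q (Suc k)) \<omega> * (\<beta> (q (Suc k)) \<omega> - \<beta> (q k) \<omega>)) =
      (\<Sum>i<n. \<xi> i \<omega> * (\<Sum>k<N. indicator {p i<..p (Suc i)} (q (Suc k)) * (\<beta> (q (Suc k)) \<omega> - \<beta> (q k) \<omega>)))"
    unfolding elementary_process_def sum_distrib_right sum_distrib_left
    by (subst sum.swap) (simp add: mult.assoc)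
  also have "\<dots> = elementary_integral \<beta> n p \<xi> \<omega>"
    unfolding elementary_integral_def by (intro sum.cong refl) (simp only: tel lessThan_iff)
  finally show ?thesis by simp
qed

lemma elementary_process_outside:
  assumes "partition_of r t n p" "v \<notin> {r<..t}"
  shows "elementary_process n p \<xi> v \<omega> = 0"
proof -
  have "v \<notin> {p i<..p (Suc i)}" if "i < n" for i
    using partition_of_bounds[OF assms(1), of i] partition_of_bounds[OF assms(1), of "Suc i"] that assms(2)
    by auto
  then show ?thesis unfolding elementary_process_def by (intro sum.neutral) auto
qed

section \<open>From elementary to general integrands\<close>

context brownian_motion
begin

text \<open>The Ito integrals up to \<open>s\<close> and up to \<open>t\<close> have unrelated
  approximating sequences, so their difference must be treated at the elementary level. On a common
  refinement it is the elementary integral of \<open>h1 - h2\<close>, and \<open>V\<close> is its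
  quadratic variation. This integrand is nearly 0 up to \<open>s\<close>, where both processes
  approximate \<open>H\<close>, and nearly \<open>H\<close> afterwards, which gives \<open>V\<close>
  of size \<open>t - s\<close> up to the approximation errors.\<close>

lemma elementary_increment_exp:
  fixes H :: "real \<Rightarrow> 'w \<Rightarrow> real"
  assumes rst: "0 \<le> r" "r \<le> s" "s \<le> t"
    and Hm: "\<And>\<omega>. \<omega> \<in> space M \<Longrightarrow> set_borel_measurable borel {r..t} (\<lambda>v. H v \<omega>)"
    and H: "\<And>v \<omega>. v \<in> {r..t} \<Longrightarrow> \<bar>H v \<omega>\<bar> \<le> K"
    and e1: "elementary_data F r t n1 p1 \<xi>1" and e2: "elementary_data F r s n2 p2 \<xi>2"
  obtains V where "V \<in> borel_measurable M"
    "\<And>\<theta>. (\<integral>\<^sup>+\<omega>. ennreal (exp (\<theta> * (elementary_integral (\<lambda>v \<omega>. B v \<omega> $ j) n1 p1 \<xi>1 \<omega> -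
        elementary_integral (\<lambda>v \<omega>. B v \<omega> $ j) n2 p2 \<xi>2 \<omega>) - \<theta>\<^sup>2 / 2 * V \<omega>)) \<partial>M) = 1"
    "\<And>\<omega>. \<omega> \<in> space M \<Longrightarrow> ennreal (V \<omega>) \<le>
        2 * (\<integral>\<^sup>+v\<in>{r..t}. ennreal ((elementary_process n1 p1 \<xi>1 v \<omega> - H v \<omega>)\<^sup>2) \<partial>lborel) +
        2 * (\<integral>\<^sup>+v\<in>{r..s}. ennreal ((elementary_process n2 p2 \<xi>2 v \<omega> - H v \<omega>)\<^sup>2) \<partial>lborel) +
        ennreal (2 * K\<^sup>2 * (t - s))"
proof -
  have p1: "partition_of r t n1 p1" and p2: "partition_of r s n2 p2"
    using e1 e2 by (auto simp: elementary_data_def)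
  have "r \<in> p1 ` {..n1}" "t \<in> p1 ` {..n1}" using p1 by (auto simp: partition_of_def image_iff)
  moreover have "r \<le> x \<and> x \<le> t" if "x \<in> p1 ` {..n1} \<union> p2 ` {..n2}" for x
    using that partition_of_bounds[OF p1] partition_of_bounds[OF p2] rst by fastforce
  ultimately obtain N q where q: "partition_of r t N q" "q ` {..N} = p1 ` {..n1} \<union> p2 ` {..n2}"
    using partition_of_finite_set[of "p1 ` {..n1} \<union> p2 ` {..n2}" r t] by auto
  define h1 where "h1 = elementary_process n1 p1 \<xi>1"
  define h2 where "h2 = elementary_process n2 p2 \<xi>2"
  define g where "g v \<omega> = h1 v \<omega> - h2 v \<omega>" for v \<omega>
  define V where "V \<omega> = (\<Sum>k<N. (g (q (Suc k)) \<omega>)\<^sup>2 * (q (Suc k) - q k))" for \<omega>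
  have hm: "elementary_process n p \<xi> (q (Suc k)) \<in> borel_measurable (F (q k))"
    if k: "k < N" and e: "elementary_data F r t' n p \<xi>" and sub: "p ` {..n} \<subseteq> q ` {..N}" for n p \<xi> k t'
    unfolding elementary_process_def
  proof (intro borel_measurable_sum)
    fix i assume i: "i \<in> {..<n}"
    have p: "partition_of r t' n p" using e by (simp add: elementary_data_def)
    show "(\<lambda>\<omega>. \<xi> i \<omega> * indicator {p i<..p (Suc i)} (q (Suc k))) \<in> borel_measurable (F (q k))"
    proof (cases "p i < q (Suc k)")
      case True
      then have "p i \<le> q k" using elementary_process_refine(2)[OF p q(1) sub k, of i] i by auto
      moreover have "\<xi> i \<in> borel_measurable (F (p i))" using e i by (simp add: elementary_data_def)
      ultimately have [measurable]: "\<xi> i \<in> borel_measurable (F (q k))" by (rule F_measurable_mono)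
      show ?thesis by measurable
    qed auto
  qed
  have gm: "g (q (Suc k)) \<in> borel_measurable (F (q k))" if "k < N" for k
    unfolding g_def h1_def h2_def
    by (intro borel_measurable_diff hm[OF that e1] hm[OF that e2]) (auto simp: q)
  show thesis
  proof (rule that[of V])
    show "V \<in> borel_measurable M"
      unfolding V_def
      by (intro borel_measurable_sum borel_measurable_times borel_measurable_power borel_measurable_const)
         (auto intro: F_measurable_M[OF gm])
  next
    fix \<theta> :: real
    have step: "(\<integral>\<^sup>+\<omega>. ennreal (exp (\<Sum>k<N. (\<theta> * g (q (Suc k)) \<omega>) * (B (q (Suc k)) \<omega> $ j - B (q k) \<omega> $ j) -
      (\<theta> * g (q (Suc k)) \<omega>)\<^sup>2 * (q (Suc k) - q k) / 2)) \<partial>M) = 1"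
      by (intro step_exp_moment[OF rst(1) q(1)] borel_measurable_times gm borel_measurable_const)
    have eq: "(\<Sum>k<N. (\<theta> * g (q (Suc k)) \<omega>) * (B (q (Suc k)) \<omega> $ j - B (q k) \<omega> $ j) -
        (\<theta> * g (q (Suc k)) \<omega>)\<^sup>2 * (q (Suc k) - q k) / 2) =
      \<theta> * (elementary_integral (\<lambda>v \<omega>. B v \<omega> $ j) n1 p1 \<xi>1 \<omega> -
        elementary_integral (\<lambda>v \<omega>. B v \<omega> $ j) n2 p2 \<xi>2 \<omega>) - \<theta>\<^sup>2 / 2 * V \<omega>" for \<omega>
    proof -
      have "elementary_integral (\<lambda>v \<omega>. B v \<omega> $ j) n1 p1 \<xi>1 \<omega> -
          elementary_integral (\<lambda>v \<omega>. B v \<omega> $ j) n2 p2 \<xi>2 \<omega> =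
          (\<Sum>k<N. g (q (Suc k)) \<omega> * (B (q (Suc k)) \<omega> $ j - B (q k) \<omega> $ j))"
        unfolding g_def h1_def h2_def left_diff_distrib sum_subtractf
        using q(2) by (subst (1 2) elementary_integral_refine[OF _ q(1)]) (auto intro: p1 p2)
      then show ?thesis
        by (simp only: V_def sum_subtractf sum_distrib_left power_mult_distrib mult.assoc times_divide_eq_left
            sum_divide_distrib times_divide_eq_right)
    qed
    from step show "(\<integral>\<^sup>+\<omega>. ennreal (exp (\<theta> * (elementary_integral (\<lambda>v \<omega>. B v \<omega> $ j) n1 p1 \<xi>1 \<omega> -
        elementary_integral (\<lambda>v \<omega>. B v \<omega> $ j) n2 p2 \<xi>2 \<omega>) - \<theta>\<^sup>2 / 2 * V \<omega>)) \<partial>M) = 1"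
      unfolding eq .
  next
    fix \<omega> assume \<omega>: "\<omega> \<in> space M"
    have hb: "elementary_process n p \<xi> v \<omega> = (\<Sum>i<n. \<xi> i \<omega> * indicator {p i<..p (Suc i)} v)" for n p \<xi> v
      by (simp add: elementary_process_def)
    have [measurable]: "(\<lambda>v. h1 v \<omega>) \<in> borel_measurable borel" "(\<lambda>v. h2 v \<omega>) \<in> borel_measurable borel"
      unfolding h1_def h2_def hb by measurable
    have "(\<integral>\<^sup>+v. (\<Sum>k<N. ennreal ((g (q (Suc k)) \<omega>)\<^sup>2) * indicator {q k<..q (Suc k)} v) \<partial>lborel) =
        (\<Sum>k<N. ennreal ((g (q (Suc k)) \<omega>)\<^sup>2) * ennreal (q (Suc k) - q k))"
      using partition_of_le[OF q(1)] by (subst nn_integral_sum) (auto simp: nn_integral_cmult)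
    also have "\<dots> = (\<Sum>k<N. ennreal ((g (q (Suc k)) \<omega>)\<^sup>2 * (q (Suc k) - q k)))"
      using partition_of_le[OF q(1)] by (intro sum.cong) (auto simp: ennreal_mult')
    also have "\<dots> = ennreal (V \<omega>)"
      unfolding V_def using partition_of_le[OF q(1)] by (intro sum_ennreal) auto
    finally have "ennreal (V \<omega>) =
        (\<integral>\<^sup>+v. (\<Sum>k<N. ennreal ((g (q (Suc k)) \<omega>)\<^sup>2) * indicator {q k<..q (Suc k)} v) \<partial>lborel)" by simp
    also have "\<dots> \<le> (\<integral>\<^sup>+v. ennreal ((g v \<omega>)\<^sup>2) * indicator {r..t} v \<partial>lborel)"
    proof (intro nn_integral_mono)
      fix v
      show "(\<Sum>k<N. ennreal ((g (q (Suc k)) \<omega>)\<^sup>2) * indicator {q k<..q (Suc k)} v)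
          \<le> ennreal ((g v \<omega>)\<^sup>2) * indicator {r..t} v"
      proof (cases "\<exists>k<N. v \<in> {q k<..q (Suc k)}")
        case True
        then obtain k where k: "k < N" "v \<in> {q k<..q (Suc k)}" by blast
        have other: "v \<notin> {q l<..q (Suc l)}" if "l < N" "l \<noteq> k" for l
        proof (cases "l < k")
          case True
          then show ?thesis using partition_of_le[OF q(1), of "Suc l" k] k by auto
        next
          case False
          then show ?thesis using partition_of_le[OF q(1), of "Suc k" l] k that by auto
        qed
        have "(\<Sum>l<N. ennreal ((g (q (Suc l)) \<omega>)\<^sup>2) * indicator {q l<..q (Suc l)} v) =
            (\<Sum>l<N. if l = k then ennreal ((g (q (Suc k)) \<omega>)\<^sup>2) else 0)"
          using other k(2) by (intro sum.cong refl) (auto simp: indicator_def)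
        also have "\<dots> = ennreal ((g (q (Suc k)) \<omega>)\<^sup>2)" using k by simp
        also have "g (q (Suc k)) \<omega> = g v \<omega>"
          using elementary_process_refine(1)[OF p1 q(1) _ k, of \<xi>1 \<omega>]
            elementary_process_refine(1)[OF p2 q(1) _ k, of \<xi>2 \<omega>] q(2)
          by (auto simp: g_def h1_def h2_def)
        finally show ?thesis
          using k partition_of_bounds(1)[OF q(1), of k] partition_of_bounds(2)[OF q(1), of "Suc k"] by auto
      next
        case False
        then have "(\<Sum>k<N. ennreal ((g (q (Suc k)) \<omega>)\<^sup>2) * indicator {q k<..q (Suc k)} v) = 0"
          by (intro sum.neutral) (auto simp: indicator_def)
        then show ?thesis by (simp only: zero_le)
      qed
    qed
    also have "\<dots> \<le> (\<integral>\<^sup>+v. 2 * (ennreal ((h1 v \<omega> - H v \<omega>)\<^sup>2) * indicator {r..t} v) +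
        2 * (ennreal ((h2 v \<omega> - H v \<omega>)\<^sup>2) * indicator {r..s} v) +
        ennreal (2 * K\<^sup>2) * indicator {s<..t} v \<partial>lborel)"
    proof (intro nn_integral_mono)
      fix v
      \<comment> \<open>Used with \<open>z\<close> the value of \<open>H\<close>. The factor 2 is
        why the final exponent contains \<open>K\<close> squared rather than half of it.\<close>
      have sq: "(x - y)\<^sup>2 \<le> 2 * (x - z)\<^sup>2 + 2 * (y - z)\<^sup>2" for x y z :: real
        using zero_le_power2[of "x + y - 2 * z"] by (simp add: power2_eq_square algebra_simps)
      consider "v \<in> {r..s}" | "v \<in> {s<..t}" | "v \<notin> {r..t}" by force
      then show "ennreal ((g v \<omega>)\<^sup>2) * indicator {r..t} v \<le> 
        2 * (ennreal ((h1 v \<omega> - H v \<omega>)\<^sup>2) * indicator {r..t} v) +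
        2 * (ennreal ((h2 v \<omega> - H v \<omega>)\<^sup>2) * indicator {r..s} v) + ennreal (2 * K\<^sup>2) * indicator {s<..t} v"
      proof cases
        case 1
        have "ennreal ((g v \<omega>)\<^sup>2) \<le> ennreal (2 * (h1 v \<omega> - H v \<omega>)\<^sup>2 + 2 * (h2 v \<omega> - H v \<omega>)\<^sup>2)"
          unfolding g_def by (intro ennreal_leI sq)
        also have "\<dots> = 2 * ennreal ((h1 v \<omega> - H v \<omega>)\<^sup>2) + 2 * ennreal ((h2 v \<omega> - H v \<omega>)\<^sup>2)"
          by (simp add: ennreal_plus ennreal_mult')
        finally show ?thesis using 1 rst by (auto simp: indicator_def)
      next
        \<comment> \<open>After \<open>s\<close> the second process vanishes, so it plays the part
          of \<open>y = 0\<close> and the bound on \<open>H\<close> remains.\<close>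
        case 2
        have "h2 v \<omega> = 0" unfolding h2_def using 2 by (intro elementary_process_outside[OF p2]) auto
        then have "(g v \<omega>)\<^sup>2 \<le> 2 * (h1 v \<omega> - H v \<omega>)\<^sup>2 + 2 * (H v \<omega>)\<^sup>2"
          using sq[of "h1 v \<omega>" 0 "H v \<omega>"] by (simp add: g_def)
        also have "(H v \<omega>)\<^sup>2 \<le> K\<^sup>2" using H[of v \<omega>] 2 rst by (intro abs_le_square_iff[THEN iffD1]) auto
        finally have "ennreal ((g v \<omega>)\<^sup>2) \<le> ennreal (2 * (h1 v \<omega> - H v \<omega>)\<^sup>2 + 2 * K\<^sup>2)"
          by (intro ennreal_leI) auto
        also have "\<dots> = 2 * ennreal ((h1 v \<omega> - H v \<omega>)\<^sup>2) + ennreal (2 * K\<^sup>2)"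
          by (simp add: ennreal_plus ennreal_mult')
        finally show ?thesis using 2 rst by (auto simp: indicator_def)
      qed auto
    qed
    also have "\<dots> = 2 * (\<integral>\<^sup>+v\<in>{r..t}. ennreal ((h1 v \<omega> - H v \<omega>)\<^sup>2) \<partial>lborel) +
        2 * (\<integral>\<^sup>+v\<in>{r..s}. ennreal ((h2 v \<omega> - H v \<omega>)\<^sup>2) \<partial>lborel) + ennreal (2 * K\<^sup>2 * (t - s))"
    proof -
      \<comment> \<open>Sections of \<open>H\<close> are measurable on \<open>{r..t}\<close> only;
        cutting off outside makes them measurable on the whole line without changing the
        integrals.\<close>
      define H' where "H' v = indicat_real {r..t} v * H v \<omega>" for v
      have [measurable]: "H' \<in> borel_measurable borel"
        using Hm[OF \<omega>] by (simp add: H'_def[abs_def] set_borel_measurable_def)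
      have eq: "ennreal ((h1 v \<omega> - H v \<omega>)\<^sup>2) * indicator {r..t} v = ennreal ((h1 v \<omega> - H' v)\<^sup>2) * indicator {r..t} v"
        "ennreal ((h2 v \<omega> - H v \<omega>)\<^sup>2) * indicator {r..s} v = ennreal ((h2 v \<omega> - H' v)\<^sup>2) * indicator {r..s} v"
        for v using rst by (auto simp: H'_def indicator_def)
      show ?thesis
        unfolding eq using rst by (simp add: nn_integral_add nn_integral_cmult ennreal_mult')
    qed
    finally show "ennreal (V \<omega>) \<le>
        2 * (\<integral>\<^sup>+v\<in>{r..t}. ennreal ((elementary_process n1 p1 \<xi>1 v \<omega> - H v \<omega>)\<^sup>2) \<partial>lborel) +
        2 * (\<integral>\<^sup>+v\<in>{r..s}. ennreal ((elementary_process n2 p2 \<xi>2 v \<omega> - H v \<omega>)\<^sup>2) \<partial>lborel) +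
        ennreal (2 * K\<^sup>2 * (t - s))"
      unfolding h1_def h2_def .
  qed
qed

lemma progressive_section_measurable:
  assumes "progressive_on F r t H" "r \<le> t" "\<omega> \<in> space M"
  shows "set_borel_measurable borel {r..t} (\<lambda>v. H v \<omega>)"
proof -
  have 1: "(\<lambda>(s, \<omega>). H s \<omega>) \<in> borel_measurable (restrict_space borel {r..t} \<Otimes>\<^sub>M F t)"
    using assms by (simp add: progressive_on_def)
  have 2: "(\<lambda>v. (v, \<omega>)) \<in> measurable (restrict_space borel {r..t}) (restrict_space borel {r..t} \<Otimes>\<^sub>M F t)"
    using assms(3) space_F by (intro measurable_Pair measurable_ident measurable_const) auto
  have "(\<lambda>v. H v \<omega>) \<in> borel_measurable (restrict_space borel {r..t})"
    using measurable_compose[OF 2 1] by simp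
  then show ?thesis
    unfolding set_borel_measurable_def by (subst borel_measurable_restrict_space_iff[symmetric]) auto
qed

text \<open>Truncating the left hand side at \<open>c\<close> lets convergence in probability suffice, so that no
  almost surely convergent subsequence has to be extracted.\<close>

lemma ito_increment_exp:
  fixes H :: "real \<Rightarrow> 'w \<Rightarrow> real"
  assumes rst: "0 \<le> r" "r \<le> s" "s \<le> t"
    and H: "\<And>v \<omega>. v \<in> {r..t} \<Longrightarrow> \<bar>H v \<omega>\<bar> \<le> K"
    and It: "is_ito_integral M F (\<lambda>v \<omega>. B v \<omega> $ j) r t H It"
    and Is: "is_ito_integral M F (\<lambda>v \<omega>. B v \<omega> $ j) r s H Is"
  shows "(\<integral>\<^sup>+\<omega>. ennreal (exp (\<theta> * (It \<omega> - Is \<omega>))) \<partial>M) \<le> ennreal (exp (\<theta>\<^sup>2 * (K\<^sup>2 * (t - s))))"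
proof -
  have [measurable]: "It \<in> borel_measurable M" "Is \<in> borel_measurable M"
    and Hm: "\<And>\<omega>. \<omega> \<in> space M \<Longrightarrow> set_borel_measurable borel {r..t} (\<lambda>v. H v \<omega>)"
    using It Is rst progressive_section_measurable[of r t H] by (auto simp: is_ito_integral_def)
  obtain n1 p1 \<xi>1 where 1: "\<And>m. elementary_data F r t (n1 m) (p1 m) (\<xi>1 m)"
    "tends_to_zero_in_prob M (\<lambda>m \<omega>. \<integral>\<^sup>+ v\<in>{r..t}.
          ennreal ((elementary_process (n1 m) (p1 m) (\<xi>1 m) v \<omega> - H v \<omega>)\<^sup>2) \<partial>lborel)"
    "tends_to_zero_in_prob M (\<lambda>m \<omega>.
          ennreal \<bar>elementary_integral (\<lambda>v \<omega>. B v \<omega> $ j) (n1 m) (p1 m) (\<xi>1 m) \<omega> - It \<omega>\<bar>)"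
    using It unfolding is_ito_integral_def by blast
  obtain n2 p2 \<xi>2 where 2: "\<And>m. elementary_data F r s (n2 m) (p2 m) (\<xi>2 m)"
    "tends_to_zero_in_prob M (\<lambda>m \<omega>. \<integral>\<^sup>+ v\<in>{r..s}.
          ennreal ((elementary_process (n2 m) (p2 m) (\<xi>2 m) v \<omega> - H v \<omega>)\<^sup>2) \<partial>lborel)"
    "tends_to_zero_in_prob M (\<lambda>m \<omega>.
          ennreal \<bar>elementary_integral (\<lambda>v \<omega>. B v \<omega> $ j) (n2 m) (p2 m) (\<xi>2 m) \<omega> - Is \<omega>\<bar>)"
    using Is unfolding is_ito_integral_def by blast
  define E1 where "E1 m \<omega> = (\<integral>\<^sup>+ v\<in>{r..t}.
      ennreal ((elementary_process (n1 m) (p1 m) (\<xi>1 m) v \<omega> - H v \<omega>)\<^sup>2) \<partial>lborel)" for m \<omega>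
  define E2 where "E2 m \<omega> = (\<integral>\<^sup>+ v\<in>{r..s}.
      ennreal ((elementary_process (n2 m) (p2 m) (\<xi>2 m) v \<omega> - H v \<omega>)\<^sup>2) \<partial>lborel)" for m \<omega>
  define J1 where "J1 m = elementary_integral (\<lambda>v \<omega>. B v \<omega> $ j) (n1 m) (p1 m) (\<xi>1 m)" for m
  define J2 where "J2 m = elementary_integral (\<lambda>v \<omega>. B v \<omega> $ j) (n2 m) (p2 m) (\<xi>2 m)" for m
  have conv: "tends_to_zero_in_prob M E1" "tends_to_zero_in_prob M E2"
    "tends_to_zero_in_prob M (\<lambda>m \<omega>. ennreal \<bar>J1 m \<omega> - It \<omega>\<bar>)"
    "tends_to_zero_in_prob M (\<lambda>m \<omega>. ennreal \<bar>J2 m \<omega> - Is \<omega>\<bar>)"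
    using 1 2 unfolding E1_def[abs_def] E2_def[abs_def] J1_def J2_def by auto
  \<comment> \<open>With all four approximation errors at most \<epsilon>, the integrals move by at
    most 2\<epsilon> together, and \<open>V\<close> is at most
    \<open>4 * \<epsilon> + 2 * K\<^sup>2 * (t - s)\<close>. Inserted into the exponent, these two
    estimates give \<open>k0\<close>.\<close>
  define k0 where "k0 \<epsilon> = exp (2 * \<bar>\<theta>\<bar> * \<epsilon> + \<theta>\<^sup>2 * (2 * \<epsilon> + K\<^sup>2 * (t - s)))" for \<epsilon> :: real
  have trunc: "(\<integral>\<^sup>+\<omega>. min (ennreal (exp (\<theta> * (It \<omega> - Is \<omega>)))) (of_nat c) \<partial>M) \<le> ennreal (k0 \<epsilon>)"
    if e: "\<epsilon> > 0" for \<epsilon> :: real and c :: nat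
  proof -
    \<comment> \<open>Off the exceptional event \<open>b m\<close> the integrand is
      \<open>k0 \<epsilon>\<close> times an exponential of mean 1. On it the truncation gives at
      most \<open>c\<close>, and its probability tends to 0.\<close>
    define bad where "bad Z m = {\<omega> \<in> space M. Z m \<omega> > ennreal \<epsilon>}" for Z :: "nat \<Rightarrow> 'w \<Rightarrow> ennreal" and m
    define b where "b m = bad E1 m \<union> bad E2 m \<union> (bad (\<lambda>m \<omega>. ennreal \<bar>J1 m \<omega> - It \<omega>\<bar>) m \<union>
      bad (\<lambda>m \<omega>. ennreal \<bar>J2 m \<omega> - Is \<omega>\<bar>) m)" for m
    have badm: "bad Z m \<in> sets M" and badp: "(\<lambda>m. measure M (bad Z m)) \<longlonglongrightarrow> 0"
      if "tends_to_zero_in_prob M Z" for Z m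
    proof -
      have [measurable]: "Z m \<in> borel_measurable M" using that by (simp add: tends_to_zero_in_prob_def)
      show "bad Z m \<in> sets M" unfolding bad_def by measurable
      show "(\<lambda>m. measure M (bad Z m)) \<longlonglongrightarrow> 0"
        using that e unfolding bad_def tends_to_zero_in_prob_def by blast
    qed
    have bm: "b m \<in> sets M" for m unfolding b_def by (intro sets.Un badm conv)
    have bp: "(\<lambda>m. measure M (b m)) \<longlonglongrightarrow> 0"
    proof (rule tendsto_sandwich[OF _ _ tendsto_const])
      let ?s = "\<lambda>m. measure M (bad E1 m) + measure M (bad E2 m) +
        (measure M (bad (\<lambda>m \<omega>. ennreal \<bar>J1 m \<omega> - It \<omega>\<bar>) m) + measure M (bad (\<lambda>m \<omega>. ennreal \<bar>J2 m \<omega> - Is \<omega>\<bar>) m))"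
      have "?s \<longlonglongrightarrow> 0 + 0 + (0 + 0)" by (intro tendsto_add badp conv)
      then show "?s \<longlonglongrightarrow> 0" by simp
      show "\<forall>\<^sub>F m in sequentially. measure M (b m) \<le> ?s m"
        unfolding b_def
        by (intro always_eventually allI order_trans[OF measure_Un_le] add_mono order_refl
            sets.Un badm conv)
    qed auto
    have "(\<integral>\<^sup>+\<omega>. min (ennreal (exp (\<theta> * (It \<omega> - Is \<omega>)))) (of_nat c) \<partial>M) \<le>
        ennreal (k0 \<epsilon> + real c * measure M (b m))" for m
    proof -
      obtain V where V: "V \<in> borel_measurable M"
        "(\<integral>\<^sup>+\<omega>. ennreal (exp (\<theta> * (J1 m \<omega> - J2 m \<omega>) - \<theta>\<^sup>2 / 2 * V \<omega>)) \<partial>M) = 1"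
        "\<And>\<omega>. \<omega> \<in> space M \<Longrightarrow> ennreal (V \<omega>) \<le> 2 * E1 m \<omega> + 2 * E2 m \<omega> + ennreal (2 * K\<^sup>2 * (t - s))"
      proof (rule elementary_increment_exp[where j = j, OF rst Hm H 1(1)[of m] 2(1)[of m]])
        fix V assume "V \<in> borel_measurable M"
          "\<And>\<theta>. (\<integral>\<^sup>+\<omega>. ennreal (exp (\<theta> * (elementary_integral (\<lambda>v \<omega>. B v \<omega> $ j) (n1 m) (p1 m) (\<xi>1 m) \<omega> -
            elementary_integral (\<lambda>v \<omega>. B v \<omega> $ j) (n2 m) (p2 m) (\<xi>2 m) \<omega>) - \<theta>\<^sup>2 / 2 * V \<omega>)) \<partial>M) = 1"
          "\<And>\<omega>. \<omega> \<in> space M \<Longrightarrow> ennreal (V \<omega>) \<le> 2 * (\<integral>\<^sup>+ v\<in>{r..t}.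
              ennreal ((elementary_process (n1 m) (p1 m) (\<xi>1 m) v \<omega> - H v \<omega>)\<^sup>2) \<partial>lborel) +
            2 * (\<integral>\<^sup>+ v\<in>{r..s}.
              ennreal ((elementary_process (n2 m) (p2 m) (\<xi>2 m) v \<omega> - H v \<omega>)\<^sup>2) \<partial>lborel) +
            ennreal (2 * K\<^sup>2 * (t - s))"
        then show thesis using that[of V] unfolding E1_def E2_def J1_def J2_def by blast
      qed
      have Jm[measurable]: "J1 m \<in> borel_measurable M" "J2 m \<in> borel_measurable M"
      proof -
        have J: "elementary_integral (\<lambda>v \<omega>. B v \<omega> $ j) n p \<xi> \<in> borel_measurable M"
          if e: "elementary_data F r t' n p \<xi>" for n p \<xi> t'
        proof -
          have p: "partition_of r t' n p" using e by (simp add: elementary_data_def)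
          have B: "(\<lambda>\<omega>. B (p k) \<omega> $ j) \<in> borel_measurable M" if "k \<le> n" for k
          proof -
            have "B (p k) \<in> borel_measurable M"
              using partition_of_bounds(1)[OF p that] rst by (intro F_measurable_M[OF adapted]) auto
            then show ?thesis
              by (rule measurable_compose) (intro borel_measurable_continuous_onI continuous_intros)
          qed
          have "\<xi> k \<in> borel_measurable M" if "k < n" for k
            using e that by (intro F_measurable_M[of _ "p k"]) (auto simp: elementary_data_def)
          then show ?thesis unfolding elementary_integral_def[abs_def]
            using B by (intro borel_measurable_sum borel_measurable_times borel_measurable_diff) auto
        qed
        show "J1 m \<in> borel_measurable M" "J2 m \<in> borel_measurable M"
          unfolding J1_def J2_def using J 1(1) 2(1) by auto
      qed
      have "min (ennreal (exp (\<theta> * (It \<omega> - Is \<omega>)))) (of_nat c) \<le>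
          ennreal (k0 \<epsilon>) * ennreal (exp (\<theta> * (J1 m \<omega> - J2 m \<omega>) - \<theta>\<^sup>2 / 2 * V \<omega>)) +
          of_nat c * indicator (b m) \<omega>" if \<omega>: "\<omega> \<in> space M" for \<omega>
      proof (cases "\<omega> \<in> b m")
        case True
        then show ?thesis by (auto intro: add_increasing)
      next
        case False
        then have good: "E1 m \<omega> \<le> ennreal \<epsilon>" "E2 m \<omega> \<le> ennreal \<epsilon>"
          "\<bar>J1 m \<omega> - It \<omega>\<bar> \<le> \<epsilon>" "\<bar>J2 m \<omega> - Is \<omega>\<bar> \<le> \<epsilon>"
          using \<omega> e by (auto simp: b_def bad_def not_less ennreal_le_iff)
        have "ennreal (V \<omega>) \<le> 2 * ennreal \<epsilon> + 2 * ennreal \<epsilon> + ennreal (2 * K\<^sup>2 * (t - s))"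
          by (rule order_trans[OF V(3)[OF \<omega>]]) (intro add_mono mult_left_mono good order_refl, auto)
        also have "\<dots> = ennreal (4 * \<epsilon> + 2 * K\<^sup>2 * (t - s))"
        proof -
          have "ennreal (4 * \<epsilon> + 2 * K\<^sup>2 * (t - s)) = ennreal (2 * \<epsilon> + 2 * \<epsilon> + 2 * K\<^sup>2 * (t - s))" by simp
          also have "\<dots> = ennreal (2 * \<epsilon>) + ennreal (2 * \<epsilon>) + ennreal (2 * K\<^sup>2 * (t - s))"
            using e rst by (simp only: ennreal_plus add_nonneg_nonneg mult_nonneg_nonneg zero_le_power2
              zero_le_numeral less_imp_le diff_ge_0_iff_ge)
          finally show ?thesis using e by (simp add: ennreal_mult')
        qed
        finally have "V \<omega> \<le> 4 * \<epsilon> + 2 * K\<^sup>2 * (t - s)" using e rst by (subst (asm) ennreal_le_iff) auto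
        then have "\<theta>\<^sup>2 / 2 * V \<omega> \<le> \<theta>\<^sup>2 / 2 * (4 * \<epsilon> + 2 * K\<^sup>2 * (t - s))" by (intro mult_left_mono) auto
        also have "\<dots> = \<theta>\<^sup>2 * (2 * \<epsilon> + K\<^sup>2 * (t - s))" by (simp add: algebra_simps)
        finally have v: "\<theta>\<^sup>2 / 2 * V \<omega> \<le> \<theta>\<^sup>2 * (2 * \<epsilon> + K\<^sup>2 * (t - s))" .
        have "\<theta> * ((It \<omega> - Is \<omega>) - (J1 m \<omega> - J2 m \<omega>)) \<le> \<bar>\<theta>\<bar> * \<bar>(It \<omega> - Is \<omega>) - (J1 m \<omega> - J2 m \<omega>)\<bar>"
          by (metis abs_ge_self abs_mult)
        also have "\<dots> \<le> \<bar>\<theta>\<bar> * (2 * \<epsilon>)" using good by (intro mult_left_mono) auto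
        finally have "\<theta> * (It \<omega> - Is \<omega>) \<le> (2 * \<bar>\<theta>\<bar> * \<epsilon> + \<theta>\<^sup>2 * (2 * \<epsilon> + K\<^sup>2 * (t - s))) +
            (\<theta> * (J1 m \<omega> - J2 m \<omega>) - \<theta>\<^sup>2 / 2 * V \<omega>)"
          using v by (simp add: right_diff_distrib)
        then have "exp (\<theta> * (It \<omega> - Is \<omega>)) \<le> k0 \<epsilon> * exp (\<theta> * (J1 m \<omega> - J2 m \<omega>) - \<theta>\<^sup>2 / 2 * V \<omega>)"
          unfolding k0_def exp_add[symmetric] by simp
        then have "ennreal (exp (\<theta> * (It \<omega> - Is \<omega>))) \<le>
            ennreal (k0 \<epsilon> * exp (\<theta> * (J1 m \<omega> - J2 m \<omega>) - \<theta>\<^sup>2 / 2 * V \<omega>))" by (rule ennreal_leI)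
        also have "\<dots> = ennreal (k0 \<epsilon>) * ennreal (exp (\<theta> * (J1 m \<omega> - J2 m \<omega>) - \<theta>\<^sup>2 / 2 * V \<omega>))"
          by (rule ennreal_mult) (auto simp: k0_def)
        finally show ?thesis by (intro min.coboundedI1) (auto intro: add_increasing2)
      qed
      then have "(\<integral>\<^sup>+\<omega>. min (ennreal (exp (\<theta> * (It \<omega> - Is \<omega>)))) (of_nat c) \<partial>M) \<le>
        (\<integral>\<^sup>+\<omega>. ennreal (k0 \<epsilon>) * ennreal (exp (\<theta> * (J1 m \<omega> - J2 m \<omega>) - \<theta>\<^sup>2 / 2 * V \<omega>)) +
          of_nat c * indicator (b m) \<omega> \<partial>M)" by (rule nn_integral_mono)
      also have "\<dots> = ennreal (k0 \<epsilon>) * 1 + of_nat c * emeasure M (b m)"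
        using V(1,2) bm by (simp add: nn_integral_add nn_integral_cmult)
      also have "\<dots> = ennreal (k0 \<epsilon> + real c * measure M (b m))"
        by (simp add: k0_def emeasure_eq_measure ennreal_plus ennreal_mult' ennreal_of_nat_eq_real_of_nat)
      finally show ?thesis .
    qed
    moreover have "(\<lambda>m. ennreal (k0 \<epsilon> + real c * measure M (b m))) \<longlonglongrightarrow> ennreal (k0 \<epsilon> + real c * 0)"
      by (intro tendsto_intros bp)
    ultimately show ?thesis by (intro tendsto_lowerbound[OF _ _ sequentially_bot]) auto
  qed
  \<comment> \<open>The left side does not involve \<epsilon>, so \<epsilon> may tend to 0; monotone
    convergence in \<open>c\<close> then removes the truncation.\<close>
  have trunc0: "(\<integral>\<^sup>+\<omega>. min (ennreal (exp (\<theta> * (It \<omega> - Is \<omega>)))) (of_nat c) \<partial>M) \<le> ennreal (k0 0)" for c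
  proof (rule tendsto_lowerbound[OF _ _ sequentially_bot])
    show "(\<lambda>m. ennreal (k0 (inverse (real (Suc m))))) \<longlonglongrightarrow> ennreal (k0 0)"
      unfolding k0_def by (intro tendsto_intros LIMSEQ_inverse_real_of_nat)
  qed (intro always_eventually allI trunc, simp)
  have "(\<integral>\<^sup>+\<omega>. ennreal (exp (\<theta> * (It \<omega> - Is \<omega>))) \<partial>M) =
      (\<integral>\<^sup>+\<omega>. (SUP c. min (ennreal (exp (\<theta> * (It \<omega> - Is \<omega>)))) (of_nat c)) \<partial>M)"
  proof (intro nn_integral_cong antisym SUP_least)
    fix \<omega>
    obtain c where "exp (\<theta> * (It \<omega> - Is \<omega>)) \<le> real c" using real_arch_simple by blast
    then have "ennreal (exp (\<theta> * (It \<omega> - Is \<omega>))) \<le> of_nat c"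
      by (simp add: ennreal_of_nat_eq_real_of_nat ennreal_leI)
    then show "ennreal (exp (\<theta> * (It \<omega> - Is \<omega>))) \<le>
        (SUP c. min (ennreal (exp (\<theta> * (It \<omega> - Is \<omega>)))) (of_nat c))"
      by (intro SUP_upper2[of c]) auto
  qed auto
  also have "\<dots> = (SUP c. \<integral>\<^sup>+\<omega>. min (ennreal (exp (\<theta> * (It \<omega> - Is \<omega>)))) (of_nat c) \<partial>M)"
    by (intro nn_integral_monotone_convergence_SUP)
      (auto simp: incseq_def le_fun_def intro!: min.coboundedI2 of_nat_mono)
  also have "\<dots> \<le> ennreal (k0 0)" by (intro SUP_least trunc0)
  finally show ?thesis by (simp add: k0_def)
qed

end

subsection \<open>Dyadic increments of processes with sub-Gaussian increments\<close>

text \<open>The maximum over natural \<open>\<theta>\<close> of \<open>\<theta> y - L \<theta>\<^sup>2\<close> is of the order \<open>y\<^sup>2 / (4 L)\<close>; this replaces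
  the usual integration of the exponential moments against a Gaussian density in \<open>\<theta>\<close>.\<close>

lemma square_le_max_linear:
  fixes y L :: real
  assumes "y \<ge> 0" "L > 0"
  obtains \<theta> :: nat where "y\<^sup>2 / (8 * L) \<le> L + (real \<theta> * y - L * (real \<theta>)\<^sup>2)"
proof
  \<comment> \<open>The real maximiser is \<open>y / (2 * L)\<close>. Rounding it down costs the
    additive \<open>L\<close> and turns the 4 in the denominator into 8.\<close>
  define \<theta> where "\<theta> = nat \<lfloor>y / (2 * L)\<rfloor>"
  define f where "f = y / (2 * L) - real \<theta>"
  have "y / (2 * L) \<ge> 0" using assms by simp
  then have f: "0 \<le> f" "f \<le> 1" unfolding f_def \<theta>_def by linarith+
  have y: "y = 2 * L * (real \<theta> + f)" using assms by (simp add: f_def)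
  have "y\<^sup>2 / (8 * L) = L / 2 * (real \<theta> + f)\<^sup>2"
    unfolding y using assms by (simp add: power2_eq_square field_simps)
  also have "(real \<theta> + f)\<^sup>2 \<le> (real \<theta> + 1)\<^sup>2" using f by (intro power_mono) auto
  also have "(real \<theta> + 1)\<^sup>2 \<le> 2 * (real \<theta>)\<^sup>2 + 2"
    using zero_le_power2[of "real \<theta> - 1"] by (simp add: power2_eq_square algebra_simps)
  finally have "y\<^sup>2 / (8 * L) \<le> L * (real \<theta>)\<^sup>2 + L" using assms by (simp add: algebra_simps)
  moreover have "real \<theta> * y - L * (real \<theta>)\<^sup>2 = L * (real \<theta>)\<^sup>2 + 2 * L * real \<theta> * f"
    unfolding y by (simp add: power2_eq_square algebra_simps)
  moreover have "0 \<le> 2 * L * real \<theta> * f" using assms f by simp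
  ultimately show "y\<^sup>2 / (8 * L) \<le> L + (real \<theta> * y - L * (real \<theta>)\<^sup>2)" by linarith
qed

text \<open>The square in the exponent is bounded by the best linear term, hence by a sum over all
  natural \<theta>, which is integrated term by term. Taking \<open>L = K + 1\<close> leaves a spare
  factor \<open>exp (- \<theta>\<^sup>2)\<close>, at most \<open>exp (- \<theta>)\<close>, so a
  geometric series results.\<close>

lemma sub_gaussian_square_moment:
  assumes Y[measurable]: "Y \<in> borel_measurable M" and pos: "\<And>\<omega>. Y \<omega> \<ge> 0" and K: "K \<ge> 0" and A: "A \<ge> 0"
    and mgf: "\<And>\<theta>::nat. (\<integral>\<^sup>+\<omega>. ennreal (exp (real \<theta> * Y \<omega>)) \<partial>M) \<le> ennreal (A * exp (K * (real \<theta>)\<^sup>2))"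
  shows "(\<integral>\<^sup>+\<omega>. ennreal (exp ((Y \<omega>)\<^sup>2 / (8 * (K + 1)))) \<partial>M) \<le>
      ennreal (exp (K + 1) * (A * (1 / (1 - exp (-1)))))"
proof -
  define L where "L = K + 1"
  have L: "L > 0" using K by (simp add: L_def)
  have "ennreal (exp ((Y \<omega>)\<^sup>2 / (8 * L))) \<le>
      ennreal (exp L) * (\<Sum>\<theta>. ennreal (exp (- L * (real \<theta>)\<^sup>2)) * ennreal (exp (real \<theta> * Y \<omega>)))" for \<omega>
  proof -
    obtain \<theta> :: nat where t: "(Y \<omega>)\<^sup>2 / (8 * L) \<le> L + (real \<theta> * Y \<omega> - L * (real \<theta>)\<^sup>2)"
      using square_le_max_linear[OF pos L] by blast
    then have "exp ((Y \<omega>)\<^sup>2 / (8 * L)) \<le> exp L * (exp (- L * (real \<theta>)\<^sup>2) * exp (real \<theta> * Y \<omega>))"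
      unfolding exp_add[symmetric] by simp
    then have "ennreal (exp ((Y \<omega>)\<^sup>2 / (8 * L))) \<le>
        ennreal (exp L) * (ennreal (exp (- L * (real \<theta>)\<^sup>2)) * ennreal (exp (real \<theta> * Y \<omega>)))"
      by (simp add: ennreal_mult'[symmetric] ennreal_leI del: exp_add)
    also have "\<dots> \<le> ennreal (exp L) * (\<Sum>\<theta>. ennreal (exp (- L * (real \<theta>)\<^sup>2)) * ennreal (exp (real \<theta> * Y \<omega>)))"
      using sum_le_suminf[of "\<lambda>\<theta>. ennreal (exp (- L * (real \<theta>)\<^sup>2)) * ennreal (exp (real \<theta> * Y \<omega>))" "{\<theta>}"]
      by (intro mult_left_mono) auto
    finally show ?thesis .
  qed
  then have "(\<integral>\<^sup>+\<omega>. ennreal (exp ((Y \<omega>)\<^sup>2 / (8 * L))) \<partial>M) \<le>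
      (\<integral>\<^sup>+\<omega>. ennreal (exp L) * (\<Sum>\<theta>. ennreal (exp (- L * (real \<theta>)\<^sup>2)) * ennreal (exp (real \<theta> * Y \<omega>))) \<partial>M)"
    by (intro nn_integral_mono)
  also have "\<dots> = ennreal (exp L) *
      (\<Sum>\<theta>. ennreal (exp (- L * (real \<theta>)\<^sup>2)) * (\<integral>\<^sup>+\<omega>. ennreal (exp (real \<theta> * Y \<omega>)) \<partial>M))"
    by (simp add: nn_integral_cmult nn_integral_suminf)
  also have "\<dots> \<le> ennreal (exp L) * (\<Sum>\<theta>. ennreal (A * exp (-1) ^ \<theta>))"
  proof (intro mult_left_mono suminf_le allI)
    fix \<theta> :: nat
    have "ennreal (exp (- L * (real \<theta>)\<^sup>2)) * (\<integral>\<^sup>+\<omega>. ennreal (exp (real \<theta> * Y \<omega>)) \<partial>M) \<le>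
        ennreal (exp (- L * (real \<theta>)\<^sup>2)) * ennreal (A * exp (K * (real \<theta>)\<^sup>2))"
      by (intro mult_left_mono mgf) auto
    also have "\<dots> = ennreal (exp (- L * (real \<theta>)\<^sup>2) * (A * exp (K * (real \<theta>)\<^sup>2)))"
      using A by (simp add: ennreal_mult')
    also have "exp (- L * (real \<theta>)\<^sup>2) * (A * exp (K * (real \<theta>)\<^sup>2)) = A * exp (- ((real \<theta>)\<^sup>2))"
      by (simp add: L_def exp_add[symmetric] algebra_simps flip: exp_minus)
    also have "\<dots> \<le> A * exp (- real \<theta>)"
    proof -
      have "real \<theta> * 1 \<le> real \<theta> * real \<theta>" by (cases "\<theta> = 0") (auto intro!: mult_left_mono)
      then show ?thesis using A by (intro mult_left_mono) (auto simp: power2_eq_square)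
    qed
    also have "exp (- real \<theta>) = exp (-1) ^ \<theta>" by (simp add: exp_of_nat_mult[symmetric])
    finally show "ennreal (exp (- L * (real \<theta>)\<^sup>2)) * (\<integral>\<^sup>+\<omega>. ennreal (exp (real \<theta> * Y \<omega>)) \<partial>M) \<le>
        ennreal (A * exp (-1) ^ \<theta>)" by (simp add: ennreal_leI)
  qed auto
  also have "(\<Sum>\<theta>. ennreal (A * exp (-1) ^ \<theta>)) = ennreal (A * (1 / (1 - exp (-1))))"
    using A geometric_sums[of "exp (-1::real)"]
    by (intro suminf_ennreal_eq sums_mult) auto
  also have "ennreal (exp L) * \<dots> = ennreal (exp L * (A * (1 / (1 - exp (-1)))))"
    by (rule ennreal_mult'[symmetric]) simp
  finally show ?thesis by (simp add: L_def)
qed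

text \<open>\<open>G\<close> is the sum of all \<open>exp (Y n k)\<close> with weights
  \<open>4 ^ -n\<close>: the \<open>2 ^ n\<close> terms of level \<open>n\<close> contribute at most
  \<open>C / 2 ^ n\<close> to its integral, and every single term is at most \<open>G\<close>.
  Taking logarithms gives a bound uniform in \<open>k\<close> at the price \<open>n * ln 4\<close>.
  The term of level 0 ensures \<open>1 \<le> G\<close>.\<close>

lemma dyadic_maximal_function:
  fixes Y :: "nat \<Rightarrow> nat \<Rightarrow> 'w \<Rightarrow> real"
  assumes Y: "\<And>n k. k < 2 ^ n \<Longrightarrow> Y n k \<in> borel_measurable M"
    and bound: "\<And>n k. k < 2 ^ n \<Longrightarrow> (\<integral>\<^sup>+\<omega>. ennreal (exp (Y n k \<omega>)) \<partial>M) \<le> ennreal C"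
    and pos: "\<And>n k \<omega>. 0 \<le> Y n k \<omega>" and C: "C \<ge> 0"
  obtains G :: "'w \<Rightarrow> ennreal" where "G \<in> borel_measurable M" "(\<integral>\<^sup>+\<omega>. G \<omega> \<partial>M) < \<infinity>" "\<And>\<omega>. 1 \<le> G \<omega>"
    "\<And>n k \<omega>. k < 2 ^ n \<Longrightarrow> G \<omega> < \<infinity> \<Longrightarrow> Y n k \<omega> \<le> real n * ln 4 + ln (enn2real (G \<omega>))"
proof -
  define G where "G \<omega> = (\<Sum>n. \<Sum>k<2 ^ n. ennreal ((1/4) ^ n) * ennreal (exp (Y n k \<omega>)))" for \<omega>
  have mono: "ennreal ((1/4) ^ n) * ennreal (exp (Y n k \<omega>)) \<le> G \<omega>" if "k < 2 ^ n" for n k \<omega>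
  proof -
    have "ennreal ((1/4) ^ n) * ennreal (exp (Y n k \<omega>)) \<le>
        (\<Sum>k<2 ^ n. ennreal ((1/4) ^ n) * ennreal (exp (Y n k \<omega>)))"
      using that by (intro member_le_sum) auto
    also have "\<dots> \<le> G \<omega>"
      unfolding G_def using sum_le_suminf[of "\<lambda>n. \<Sum>k<2 ^ n. ennreal ((1/4) ^ n) * ennreal (exp (Y n k \<omega>))" "{n}"]
      by auto
    finally show ?thesis .
  qed
  have G1: "1 \<le> G \<omega>" for \<omega>
  proof -
    have "ennreal 1 \<le> ennreal (exp (Y 0 0 \<omega>))" using pos by (intro ennreal_leI) auto
    also have "\<dots> \<le> G \<omega>" using mono[of 0 0 \<omega>] by simp
    finally show ?thesis by (simp del: ennreal_le_iff)
  qed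
  show thesis
  proof (rule that[of G])
    show "G \<in> borel_measurable M"
      unfolding G_def using Y by measurable
    have "(\<integral>\<^sup>+\<omega>. (\<Sum>k<2 ^ n. ennreal ((1/4) ^ n) * ennreal (exp (Y n k \<omega>))) \<partial>M) =
        (\<Sum>k<2 ^ n. ennreal ((1/4) ^ n) * (\<integral>\<^sup>+\<omega>. ennreal (exp (Y n k \<omega>)) \<partial>M))" for n
      using Y by (subst nn_integral_sum) (auto simp: nn_integral_cmult)
    then have "(\<integral>\<^sup>+\<omega>. G \<omega> \<partial>M) =
        (\<Sum>n. \<Sum>k<2 ^ n. ennreal ((1/4) ^ n) * (\<integral>\<^sup>+\<omega>. ennreal (exp (Y n k \<omega>)) \<partial>M))"
      unfolding G_def using Y by (subst nn_integral_suminf) auto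
    also have "\<dots> \<le> (\<Sum>n. ennreal (C * (1/2) ^ n))"
    proof (intro suminf_le allI)
      fix n
      have "(\<Sum>k<2 ^ n. ennreal ((1/4) ^ n) * (\<integral>\<^sup>+\<omega>. ennreal (exp (Y n k \<omega>)) \<partial>M)) \<le>
          (\<Sum>k<(2::nat) ^ n. ennreal ((1/4) ^ n * C))"
        using C by (intro sum_mono) (auto simp: ennreal_mult' intro!: mult_left_mono bound)
      also have "\<dots> = ennreal (2 ^ n * ((1/4) ^ n * C))"
        using C by (simp add: ennreal_mult' ennreal_of_nat_eq_real_of_nat[symmetric] ennreal_power[symmetric])
      also have "2 ^ n * ((1/4) ^ n * C) = C * (1/2) ^ n"
        by (simp add: power_mult_distrib[symmetric] mult.assoc[symmetric])
      finally show "(\<Sum>k<2 ^ n. ennreal ((1/4) ^ n) * (\<integral>\<^sup>+\<omega>. ennreal (exp (Y n k \<omega>)) \<partial>M)) \<le>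
          ennreal (C * (1/2) ^ n)" .
    qed auto
    also have "\<dots> = ennreal (C * (1 / (1 - 1/2)))"
      using C by (intro suminf_ennreal_eq sums_mult geometric_sums) auto
    also have "\<dots> < \<infinity>" by simp
    finally show "(\<integral>\<^sup>+\<omega>. G \<omega> \<partial>M) < \<infinity>" .
    show "1 \<le> G \<omega>" for \<omega> by (rule G1)
    fix n k :: nat and \<omega> assume k: "k < 2 ^ n" and fin: "G \<omega> < \<infinity>"
    define g where "g = enn2real (G \<omega>)"
    have g1: "G \<omega> = ennreal g" "g \<ge> 0" using fin by (simp_all add: g_def)
    then have "ennreal 1 \<le> ennreal g" using G1[of \<omega>] by simp
    then have g: "G \<omega> = ennreal g" "g \<ge> 1" using g1 by (simp_all add: ennreal_le_iff del: ennreal_1)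
    have "ennreal ((1/4) ^ n * exp (Y n k \<omega>)) \<le> ennreal g"
      using mono[OF k, of \<omega>] g by (simp add: ennreal_mult')
    then have "(1/4) ^ n * exp (Y n k \<omega>) \<le> g" using g by (subst (asm) ennreal_le_iff) auto
    then have "exp (Y n k \<omega>) \<le> 4 ^ n * g" by (simp add: power_divide field_simps)
    then have "ln (exp (Y n k \<omega>)) \<le> ln (4 ^ n * g)" using g by (subst ln_le_cancel_iff) auto
    also have "\<dots> = real n * ln 4 + ln g" using g by (simp add: ln_mult ln_realpow)
    finally show "Y n k \<omega> \<le> real n * ln 4 + ln (enn2real (G \<omega>))" by (simp add: g_def)
  qed
qed

text \<open>An increment of level \<open>n\<close>, divided by the root of its length
  \<open>h n\<close>, has square-exponential moments independent of \<open>n\<close> and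
  \<open>k\<close>. The maximal function bounds its square by a multiple of
  \<open>n + ln G + 1\<close>. The growth in \<open>n\<close> is affordable because
  \<open>h n\<close> decays faster than \<open>(2 powr - \<gamma>) ^ n\<close> squared for \<gamma>
  < 1/2.\<close>

lemma dyadic_increments:
  fixes N :: "real \<Rightarrow> 'w \<Rightarrow> 'a::{real_normed_vector, second_countable_topology}"
  assumes N: "\<And>t. t \<in> {r..T} \<Longrightarrow> N t \<in> borel_measurable M" and rT: "r < T"
    and K: "K \<ge> 0" and A: "A \<ge> 0" and gam: "0 < \<gamma>" "\<gamma> < 1/2"
    and mgf: "\<And>s t \<theta>. r \<le> s \<Longrightarrow> s < t \<Longrightarrow> t \<le> T \<Longrightarrow> \<theta> \<ge> 0 \<Longrightarrow>
        (\<integral>\<^sup>+\<omega>. ennreal (exp (\<theta> * norm (N t \<omega> - N s \<omega>))) \<partial>M) \<le> ennreal (A * exp (K * (t - s) * \<theta>\<^sup>2))"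
  obtains C G where "C > 0" "G \<in> borel_measurable M" "(\<integral>\<^sup>+\<omega>. G \<omega> \<partial>M) < \<infinity>" "\<And>\<omega>. 1 \<le> G \<omega>"
    "\<And>n k \<omega>. k < (2::nat) ^ n \<Longrightarrow> G \<omega> < \<infinity> \<Longrightarrow>
        norm (N (r + (T - r) * (real (Suc k) / 2 ^ n)) \<omega> - N (r + (T - r) * (real k / 2 ^ n)) \<omega>)
        \<le> C * (1 + sqrt (ln (enn2real (G \<omega>)))) * (2 powr - \<gamma>) ^ n"
proof -
  define h where "h n = (T - r) / 2 ^ n" for n :: nat
  define d where "d n k = r + (T - r) * (real k / 2 ^ n)" for n k :: nat
  define \<Delta> where "\<Delta> n k \<omega> = norm (N (d n (Suc k)) \<omega> - N (d n k) \<omega>)" for n k \<omega>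
  define L where "L = 8 * (K + 1)"
  have L: "L > 0" using K by (simp add: L_def)
  have h: "h n > 0" for n using rT by (simp add: h_def)
  have dd: "d n (Suc k) - d n k = h n" for n k
    by (simp add: d_def h_def add_divide_distrib distrib_left)
  have d: "d n k \<in> {r..T}" if "k \<le> 2 ^ n" for n k
  proof -
    have "real k \<le> 2 ^ n" using that by (metis of_nat_le_iff of_nat_numeral of_nat_power)
    then have "(T - r) * (real k / 2 ^ n) \<le> (T - r) * 1" using rT by (intro mult_left_mono) auto
    then show ?thesis using rT by (auto simp: d_def)
  qed
  define Y where "Y n k \<omega> = (\<Delta> n k \<omega> / sqrt (h n))\<^sup>2 / L" for n k \<omega>
  define C0 where "C0 = exp (K + 1) * (A * (1 / (1 - exp (-1))))"
  have \<Delta>m: "\<Delta> n k \<in> borel_measurable M" if "k < 2 ^ n" for n k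
    unfolding \<Delta>_def using that by (intro measurable_compose[OF _ borel_measurable_norm] borel_measurable_diff N d) auto
  have Ym: "Y n k \<in> borel_measurable M" if "k < 2 ^ n" for n k
    unfolding Y_def using \<Delta>m[OF that] by measurable
  have Yb: "(\<integral>\<^sup>+\<omega>. ennreal (exp (Y n k \<omega>)) \<partial>M) \<le> ennreal C0" if k: "k < 2 ^ n" for n k
    unfolding Y_def L_def C0_def
  proof (rule sub_gaussian_square_moment[OF _ _ K A])
    fix \<theta> :: nat
    have "(\<integral>\<^sup>+\<omega>. ennreal (exp (real \<theta> / sqrt (h n) * \<Delta> n k \<omega>)) \<partial>M) \<le>
        ennreal (A * exp (K * (d n (Suc k) - d n k) * (real \<theta> / sqrt (h n))\<^sup>2))"
      unfolding \<Delta>_def using d[of k n] d[of "Suc k" n] k h[of n] dd[of n k] by (intro mgf) auto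
    also have "K * (d n (Suc k) - d n k) * (real \<theta> / sqrt (h n))\<^sup>2 = K * (real \<theta>)\<^sup>2"
      using h[of n] by (simp add: dd power_divide)
    finally show "(\<integral>\<^sup>+\<omega>. ennreal (exp (real \<theta> * (\<Delta> n k \<omega> / sqrt (h n)))) \<partial>M) \<le>
        ennreal (A * exp (K * (real \<theta>)\<^sup>2))" by simp
    show "(\<lambda>\<omega>. \<Delta> n k \<omega> / sqrt (h n)) \<in> borel_measurable M" using \<Delta>m[OF k] by measurable
  qed (use h[of n] in \<open>auto simp: \<Delta>_def less_imp_le\<close>)
  have "C0 \<ge> 0" using A by (simp add: C0_def)
  then obtain G where G: "G \<in> borel_measurable M" "(\<integral>\<^sup>+\<omega>. G \<omega> \<partial>M) < \<infinity>" "\<And>\<omega>. 1 \<le> G \<omega>"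
    "\<And>n k \<omega>. k < 2 ^ n \<Longrightarrow> G \<omega> < \<infinity> \<Longrightarrow> Y n k \<omega> \<le> real n * ln 4 + ln (enn2real (G \<omega>))"
    using dyadic_maximal_function[of Y M C0, OF Ym Yb] L by (auto simp: Y_def)
  \<comment> \<open>From \<open>x \<le> exp x\<close> at
    \<open>x = n * (1 - 2 * \<gamma>) * ln 2\<close>: this is the constant with
    \<open>n / 2 ^ n \<le> c0 * 2 powr (- 2 * \<gamma> * n)\<close>. \<open>C\<close> is the root of
    the product of all constants collected below.\<close>
  define c0 where "c0 = 1 / ((1 - 2 * \<gamma>) * ln 2)"
  define C where "C = sqrt ((T - r) * L * (c0 * ln 4 + 1))"
  have c0: "c0 > 0" using gam by (simp add: c0_def)
  then have C: "C > 0" using L rT by (simp add: C_def add_pos_pos)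
  show thesis
  proof (rule that[OF C G(1-3)])
    fix n k :: nat and \<omega> assume k: "k < 2 ^ n" and fin: "G \<omega> < \<infinity>"
    define l where "l = ln (enn2real (G \<omega>))"
    have "enn2real (G \<omega>) \<ge> 1"
      using enn2real_mono[OF G(3)[of \<omega>]] fin by (simp add: infinity_ennreal_def)
    then have l: "l \<ge> 0" by (simp add: l_def)
    define q where "q = (2::real) powr - \<gamma>"
    have q: "(q ^ n)\<^sup>2 = 2 powr (- (2 * \<gamma>) * real n)" unfolding q_def
      by (subst (1 2) powr_realpow[symmetric]) (simp_all add: powr_powr mult_ac)
    have p: "1 / 2 ^ n = (2::real) powr (- real n)" by (simp add: powr_minus_divide powr_realpow)
    have 1: "1 / 2 ^ n \<le> (q ^ n)\<^sup>2"
      unfolding q p using gam mult_right_mono[of "2 * \<gamma>" 1 "real n"] by (intro powr_mono) auto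
    have 2: "real n * (1 / 2 ^ n) \<le> c0 * (q ^ n)\<^sup>2"
    proof -
      define e where "e = (1 - 2 * \<gamma>) * ln 2"
      have e: "e > 0" using gam by (simp add: e_def)
      have "c0 = 1 / e" by (simp add: c0_def e_def)
      have "real n * e \<le> exp (real n * e)" using exp_ge_add_one_self[of "real n * e"] by linarith
      also have "\<dots> = 2 powr (real n * (1 - 2 * \<gamma>))" by (simp add: powr_def e_def mult_ac)
      finally have "real n \<le> c0 * 2 powr (real n * (1 - 2 * \<gamma>))"
        using e by (simp add: \<open>c0 = 1 / e\<close> field_simps)
      then have "real n * 2 powr (- real n) \<le> c0 * 2 powr (real n * (1 - 2 * \<gamma>)) * 2 powr (- real n)"
        by (intro mult_right_mono) auto
      also have "\<dots> = c0 * 2 powr (- (2 * \<gamma>) * real n)"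
        by (simp add: powr_add[symmetric] mult.assoc algebra_simps)
      finally show ?thesis unfolding q p .
    qed
    have "(\<Delta> n k \<omega>)\<^sup>2 = h n * L * Y n k \<omega>" using h[of n] L by (simp add: Y_def power_divide)
    also have "\<dots> \<le> h n * L * (real n * ln 4 + l)"
      using G(4)[OF k fin] h[of n] L by (intro mult_left_mono) (auto simp: l_def)
    also have "\<dots> = (T - r) * L * (real n * (1 / 2 ^ n) * ln 4 + 1 / 2 ^ n * l)"
      by (simp add: h_def distrib_left add_divide_distrib)
    also have "\<dots> \<le> (T - r) * L * (c0 * (q ^ n)\<^sup>2 * ln 4 + (q ^ n)\<^sup>2 * l)"
      using rT L l 1 2 by (intro mult_left_mono add_mono mult_right_mono) auto
    also have "\<dots> \<le> (T - r) * L * (c0 * ln 4 + 1) * ((1 + sqrt l)\<^sup>2 * (q ^ n)\<^sup>2)"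
    proof -
      have "(1 + sqrt l)\<^sup>2 = 1 + l + 2 * sqrt l" using l by (simp add: power2_eq_square algebra_simps)
      then have b: "1 + l \<le> (1 + sqrt l)\<^sup>2" using l by simp
      have "c0 * ln 4 + l \<le> (c0 * ln 4 + 1) * (1 + l)" using c0 l by (simp add: algebra_simps)
      also have "\<dots> \<le> (c0 * ln 4 + 1) * (1 + sqrt l)\<^sup>2" using b c0 by (intro mult_left_mono) auto
      finally have "(T - r) * L * (q ^ n)\<^sup>2 * (c0 * ln 4 + l) \<le>
          (T - r) * L * (q ^ n)\<^sup>2 * ((c0 * ln 4 + 1) * (1 + sqrt l)\<^sup>2)"
        using rT L by (intro mult_left_mono) auto
      then show ?thesis by (simp add: algebra_simps)
    qed
    also have "\<dots> = (C * (1 + sqrt l) * q ^ n)\<^sup>2"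
      using rT L c0 by (simp add: C_def power_mult_distrib)
    finally have "\<Delta> n k \<omega> \<le> C * (1 + sqrt l) * q ^ n"
      using C l by (intro power2_le_imp_le[of "\<Delta> n k \<omega>"]) (auto simp: q_def)
    then show "norm (N (r + (T - r) * (real (Suc k) / 2 ^ n)) \<omega> - N (r + (T - r) * (real k / 2 ^ n)) \<omega>)
        \<le> C * (1 + sqrt (ln (enn2real (G \<omega>)))) * (2 powr - \<gamma>) ^ n"
      unfolding \<Delta>_def d_def l_def q_def .
  qed
qed

text \<open>A sum is at most the number of terms times its largest term, whose exponential is one of
  the summands on the right. Joint exponential moments thus reduce to separate ones with an enlarged
  parameter.\<close>

lemma exp_sum_le_sum_exp:
  fixes a :: "'b \<Rightarrow> real"
  assumes "finite P" "P \<noteq> {}" "c \<ge> 0"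
  shows "exp (c * (\<Sum>p\<in>P. a p)) \<le> (\<Sum>p\<in>P. exp (c * real (card P) * a p))"
proof -
  obtain p0 where p0: "p0 \<in> P" "\<And>p. p \<in> P \<Longrightarrow> a p \<le> a p0"
  proof -
    have "Max (a ` P) \<in> a ` P" using assms by (intro Max_in) auto
    then obtain p0 where "p0 \<in> P" "Max (a ` P) = a p0" by auto
    then show ?thesis using that[of p0] assms Max_ge[of "a ` P"] by auto
  qed
  have "(\<Sum>p\<in>P. a p) \<le> real (card P) * a p0" using p0 sum_bounded_above[of P a "a p0"] by auto
  then have "c * (\<Sum>p\<in>P. a p) \<le> c * (real (card P) * a p0)" using assms by (intro mult_left_mono) auto
  then have "exp (c * (\<Sum>p\<in>P. a p)) \<le> exp (c * real (card P) * a p0)" by (simp add: mult.assoc)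
  also have "\<dots> \<le> (\<Sum>p\<in>P. exp (c * real (card P) * a p))"
    using assms p0 by (intro member_le_sum[where f = "\<lambda>p. exp (c * real (card P) * a p)"]) auto
  finally show ?thesis .
qed

lemma exp_abs_le:
  fixes z :: real
  assumes "c \<ge> 0"
  shows "exp (c * \<bar>z\<bar>) \<le> exp (c * z) + exp (- c * z)"
  by (cases "z \<ge> 0") (simp_all add: add_increasing add_increasing2 less_imp_le)

text \<open>The squared norm of a row of \<open>S\<close> is a diagonal entry of \<open>A\<close>,
  which is the quadratic form at a unit vector. Upper ellipticity thereby bounds the integrands of
  the stochastic integrals.\<close>

lemma is_sqrt_matrix_entry_bound:
  fixes S A :: "real ^ 'n ^ 'n"
  assumes "is_sqrt_matrix S A" "\<Lambda> \<ge> 0"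
    and ell: "\<And>\<xi>. (\<Sum>i\<in>UNIV. \<Sum>j\<in>UNIV. A $ i $ j * \<xi> $ i * \<xi> $ j) \<le> \<Lambda> * (norm \<xi>)\<^sup>2"
  shows "\<bar>S $ i $ j\<bar> \<le> sqrt \<Lambda>"
proof -
  have "A $ i $ i = (\<Sum>k\<in>UNIV. (S $ i $ k)\<^sup>2)"
    using assms(1) by (auto simp: is_sqrt_matrix_def matrix_matrix_mult_def transpose_def power2_eq_square)
  then have "(S $ i $ j)\<^sup>2 \<le> A $ i $ i"
    using member_le_sum[of j UNIV "\<lambda>k. (S $ i $ k)\<^sup>2"] by simp
  also have "A $ i $ i = (\<Sum>k\<in>UNIV. \<Sum>l\<in>UNIV. A $ k $ l * axis i 1 $ k * axis i 1 $ l)"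
  proof -
    have "(\<Sum>k\<in>UNIV. \<Sum>l\<in>UNIV. A $ k $ l * axis i 1 $ k * axis i 1 $ l) =
        (\<Sum>k\<in>UNIV. \<Sum>l\<in>UNIV. if l = i then if k = i then A $ i $ i else 0 else 0)"
      by (intro sum.cong refl) (auto simp: axis_def)
    then show ?thesis by simp
  qed
  also have "\<dots> \<le> \<Lambda>" using ell[of "axis i 1"] by simp
  finally show ?thesis by (metis real_sqrt_le_mono real_sqrt_abs)
qed

subsection \<open>The martingale part of the solution\<close>

context brownian_motion
begin

text \<open>\<open>N t\<close> collects the Ito integrals chosen separately for each
  \<open>t\<close>; its values at different times are related through exponential moments of
  increments only. Passing from the norm to the \<open>CARD('n)\<close> squared scalar integrals
  multiplies \<theta> by their number, and removing absolute values doubles the number of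
  terms.\<close>

lemma sde_noise:
  fixes X :: "real \<Rightarrow> 'w \<Rightarrow> real ^ 'n"
  assumes rT: "0 \<le> r" and sol: "sde_solution M F B \<sigma> b T r x X"
    and K: "\<And>s y i j. s \<in> {r..T} \<Longrightarrow> \<bar>\<sigma> s y $ i $ j\<bar> \<le> K"
  obtains N :: "real \<Rightarrow> 'w \<Rightarrow> real ^ 'n" where
    "\<And>t. t \<in> {r..T} \<Longrightarrow> N t \<in> borel_measurable M"
    "\<And>t. t \<in> {r..T} \<Longrightarrow> AE \<omega> in M. \<forall>i.
           set_integrable lborel {r..t} (\<lambda>s. b s (X s \<omega>) $ i) \<and>
           X t \<omega> $ i = x $ i + N t \<omega> $ i + (LINT s:{r..t}|lborel. b s (X s \<omega>) $ i)"
    "\<And>s t \<theta>. r \<le> s \<Longrightarrow> s < t \<Longrightarrow> t \<le> T \<Longrightarrow> \<theta> \<ge> 0 \<Longrightarrow>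
        (\<integral>\<^sup>+\<omega>. ennreal (exp (\<theta> * norm (N t \<omega> - N s \<omega>))) \<partial>M) \<le>
        ennreal (2 * (real CARD('n))\<^sup>2 * exp ((K * (real CARD('n))\<^sup>2)\<^sup>2 * (t - s) * \<theta>\<^sup>2))"
proof -
  have "\<forall>t\<in>{r..T}. \<exists>I.
        (\<forall>i j. is_ito_integral M F (\<lambda>s \<omega>. B s \<omega> $ j) r t (\<lambda>s \<omega>. \<sigma> s (X s \<omega>) $ i $ j) (I i j)) \<and>
        (AE \<omega> in M. \<forall>i.
           set_integrable lborel {r..t} (\<lambda>s. b s (X s \<omega>) $ i) \<and>
           X t \<omega> $ i = x $ i + (\<Sum>j\<in>UNIV. I i j \<omega>) + (LINT s:{r..t}|lborel. b s (X s \<omega>) $ i))"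
    using sol by (simp add: sde_solution_def)
  from bchoice[OF this] obtain I where I:
    "\<And>t i j. t \<in> {r..T} \<Longrightarrow>
        is_ito_integral M F (\<lambda>s \<omega>. B s \<omega> $ j) r t (\<lambda>s \<omega>. \<sigma> s (X s \<omega>) $ i $ j) (I t i j)"
    "\<And>t. t \<in> {r..T} \<Longrightarrow> AE \<omega> in M. \<forall>i.
           set_integrable lborel {r..t} (\<lambda>s. b s (X s \<omega>) $ i) \<and>
           X t \<omega> $ i = x $ i + (\<Sum>j\<in>UNIV. I t i j \<omega>) + (LINT s:{r..t}|lborel. b s (X s \<omega>) $ i)"
    by blast
  define N where "N t \<omega> = (\<chi> i. \<Sum>j\<in>UNIV. I t i j \<omega>)" for t \<omega>
  have Im: "I t i j \<in> borel_measurable M" if "t \<in> {r..T}" for t i j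
    using I(1)[OF that] by (auto simp: is_ito_integral_def)
  show thesis
  proof (rule that[of N])
    show "N t \<in> borel_measurable M" if t: "t \<in> {r..T}" for t
    proof -
      have "N t = (\<lambda>\<omega>. \<Sum>i\<in>UNIV. (\<Sum>j\<in>UNIV. I t i j \<omega>) *\<^sub>R axis i 1)"
      proof
        fix \<omega>
        have "(\<Sum>i\<in>UNIV. (N t \<omega> $ i) *\<^sub>R axis i 1) = N t \<omega>"
          using basis_expansion[of "N t \<omega>"] by (simp add: scalar_mult_eq_scaleR)
        then show "N t \<omega> = (\<Sum>i\<in>UNIV. (\<Sum>j\<in>UNIV. I t i j \<omega>) *\<^sub>R axis i 1)" by (simp add: N_def)
      qed
      then show ?thesis using Im[OF t] by simp
    qed
    show "AE \<omega> in M. \<forall>i.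
           set_integrable lborel {r..t} (\<lambda>s. b s (X s \<omega>) $ i) \<and>
           X t \<omega> $ i = x $ i + N t \<omega> $ i + (LINT s:{r..t}|lborel. b s (X s \<omega>) $ i)" if "t \<in> {r..T}" for t
      using I(2)[OF that] by (simp add: N_def)
    fix s t \<theta> :: real assume st: "r \<le> s" "s < t" "t \<le> T" and \<theta>: "\<theta> \<ge> 0"
    define P where "P = (UNIV :: ('n \<times> 'n) set)"
    define m where "m = real (card P)"
    define z where "z p \<omega> = I t (fst p) (snd p) \<omega> - I s (fst p) (snd p) \<omega>" for p :: "'n \<times> 'n" and \<omega>
    have m: "m = (real CARD('n))\<^sup>2" by (simp add: m_def P_def card_cartesian_product power2_eq_square
          flip: UNIV_Times_UNIV)
    have zm[measurable]: "z p \<in> borel_measurable M" for p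
      unfolding z_def using st by (intro borel_measurable_diff Im) auto
    have zexp: "(\<integral>\<^sup>+\<omega>. ennreal (exp (\<eta> * z p \<omega>)) \<partial>M) \<le> ennreal (exp (\<eta>\<^sup>2 * (K\<^sup>2 * (t - s))))" for p \<eta>
      unfolding z_def
    proof (rule ito_increment_exp[OF rT])
      show "is_ito_integral M F (\<lambda>v \<omega>. B v \<omega> $ snd p) r t (\<lambda>s \<omega>. \<sigma> s (X s \<omega>) $ fst p $ snd p) (I t (fst p) (snd p))"
        "is_ito_integral M F (\<lambda>v \<omega>. B v \<omega> $ snd p) r s (\<lambda>s \<omega>. \<sigma> s (X s \<omega>) $ fst p $ snd p) (I s (fst p) (snd p))"
        using st by (auto intro!: I(1))
    qed (use st K in auto)
    have "exp (\<theta> * norm (N t \<omega> - N s \<omega>)) \<le> (\<Sum>p\<in>P. exp (\<theta> * m * z p \<omega>) + exp (- (\<theta> * m) * z p \<omega>))" for \<omega>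
    proof -
      have "norm (N t \<omega> - N s \<omega>) \<le> (\<Sum>i\<in>UNIV. \<bar>(N t \<omega> - N s \<omega>) $ i\<bar>)" by (rule norm_le_l1_cart)
      also have "\<dots> \<le> (\<Sum>i\<in>UNIV. \<Sum>j\<in>UNIV. \<bar>z (i, j) \<omega>\<bar>)"
        by (intro sum_mono) (auto simp: N_def z_def sum_subtractf[symmetric] intro!: sum_abs)
      also have "\<dots> = (\<Sum>p\<in>P. \<bar>z p \<omega>\<bar>)"
        unfolding P_def by (simp add: sum.cartesian_product flip: UNIV_Times_UNIV)
      finally have "exp (\<theta> * norm (N t \<omega> - N s \<omega>)) \<le> exp (\<theta> * (\<Sum>p\<in>P. \<bar>z p \<omega>\<bar>))"
        using \<theta> by (simp add: mult_left_mono)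
      also have "\<dots> \<le> (\<Sum>p\<in>P. exp (\<theta> * m * \<bar>z p \<omega>\<bar>))"
        unfolding m_def using \<theta> by (intro exp_sum_le_sum_exp) (auto simp: P_def)
      also have "\<dots> \<le> (\<Sum>p\<in>P. exp (\<theta> * m * z p \<omega>) + exp (- (\<theta> * m) * z p \<omega>))"
        using \<theta> by (intro sum_mono exp_abs_le) (auto simp: m)
      finally show ?thesis .
    qed
    then have "(\<integral>\<^sup>+\<omega>. ennreal (exp (\<theta> * norm (N t \<omega> - N s \<omega>))) \<partial>M) \<le>
        (\<integral>\<^sup>+\<omega>. (\<Sum>p\<in>P. ennreal (exp (\<theta> * m * z p \<omega>)) + ennreal (exp (- (\<theta> * m) * z p \<omega>))) \<partial>M)"
      by (intro nn_integral_mono) (simp add: sum_ennreal ennreal_leI flip: ennreal_plus)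
    also have "\<dots> = (\<Sum>p\<in>P. (\<integral>\<^sup>+\<omega>. ennreal (exp (\<theta> * m * z p \<omega>)) \<partial>M) +
        (\<integral>\<^sup>+\<omega>. ennreal (exp (- (\<theta> * m) * z p \<omega>)) \<partial>M))"
      by (subst nn_integral_sum) (auto simp: nn_integral_add)
    also have "\<dots> \<le> (\<Sum>p\<in>P. ennreal (exp ((\<theta> * m)\<^sup>2 * (K\<^sup>2 * (t - s)))) +
        ennreal (exp ((- (\<theta> * m))\<^sup>2 * (K\<^sup>2 * (t - s)))))"
      by (intro sum_mono add_mono zexp)
    also have "\<dots> = (\<Sum>p\<in>P. ennreal (2 * exp ((\<theta> * m)\<^sup>2 * (K\<^sup>2 * (t - s)))))"
      by (simp flip: ennreal_plus)
    also have "\<dots> = ennreal (2 * m * exp ((K * m)\<^sup>2 * (t - s) * \<theta>\<^sup>2))"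
      by (simp add: m_def power_mult_distrib mult_ac ennreal_of_nat_eq_real_of_nat flip: ennreal_mult')
    finally show "(\<integral>\<^sup>+\<omega>. ennreal (exp (\<theta> * norm (N t \<omega> - N s \<omega>))) \<partial>M) \<le>
        ennreal (2 * (real CARD('n))\<^sup>2 * exp ((K * (real CARD('n))\<^sup>2)\<^sup>2 * (t - s) * \<theta>\<^sup>2))"
      unfolding m .
  qed
qed

end

subsection \<open>Integrability of the Feynman-Kac functional\<close>

text \<open>In terms of \<open>R = 1 + sqrt l\<close> one has
  \<open>l \<ge> R\<^sup>2 / 2 - 1\<close>, and a power below 2 is eventually dominated by
  \<open>R\<^sup>2 / 2\<close>.\<close>

lemma exp_powr_absorb:
  fixes c p :: real
  assumes "c \<ge> 0" "0 < p" "p < 2"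
  obtains C where "C > 0" "\<And>l. l \<ge> 0 \<Longrightarrow> exp (c * (1 + sqrt l) powr p) \<le> C * exp l"
proof -
  \<comment> \<open>The solution of \<open>c * R powr p = R\<^sup>2 / 2\<close> for
    \<open>c > 0\<close>: above it the quadratic term wins, below it the left side is at most its
    value at \<open>R0\<close>.\<close>
  define R0 where "R0 = (2 * c) powr (1 / (2 - p))"
  have "exp (c * (1 + sqrt l) powr p) \<le> exp (c * R0 powr p + 1) * exp l" if l: "l \<ge> 0" for l
  proof -
    define R where "R = 1 + sqrt l"
    have R: "R \<ge> 1" using l by (simp add: R_def)
    have "l = (R - 1)\<^sup>2" using l by (simp add: R_def)
    then have lR: "R\<^sup>2 / 2 - 1 \<le> l" using zero_le_power2[of "R - 2"] by (simp add: power2_eq_square algebra_simps)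
    have cR: "c * R0 powr p \<ge> 0" using assms by simp
    have "c * R powr p \<le> c * R0 powr p + R\<^sup>2 / 2"
    proof (cases "R \<le> R0")
      case True
      then have "c * R powr p \<le> c * R0 powr p" using assms R by (intro mult_left_mono powr_mono2) auto
      then show ?thesis using zero_le_power2[of R] by linarith
    next
      case False
      have "2 * c = R0 powr (2 - p)" using assms by (simp add: R0_def powr_powr)
      also have "\<dots> \<le> R powr (2 - p)" using False assms by (intro powr_mono2) (auto simp: R0_def)
      finally have "2 * c * R powr p \<le> R powr (2 - p) * R powr p" by (intro mult_right_mono) auto
      also have "\<dots> = R\<^sup>2" using R by (simp add: powr_add[symmetric] powr_numeral)
      finally show ?thesis using cR by simp
    qed
    then show ?thesis using lR unfolding exp_add[symmetric] R_def[symmetric] by simp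
  qed
  then show thesis by (intro that[of "exp (c * R0 powr p + 1)"]) auto
qed

text \<open>Needed because \<open>fk_variable\<close> is under control only off a null set, where it
  equals an explicitly measurable function.\<close>

lemma completion_measurable_AE:
  assumes "g \<in> borel_measurable M" "AE \<omega> in M. f \<omega> = g \<omega>"
  shows "f \<in> borel_measurable (completion M)"
proof (rule borel_measurableI)
  fix S :: "'b set" assume S: "open S"
  have 1: "g -` S \<inter> space M \<in> sets (completion M)" using assms(1) S by (intro sets_completionI_sets measurable_sets) auto
  have 2: "AE \<omega> in completion M. \<omega> \<in> g -` S \<inter> space M \<longleftrightarrow> \<omega> \<in> f -` S \<inter> space M"
    using AE_completion[OF assms(2)] by eventually_elim auto
  show "f -` S \<inter> space (completion M) \<in> sets (completion M)"
    using completion.in_sets_AE[OF 2 1] by simp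
qed

text \<open>Almost surely the definite description behind the Young integral is the limit of Riemann
  sums over uniform partitions. These sums are measurable, hence so is \<open>lim\<close> of them as
  a total function, and \<open>fk_variable\<close> is measurable for the completion. Integrability
  is domination by a multiple of \<open>G\<close>.\<close>

lemma fk_variable_integrable:
  fixes X :: "real \<Rightarrow> 'w \<Rightarrow> 'a::real_normed_vector"
  assumes r: "0 \<le> r" "r \<le> T"
    and W: "\<And>t. t \<in> {0..T} \<Longrightarrow> continuous_on UNIV (W t)"
    and X: "\<And>t. t \<in> {r..T} \<Longrightarrow> X t \<in> borel_measurable M"
    and u: "u \<in> borel_measurable borel"
    and G: "G \<in> borel_measurable M" "(\<integral>\<^sup>+\<omega>. G \<omega> \<partial>M) < \<infinity>" and D: "D \<ge> 0"
    and ae: "AE \<omega> in M. \<exists>J. has_young_integral W (\<lambda>s. X s \<omega>) r T J \<and>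
      (\<lambda>n. \<Sum>k<Suc n.
        W (r + (T - r) * real (Suc k) / real (Suc n)) (X (r + (T - r) * real k / real (Suc n)) \<omega>) -
        W (r + (T - r) * real k / real (Suc n)) (X (r + (T - r) * real k / real (Suc n)) \<omega>)) \<longlonglongrightarrow> J \<and>
      \<bar>u (X T \<omega>)\<bar> * exp J \<le> D * enn2real (G \<omega>)"
  shows "(AE \<omega> in M. \<exists>J. has_young_integral W (\<lambda>s. X s \<omega>) r T J) \<and>
    has_bochner_integral (completion M) (fk_variable T W u r X)
      (LINT \<omega>|completion M. fk_variable T W u r X \<omega>)"
proof
  show "AE \<omega> in M. \<exists>J. has_young_integral W (\<lambda>s. X s \<omega>) r T J" using ae by eventually_elim blast
  define p where "p n k = r + (T - r) * real k / real (Suc n)" for n k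
  define S where "S n \<omega> = (\<Sum>k<Suc n. W (p n (Suc k)) (X (p n k) \<omega>) - W (p n k) (X (p n k) \<omega>))" for n \<omega>
  define Z where "Z \<omega> = u (X T \<omega>) * exp (lim (\<lambda>n. S n \<omega>))" for \<omega>
  have p: "p n k \<in> {r..T}" if "k \<le> Suc n" for n k
  proof -
    have "real k / real (Suc n) \<le> 1" using that by (simp del: of_nat_Suc)
    then have "(T - r) * (real k / real (Suc n)) \<le> (T - r) * 1" using r by (intro mult_left_mono) auto
    then show ?thesis using r by (auto simp: p_def)
  qed
  have WX: "(\<lambda>\<omega>. W t (X s \<omega>)) \<in> borel_measurable M" if "s \<in> {r..T}" "t \<in> {r..T}" for s t
    by (rule measurable_compose[OF X borel_measurable_continuous_onI[OF W]]) (use that r in auto)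
  have "S n \<in> borel_measurable M" for n
    unfolding S_def using p by (intro borel_measurable_sum borel_measurable_diff WX) auto
  moreover have "(\<lambda>\<omega>. u (X T \<omega>)) \<in> borel_measurable M"
    by (rule measurable_compose[OF X u]) (use r in auto)
  ultimately have Zm: "Z \<in> borel_measurable M" unfolding Z_def by measurable
  have eq: "AE \<omega> in M. fk_variable T W u r X \<omega> = Z \<omega> \<and> \<bar>fk_variable T W u r X \<omega>\<bar> \<le> D * enn2real (G \<omega>)"
    using ae
  proof eventually_elim
    case (elim \<omega>)
    then obtain J where J: "has_young_integral W (\<lambda>s. X s \<omega>) r T J" "(\<lambda>n. S n \<omega>) \<longlonglongrightarrow> J"
      "\<bar>u (X T \<omega>)\<bar> * exp J \<le> D * enn2real (G \<omega>)" unfolding S_def p_def by blast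
    have "young_integral W (\<lambda>s. X s \<omega>) r T = J" by (rule young_integral_eq[OF r(2) J(1)])
    moreover have "lim (\<lambda>n. S n \<omega>) = J" by (rule limI[OF J(2)])
    ultimately show ?case using J(3) by (simp add: fk_variable_def Z_def abs_mult)
  qed
  have fm: "fk_variable T W u r X \<in> borel_measurable (completion M)"
    by (rule completion_measurable_AE[OF Zm]) (use eq in \<open>eventually_elim, simp\<close>)
  have "integrable (completion M) (fk_variable T W u r X)"
  proof (rule integrableI_bounded[OF fm])
    have "(\<integral>\<^sup>+\<omega>. ennreal (norm (fk_variable T W u r X \<omega>)) \<partial>completion M) =
        (\<integral>\<^sup>+\<omega>. ennreal (norm (fk_variable T W u r X \<omega>)) \<partial>M)" by (rule nn_integral_completion)
    also have "\<dots> \<le> (\<integral>\<^sup>+\<omega>. ennreal D * G \<omega> \<partial>M)"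
    proof (rule nn_integral_mono_AE)
      show "AE \<omega> in M. ennreal (norm (fk_variable T W u r X \<omega>)) \<le> ennreal D * G \<omega>"
        using eq
      proof eventually_elim
        case (elim \<omega>)
        have "ennreal (norm (fk_variable T W u r X \<omega>)) \<le> ennreal (D * enn2real (G \<omega>))"
          using conjunct2[OF elim] by (intro ennreal_leI) (simp only: real_norm_def)
        also have "\<dots> = ennreal D * ennreal (enn2real (G \<omega>))" using D by (intro ennreal_mult) auto
        also have "\<dots> \<le> ennreal D * G \<omega>" by (intro mult_left_mono) (auto simp: ennreal_enn2real_if)
        finally show ?case .
      qed
    qed
    also have "\<dots> = ennreal D * (\<integral>\<^sup>+\<omega>. G \<omega> \<partial>M)" by (rule nn_integral_cmult[OF G(1)])
    also have "\<dots> < \<infinity>" using G(2) by (simp add: ennreal_mult_less_top)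
    finally show "(\<integral>\<^sup>+\<omega>. ennreal (norm (fk_variable T W u r X \<omega>)) \<partial>completion M) < \<infinity>" .
  qed
  then show "has_bochner_integral (completion M) (fk_variable T W u r X)
      (LINT \<omega>|completion M. fk_variable T W u r X \<omega>)" by (rule has_bochner_integral_integrable)
qed

text \<open>With \<open>R = 1 + sqrt l \<ge> 1\<close> every base in the Young bound is at most a
  constant times \<open>R\<close>, so both terms are of degree \<beta> + \<lambda>, and the bound on
  \<open>u\<close> contributes degree \<open>\<alpha>\<^sub>0\<close> in the exponent. The larger of
  the two degrees is below 2 and is absorbed by \<open>exp l\<close>.\<close>

lemma fk_variable_growth:
  fixes S H R w :: real
  assumes SH: "S > 0" "H > 0" and w: "w \<ge> 0" and T: "T > 0" and beta: "\<beta> > 0" and lam: "lam > 0"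
    and mu: "\<tau> + lam * \<gamma> > 1" and p: "\<beta> + lam < 2" "0 < \<alpha>\<^sub>0" "\<alpha>\<^sub>0 < 2"
    and u: "\<And>x :: 'a::real_normed_vector. \<bar>u x\<bar> \<le> C\<^sub>2 * exp (C\<^sub>1 * norm x powr \<alpha>\<^sub>0)"
  obtains D where "D \<ge> 0" "\<And>J z l. l \<ge> 0 \<Longrightarrow> norm z \<le> S * (1 + sqrt l) \<Longrightarrow>
      \<bar>J\<bar> \<le> w * (1 + S * (1 + sqrt l)) powr (\<beta> + lam) * T powr \<tau> + 2 / (1 - 2 powr (1 - (\<tau> + lam * \<gamma>))) *
        (w * (1 + 2 * (S * (1 + sqrt l))) powr \<beta> * (H * (1 + sqrt l)) powr lam) * T powr (\<tau> + lam * \<gamma>) \<Longrightarrow>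
      \<bar>u z\<bar> * exp J \<le> D * exp l"
proof -
  define \<mu> where "\<mu> = \<tau> + lam * \<gamma>"
  define C where "C = 2 / (1 - 2 powr (1 - \<mu>))"
  define p where "p = max \<alpha>\<^sub>0 (\<beta> + lam)"
  define c1 where "c1 = \<bar>C\<^sub>1\<bar> * S powr \<alpha>\<^sub>0"
  define c2 where "c2 = w * (1 + S) powr (\<beta> + lam) * T powr \<tau> +
      C * (w * (1 + 2 * S) powr \<beta> * H powr lam) * T powr \<mu>"
  have "(2::real) powr (1 - \<mu>) < 2 powr 0" using mu by (intro powr_less_mono) (auto simp: \<mu>_def)
  then have C: "C > 0" by (auto simp: C_def)
  have c12: "c1 \<ge> 0" "c2 \<ge> 0" using C w by (auto simp: c1_def c2_def intro!: add_nonneg_nonneg mult_nonneg_nonneg)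
  obtain D where D: "D > 0" "\<And>l. l \<ge> 0 \<Longrightarrow> exp ((c1 + c2) * (1 + sqrt l) powr p) \<le> D * exp l"
  proof (rule exp_powr_absorb[of "c1 + c2" p])
    show "0 \<le> c1 + c2" using c12 by simp
    show "0 < p" "p < 2" using assms(8-10) by (auto simp: p_def less_max_iff_disj)
  qed (rule that)
  show thesis
  proof (rule that[of "\<bar>C\<^sub>2\<bar> * D"])
    show "\<bar>C\<^sub>2\<bar> * D \<ge> 0" using D by simp
    fix J l and z :: 'a assume l: "l \<ge> 0" and z: "norm z \<le> S * (1 + sqrt l)" and
      J: "\<bar>J\<bar> \<le> w * (1 + S * (1 + sqrt l)) powr (\<beta> + lam) * T powr \<tau> + 2 / (1 - 2 powr (1 - (\<tau> + lam * \<gamma>))) *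
        (w * (1 + 2 * (S * (1 + sqrt l))) powr \<beta> * (H * (1 + sqrt l)) powr lam) * T powr (\<tau> + lam * \<gamma>)"
    define R where "R = 1 + sqrt l"
    have R: "R \<ge> 1" using l by (simp add: R_def)
    have le1: "1 + S * R \<le> (1 + S) * R" "1 + 2 * (S * R) \<le> (1 + 2 * S) * R" using R by (auto simp: algebra_simps)
    have "(1 + S * R) powr (\<beta> + lam) \<le> ((1 + S) * R) powr (\<beta> + lam)"
      using le1 beta lam SH R by (intro powr_mono2) auto
    then have a: "(1 + S * R) powr (\<beta> + lam) \<le> (1 + S) powr (\<beta> + lam) * R powr (\<beta> + lam)"
      by (simp add: powr_mult)
    have "(1 + 2 * (S * R)) powr \<beta> \<le> ((1 + 2 * S) * R) powr \<beta>"
      using le1 beta SH R by (intro powr_mono2) auto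
    then have "(1 + 2 * (S * R)) powr \<beta> * (H * R) powr lam \<le> ((1 + 2 * S) * R) powr \<beta> * (H * R) powr lam"
      by (rule mult_right_mono) simp
    also have "\<dots> = (1 + 2 * S) powr \<beta> * H powr lam * R powr (\<beta> + lam)"
      by (simp add: powr_mult powr_add mult_ac)
    finally have b: "(1 + 2 * (S * R)) powr \<beta> * (H * R) powr lam \<le>
        (1 + 2 * S) powr \<beta> * H powr lam * R powr (\<beta> + lam)" .
    have "J \<le> w * (1 + S * R) powr (\<beta> + lam) * T powr \<tau> +
        C * (w * ((1 + 2 * (S * R)) powr \<beta> * (H * R) powr lam)) * T powr \<mu>"
      using J unfolding C_def \<mu>_def R_def by (simp only: mult.assoc)
    also have "\<dots> \<le> w * ((1 + S) powr (\<beta> + lam) * R powr (\<beta> + lam)) * T powr \<tau> +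
        C * (w * ((1 + 2 * S) powr \<beta> * H powr lam * R powr (\<beta> + lam))) * T powr \<mu>"
      using a b w C by (intro add_mono mult_right_mono mult_left_mono) auto
    also have "\<dots> = c2 * R powr (\<beta> + lam)" by (simp add: c2_def algebra_simps)
    also have "\<dots> \<le> c2 * R powr p" using c12 R by (intro mult_left_mono powr_mono) (auto simp: p_def)
    finally have J': "J \<le> c2 * R powr p" .
    have "C\<^sub>1 * norm z powr \<alpha>\<^sub>0 \<le> \<bar>C\<^sub>1\<bar> * (S * R) powr \<alpha>\<^sub>0"
      using z assms(9) by (intro mult_mono powr_mono2) (auto simp: R_def)
    also have "\<dots> = c1 * R powr \<alpha>\<^sub>0" by (simp add: c1_def powr_mult)
    also have "\<dots> \<le> c1 * R powr p" using c12 R by (intro mult_left_mono powr_mono) (auto simp: p_def)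
    finally have u': "C\<^sub>1 * norm z powr \<alpha>\<^sub>0 \<le> c1 * R powr p" .
    have "\<bar>u z\<bar> \<le> \<bar>C\<^sub>2\<bar> * exp (c1 * R powr p)"
      using u[of z] u' by (intro order_trans[OF u[of z]] mult_mono) auto
    then have "\<bar>u z\<bar> * exp J \<le> \<bar>C\<^sub>2\<bar> * exp (c1 * R powr p) * exp (c2 * R powr p)"
      using J' by (intro mult_mono) auto
    also have "\<dots> = \<bar>C\<^sub>2\<bar> * exp ((c1 + c2) * R powr p)" by (simp add: exp_add[symmetric] distrib_right)
    also have "\<dots> \<le> \<bar>C\<^sub>2\<bar> * (D * exp l)" using D(2)[OF l] by (intro mult_left_mono) (auto simp: R_def)
    finally show "\<bar>u z\<bar> * exp J \<le> \<bar>C\<^sub>2\<bar> * D * exp l" by (simp add: mult.assoc)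
  qed
qed

theorem proposition4p13:
  fixes M :: "'w measure" and F :: "real \<Rightarrow> 'w measure"
    and B :: "real \<Rightarrow> 'w \<Rightarrow> real ^ 'n"
    and a \<sigma> :: "real \<Rightarrow> real ^ 'n \<Rightarrow> real ^ 'n ^ 'n"
    and b :: "real \<Rightarrow> real ^ 'n \<Rightarrow> real ^ 'n"
    and X :: "real \<Rightarrow> real ^ 'n \<Rightarrow> real \<Rightarrow> 'w \<Rightarrow> real ^ 'n"
    and W :: "real \<Rightarrow> real ^ 'n \<Rightarrow> real"
    and u\<^sub>T :: "real ^ 'n \<Rightarrow> real"
    and T lam\<^sub>L \<Lambda> \<alpha> \<kappa> \<tau> lam \<beta> \<alpha>\<^sub>0 C\<^sub>1 C\<^sub>2 :: real
  assumes T: "T > 0"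
    and sigma: "\<forall>t\<in>{0..T}. \<forall>x. is_sqrt_matrix (\<sigma> t x) (a t x)"
    and L1: "lam\<^sub>L > 0" "\<Lambda> > 0"
      "\<forall>t\<in>{0..T}. \<forall>x \<xi>. lam\<^sub>L * (norm \<xi>)\<^sup>2 \<le> (\<Sum>i\<in>UNIV. \<Sum>j\<in>UNIV. a t x $ i $ j * \<xi> $ i * \<xi> $ j)
         \<and> (\<Sum>i\<in>UNIV. \<Sum>j\<in>UNIV. a t x $ i $ j * \<xi> $ i * \<xi> $ j) \<le> \<Lambda> * (norm \<xi>)\<^sup>2"
    and L2: "0 < \<alpha>" "\<alpha> < 1" "(SUP t\<in>{0..T}. Cb2_norm \<alpha> (a t)) \<le> ennreal \<Lambda>"
    and L3: "\<kappa> > 0"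
      "\<forall>t\<in>{0..T}. \<forall>i x. \<bar>b t x $ i\<bar> \<le> \<kappa> * (1 + norm x)"
      "\<forall>t\<in>{0..T}. \<forall>i x y. \<bar>b t y $ i - b t x $ i\<bar> \<le> \<kappa> * norm (y - x)"
    and B: "brownian_motion M F B"
    and X: "\<forall>r\<in>{0..T}. \<forall>x. sde_solution M F B \<sigma> b T r x (X r x)"
    and tau: "0 < \<tau>" "\<tau> \<le> 1" and lambda: "0 < lam" "lam \<le> 1" and beta: "0 < \<beta>"
    and exponents: "\<tau> + lam / 2 > 1" "\<beta> + lam < 2"
    and W: "W_norm T \<tau> lam \<beta> W < \<infinity>"
    and uT_measurable: "u\<^sub>T \<in> borel_measurable borel"
    and alpha0: "0 < \<alpha>\<^sub>0" "\<alpha>\<^sub>0 < 2"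
    and uT_bound: "\<forall>x. \<bar>u\<^sub>T x\<bar> \<le> C\<^sub>2 * exp (C\<^sub>1 * norm x powr \<alpha>\<^sub>0)"
  shows "\<forall>r\<in>{0..T}. \<forall>x.
      (AE \<omega> in M. \<exists>J. has_young_integral W (\<lambda>s. X r x s \<omega>) r T J) \<and>
      has_bochner_integral (completion M) (fk_variable T W u\<^sub>T r (X r x)) (fk_u M T W u\<^sub>T X r x)"
proof (intro ballI allI)
  fix r x assume "r \<in> {0..T}"
  then have r: "0 \<le> r" "r \<le> T" by auto
  interpret brownian_motion M F B by (rule B)
  have sol: "sde_solution M F B \<sigma> b T r x (X r x)" using X r by auto
  have Xm: "X r x t \<in> borel_measurable M" if "t \<in> {r..T}" for t
    using sol that by (intro F_measurable_M[of _ t]) (auto simp: sde_solution_def)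
  have start: "AE \<omega> in M. X r x r \<omega> = x" using sol by (simp add: sde_solution_def)
  obtain w where w: "w \<ge> 0"
    "\<And>s t x y. 0 \<le> s \<Longrightarrow> s \<le> t \<Longrightarrow> t \<le> T \<Longrightarrow> \<bar>W s x - W t x - W s y + W t y\<bar>
        \<le> w * (1 + norm x + norm y) powr \<beta> * (t - s) powr \<tau> * norm (x - y) powr lam"
    "\<And>s t x. 0 \<le> s \<Longrightarrow> s \<le> t \<Longrightarrow> t \<le> T \<Longrightarrow> \<bar>W s x - W t x\<bar>
        \<le> w * (1 + norm x) powr (\<beta> + lam) * (t - s) powr \<tau>"
    "\<And>t x y. 0 \<le> t \<Longrightarrow> t \<le> T \<Longrightarrow> \<bar>W t y - W t x\<bar>
        \<le> w * (1 + norm x + norm y) powr \<beta> * norm (x - y) powr lam"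
    by (rule W_norm_bounds[OF W], rule that)
  have Wc: "continuous_on UNIV (W t)" if "t \<in> {0..T}" for t
    using w(4) that by (intro hoelder_weight_continuous[OF lambda(1) w(1)]) auto
  show "(AE \<omega> in M. \<exists>J. has_young_integral W (\<lambda>s. X r x s \<omega>) r T J) \<and>
      has_bochner_integral (completion M) (fk_variable T W u\<^sub>T r (X r x)) (fk_u M T W u\<^sub>T X r x)"
    unfolding fk_u_def
  proof (cases "r = T")
    \<comment> \<open>At the terminal time the Young integral is 0 and the solution equals
      \<open>x\<close> almost surely, so a constant majorant suffices. The dyadic construction
      requires an interval of positive length.\<close>
    case True
    show "(AE \<omega> in M. \<exists>J. has_young_integral W (\<lambda>s. X r x s \<omega>) r T J) \<and>
      has_bochner_integral (completion M) (fk_variable T W u\<^sub>T r (X r x))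
        (LINT \<omega>|completion M. fk_variable T W u\<^sub>T r (X r x) \<omega>)"
    proof (rule fk_variable_integrable[OF r Wc Xm uT_measurable, where G = "\<lambda>_. 1" and D = "\<bar>u\<^sub>T x\<bar>"])
      show "AE \<omega> in M. \<exists>J. has_young_integral W (\<lambda>s. X r x s \<omega>) r T J \<and>
        (\<lambda>n. \<Sum>k<Suc n.
          W (r + (T - r) * real (Suc k) / real (Suc n)) (X r x (r + (T - r) * real k / real (Suc n)) \<omega>) -
          W (r + (T - r) * real k / real (Suc n)) (X r x (r + (T - r) * real k / real (Suc n)) \<omega>)) \<longlonglongrightarrow> J \<and>
        \<bar>u\<^sub>T (X r x T \<omega>)\<bar> * exp J \<le> \<bar>u\<^sub>T x\<bar> * enn2real 1"
        unfolding True[symmetric] using start by eventually_elim (auto intro!: exI[of _ 0] has_young_integral_refl)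
    qed (auto simp: emeasure_space_1)
  next
    case False
    then have rT: "r < T" using r by simp
    \<comment> \<open>\<open>\<gamma>\<^sub>0\<close> is the critical exponent, where \<tau> +
      \<lambda>\<gamma> equals 1. It is below 1/2 by assumption, and \<gamma> is taken halfway
      between the two.\<close>
    define \<gamma>\<^sub>0 where "\<gamma>\<^sub>0 = (1 - \<tau>) / lam"
    define \<gamma> where "\<gamma> = (\<gamma>\<^sub>0 + 1 / 2) / 2"
    have "\<gamma>\<^sub>0 < 1 / 2" "\<gamma>\<^sub>0 \<ge> 0" using exponents tau lambda by (simp_all add: \<gamma>\<^sub>0_def field_simps)
    then have gam: "0 < \<gamma>" "\<gamma> < 1/2" "\<gamma>\<^sub>0 < \<gamma>" by (simp_all add: \<gamma>_def)
    then have mu: "\<tau> + lam * \<gamma> > 1" using lambda by (simp add: \<gamma>\<^sub>0_def field_simps)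
    have K: "\<bar>\<sigma> s y $ i $ j\<bar> \<le> sqrt \<Lambda>" if "s \<in> {r..T}" for s y i j
      using that r sigma L1 by (intro is_sqrt_matrix_entry_bound[of _ "a s y"]) auto
    obtain N where N: "\<And>t. t \<in> {r..T} \<Longrightarrow> N t \<in> borel_measurable M"
      "\<And>t. t \<in> {r..T} \<Longrightarrow> AE \<omega> in M. \<forall>i.
           set_integrable lborel {r..t} (\<lambda>s. b s (X r x s \<omega>) $ i) \<and>
           X r x t \<omega> $ i = x $ i + N t \<omega> $ i + (LINT s:{r..t}|lborel. b s (X r x s \<omega>) $ i)"
      "\<And>s t \<theta>. r \<le> s \<Longrightarrow> s < t \<Longrightarrow> t \<le> T \<Longrightarrow> \<theta> \<ge> 0 \<Longrightarrow>
        (\<integral>\<^sup>+\<omega>. ennreal (exp (\<theta> * norm (N t \<omega> - N s \<omega>))) \<partial>M) \<le>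
        ennreal (2 * (real CARD('n))\<^sup>2 * exp ((sqrt \<Lambda> * (real CARD('n))\<^sup>2)\<^sup>2 * (t - s) * \<theta>\<^sup>2))"
      by (rule sde_noise[OF r(1) sol K], assumption, rule that)
    have k0: "0 \<le> (sqrt \<Lambda> * (real CARD('n))\<^sup>2)\<^sup>2" "0 \<le> 2 * (real CARD('n))\<^sup>2" by auto
    obtain c G where c: "c > 0" and G: "G \<in> borel_measurable M" "(\<integral>\<^sup>+\<omega>. G \<omega> \<partial>M) < \<infinity>" "\<And>\<omega>. 1 \<le> G \<omega>"
      and inc: "\<And>n k \<omega>. k < (2::nat) ^ n \<Longrightarrow> G \<omega> < \<infinity> \<Longrightarrow>
        norm (N (r + (T - r) * (real (Suc k) / 2 ^ n)) \<omega> - N (r + (T - r) * (real k / 2 ^ n)) \<omega>)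
        \<le> c * (1 + sqrt (ln (enn2real (G \<omega>)))) * (2 powr - \<gamma>) ^ n"
      by (rule dyadic_increments[OF N(1) rT k0 gam(1,2) N(3)], assumption+, rule that)
    define d where "d n k = r + (T - r) * (real k / 2 ^ n)" for n k :: nat
    have d: "d n k \<in> {r..T}" if "k \<le> 2 ^ n" for n k
    proof -
      have "real k \<le> 2 ^ n" using that by (metis of_nat_le_iff of_nat_numeral of_nat_power)
      then have "(T - r) * (real k / 2 ^ n) \<le> (T - r) * 1" using rT by (intro mult_left_mono) auto
      then show ?thesis using rT by (auto simp: d_def)
    qed
    have "AE \<omega> in M. k \<le> 2 ^ n \<longrightarrow> (\<forall>i.
           set_integrable lborel {r..d n k} (\<lambda>s. b s (X r x s \<omega>) $ i) \<and>
           X r x (d n k) \<omega> $ i = x $ i + N (d n k) \<omega> $ i + (LINT s:{r..d n k}|lborel. b s (X r x s \<omega>) $ i))"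
      for n k
      using N(2)[OF d, of k n] by (cases "k \<le> 2 ^ n") auto
    \<comment> \<open>Dyadic times are countable, so one null set serves all of them.\<close>
    then have eqn: "AE \<omega> in M. \<forall>n k. k \<le> 2 ^ n \<longrightarrow> (\<forall>i.
           set_integrable lborel {r..d n k} (\<lambda>s. b s (X r x s \<omega>) $ i) \<and>
           X r x (d n k) \<omega> $ i = x $ i + N (d n k) \<omega> $ i + (LINT s:{r..d n k}|lborel. b s (X r x s \<omega>) $ i))"
      by (simp add: AE_all_countable)
    have fin: "AE \<omega> in M. G \<omega> \<noteq> \<infinity>" using G(1,2) by (intro nn_integral_PInf_AE) auto
    have cont: "AE \<omega> in M. continuous_on {r..T} (\<lambda>t. X r x t \<omega>)" using sol by (simp add: sde_solution_def)
    define c\<gamma> where "c\<gamma> = (2 / (1 - 2 powr - \<gamma>) + 1) * 2 powr \<gamma> * c"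
    define e where "e = real CARD('n) * \<kappa>"
    define S where "S = 2 * (1 + norm x + c\<gamma>) * exp (2 * e * (T - r))"
    define H where "H = c\<gamma> * (T - r) powr (- \<gamma>) + e * S * (T - r) powr (1 - \<gamma>)"
    define R where "R \<omega> = 1 + sqrt (ln (enn2real (G \<omega>)))" for \<omega>
    have path: "AE \<omega> in M. G \<omega> \<noteq> \<infinity> \<and> R \<omega> \<ge> 1 \<and> S > 0 \<and> H > 0 \<and>
      (\<forall>t\<in>{r..T}. norm (X r x t \<omega>) \<le> S * R \<omega>) \<and>
      (\<forall>s t. r \<le> s \<longrightarrow> s \<le> t \<longrightarrow> t \<le> T \<longrightarrow> norm (X r x t \<omega> - X r x s \<omega>) \<le> H * R \<omega> * (t - s) powr \<gamma>)"
      using eqn fin cont start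
    proof eventually_elim
      case (elim \<omega>)
      have "enn2real (G \<omega>) \<ge> 1"
        using enn2real_mono[OF G(3)[of \<omega>]] elim(2) by (simp add: top.not_eq_extremum)
      then have R: "R \<omega> \<ge> 1" by (simp add: R_def)
      have si: "set_integrable lborel {r..d n k} (\<lambda>s. b s (X r x s \<omega>) $ i)" if "k \<le> 2 ^ n" for n k i
        using elim(1) that by blast
      \<comment> \<open>The instance \<open>k = 1\<close>, \<open>n = 0\<close> is the time
        \<open>T\<close>, which gives integrability on the whole interval.\<close>
      have int: "(\<lambda>s. b s (X r x s \<omega>) $ i) integrable_on {r..T}" for i
        using set_borel_integral_eq_integral(1)[OF si[of 1 0 i]] by (simp add: d_def)
      have bb: "\<bar>b s (X r x s \<omega>) $ i\<bar> \<le> \<kappa> * (1 + norm (X r x s \<omega>))" if "s \<in> {r..T}" for s i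
        using L3(2) that r by auto
      have eq: "X r x (d n k) \<omega> $ i = x $ i + N (d n k) \<omega> $ i + integral {r..d n k} (\<lambda>s. b s (X r x s \<omega>) $ i)"
        if "k \<le> 2 ^ n" for n k i
        using elim(1) that set_borel_integral_eq_integral(2)[OF si[OF that, of i]] by auto
      have gam1: "\<gamma> < 1" using gam by simp
      have G': "G \<omega> < \<infinity>" using elim(2) by (simp add: top.not_eq_extremum)
      note pr = path_regularity[of r T "\<lambda>t. X r x t \<omega>" x \<kappa> c \<gamma> "R \<omega>" "\<lambda>s. b s (X r x s \<omega>)" "\<lambda>t. N t \<omega>",
        OF rT elim(3,4) L3(1) c gam(1) gam1 R int bb eq[unfolded d_def] inc[OF _ G', folded R_def],
        folded c\<gamma>_def e_def, folded S_def, folded H_def]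
      show ?case using elim(2) R pr by blast
    qed
    \<comment> \<open>\<open>S\<close> and \<open>H\<close> do not depend on \<omega>, so their
      almost sure positivity on a probability space is plain positivity.\<close>
    have SH: "S > 0" "H > 0"
    proof -
      have "AE \<omega> in M. S > 0 \<and> H > 0" using path by eventually_elim blast
      then show "S > 0" "H > 0" by (auto simp: AE_const)
    qed
    obtain D where D: "D \<ge> 0" "\<And>J (z :: real ^ 'n) l. l \<ge> 0 \<Longrightarrow> norm z \<le> S * (1 + sqrt l) \<Longrightarrow>
      \<bar>J\<bar> \<le> w * (1 + S * (1 + sqrt l)) powr (\<beta> + lam) * T powr \<tau> + 2 / (1 - 2 powr (1 - (\<tau> + lam * \<gamma>))) *
        (w * (1 + 2 * (S * (1 + sqrt l))) powr \<beta> * (H * (1 + sqrt l)) powr lam) * T powr (\<tau> + lam * \<gamma>) \<Longrightarrow>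
      \<bar>u\<^sub>T z\<bar> * exp J \<le> D * exp l"
      by (rule fk_variable_growth[OF SH w(1) T beta lambda(1) mu exponents(2) alpha0 uT_bound[rule_format]], rule that)
    show "(AE \<omega> in M. \<exists>J. has_young_integral W (\<lambda>s. X r x s \<omega>) r T J) \<and>
      has_bochner_integral (completion M) (fk_variable T W u\<^sub>T r (X r x))
        (LINT \<omega>|completion M. fk_variable T W u\<^sub>T r (X r x) \<omega>)"
    proof (rule fk_variable_integrable[OF r Wc Xm uT_measurable G(1,2) D(1)])
      show "AE \<omega> in M. \<exists>J. has_young_integral W (\<lambda>s. X r x s \<omega>) r T J \<and>
        (\<lambda>n. \<Sum>k<Suc n.
          W (r + (T - r) * real (Suc k) / real (Suc n)) (X r x (r + (T - r) * real k / real (Suc n)) \<omega>) -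
          W (r + (T - r) * real k / real (Suc n)) (X r x (r + (T - r) * real k / real (Suc n)) \<omega>)) \<longlonglongrightarrow> J \<and>
        \<bar>u\<^sub>T (X r x T \<omega>)\<bar> * exp J \<le> D * enn2real (G \<omega>)"
        using path
      proof eventually_elim
        case (elim \<omega>)
        \<comment> \<open>With this \<open>l\<close> the random factor \<open>R\<close> is
          \<open>1 + sqrt l\<close> and \<open>exp l\<close> is \<open>G\<close> itself, so the
          growth bound ends in the integrable majorant.\<close>
        define l where "l = ln (enn2real (G \<omega>))"
        have "enn2real (G \<omega>) \<ge> 1"
          using enn2real_mono[OF G(3)[of \<omega>]] elim by (simp add: top.not_eq_extremum)
        then have l: "l \<ge> 0" "exp l = enn2real (G \<omega>)" by (auto simp: l_def)
        have Rl: "R \<omega> = 1 + sqrt l" by (simp add: R_def l_def)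
        obtain J where J: "has_young_integral W (\<lambda>s. X r x s \<omega>) r T J"
          "\<bar>J\<bar> \<le> w * (1 + S * R \<omega>) powr (\<beta> + lam) * T powr \<tau> + 2 / (1 - 2 powr (1 - (\<tau> + lam * \<gamma>))) *
            (w * (1 + 2 * (S * R \<omega>)) powr \<beta> * (H * R \<omega>) powr lam) * T powr (\<tau> + lam * \<gamma>)"
          "(\<lambda>n. \<Sum>k<Suc n.
            W (r + (T - r) * real (Suc k) / real (Suc n)) (X r x (r + (T - r) * real k / real (Suc n)) \<omega>) -
            W (r + (T - r) * real k / real (Suc n)) (X r x (r + (T - r) * real k / real (Suc n)) \<omega>)) \<longlonglongrightarrow> J"
        proof (rule young_integral_exists[OF r w(1) beta lambda(1) gam(1) tau(1) mu w(2,3)])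
          show "0 \<le> H * R \<omega>" using SH elim by simp
          show "norm (X r x t \<omega> - X r x s \<omega>) \<le> H * R \<omega> * (t - s) powr \<gamma>" if "r \<le> s" "s \<le> t" "t \<le> T" for s t
            using elim that by blast
          show "norm (X r x s \<omega>) \<le> S * R \<omega>" if "r \<le> s" "s \<le> T" for s using elim that by auto
        qed
        have "\<bar>u\<^sub>T (X r x T \<omega>)\<bar> * exp J \<le> D * exp l"
          by (rule D(2)[OF l(1)]) (use elim r J(2) in \<open>auto simp: Rl\<close>)
        then show ?case using J(1,3) l(2) by auto
      qed
    qed
  qed
qed

end
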